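(* Up to isomorphism of MR geometries and interchanging the two colours, the only MR geometries on $v\le 15$ points are the following ten: $\mathsf{MR}_{12}$, $\mathsf{MR}_{13}$, $\mathsf{MR}_{14}^1$, $\mathsf{MR}_{14}^2$, $\mathsf{MR}_{15}^1$, $\mathsf{MR}_{15}^2$, $\mathsf{MR}_{15}^{3\mathsf r}$, $\mathsf{MR}_{15}^{3\mathsf g}$, $\mathsf{MR}_{15}^4$, $\mathsf{MR}_{15}^5$, as defined in the context.
   Context: A finite linear space (f.l.s.) consists of a finite set of points and a set of lines (sets of points) such that any two distinct points lie on exactly one common line, every line has at least two points, and not all points are on one line. For a set $T$ of points not all on one line, the subspace induced by $T$ has point set $T$ and lines the sets $\ell\cap T$ with $|\ell\cap T|\ge2$. An MR geometry is an f.l.s. together with a colouring of each point red or green such that every line contains at least one red and at least one green point. An isomorphism of MR geometries is an isomorphism of the underlying f.l.s. mapping red points to red points and green to green. $\mathsf{PG}(2,3)$: let $A,B,C,D$ be four points of the projective plane of order $3$, no three collinear, and $E=AB\cap CD$, $F=AC\cap BD$, $H=AD\cap BC$. $\mathsf{MR}_{13}$ is $\mathsf{PG}(2,3)$ with $A,B,C,D,E,F,H$ green and the remaining six points red. $\mathsf{MR}_{12}$ is the subspace of $\mathsf{MR}_{13}$ induced by all points except $H$, with the inherited colouring. $\mathsf{PG}(2,4)$ is represented with point set $\{i_j : i\in\mathbb Z_7, j\in\mathbb Z_3\}$ and the $21$ lines $\{i_j,(i+1)_j,(i+3)_j,f(i)_{j+1},f(i)_{j+2}\}$ ($i\in\mathbb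 Z_7$, $j\in\mathbb Z_3$), where $f(0)=6,f(1)=3,f(2)=0,f(3)=5,f(4)=1,f(5)=2,f(6)=4$. All MR geometries below (except $\mathsf{MR}_{15}^2$) are subspaces of $\mathsf{PG}(2,4)$ induced by the listed point sets. $\mathsf{MR}_{14}^1$: points $\{i_0\}\cup\{i_1\}$ ($i\in\mathbb Z_7$), each $i_0$ green, each $i_1$ red. $\mathsf{MR}_{14}^2$: points $\{i_0:i\in\mathbb Z_7\}\cup\{2_1,4_1,5_1,6_1,0_2,1_2,3_2\}$, each $i_0$ green, the others red. $\mathsf{MR}_{15}^1$: points of $\mathsf{MR}_{14}^1$ together with $6_2$, coloured as in $\mathsf{MR}_{14}^1$ and $6_2$ green. $\mathsf{MR}_{15}^2$: take $\mathsf{MR}_{14}^1$ (in which each $\{i_0,i_1\}$ is a $2$-point line), add a new green point $\infty$, and replace each line $\{i_0,i_1\}$ ($i\in\mathbb Z_7$) by $\{i_0,i_1,\infty\}$; all other lines unchanged. $\mathsf{MR}_{15}^{3\mathsf r}$ and $\mathsf{MR}_{15}^{3\mathsf g}$: points of $\mathsf{MR}_{14}^2$ together with $4_2$, coloured as in $\mathsf{MR}_{14}^2$ with $4_2$ red, respectively green. $\mathsf{MR}_{15}^4$: points of $\mathsf{MR}_{14}^2$ together with $3_1$, with $3_1$ red. $\mathsf{MR}_{15}^5$: all points of $\mathsf{PG}(2,4)$ except $0_1,1_1,3_1,6_2,0_2,3_2$; green points $0_0,1_0,3_0,4_0,5_1,1_2,5_2$; red points $2_0,5_0,6_0,2_1,4_1,6_1,2_2,4_2$.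 *)

theory Defs
  imports Main
begin

record 'a incidence =
  points :: "'a set"
  lines :: "'a set set"

(* The bound on card (points S) is part of "not all points are on one line": a set of
   at most one point counts as lying on a line, even if lines S is empty. *)
definition finite_linear_space :: "('a, 'b) incidence_scheme \<Rightarrow> bool" where
  "finite_linear_space S \<longleftrightarrow>
     finite (points S) \<and>
     (\<forall>l\<in>lines S. l \<subseteq> points S) \<and>
     (\<forall>x\<in>points S. \<forall>y\<in>points S. x \<noteq> y \<longrightarrow> (\<exists>!l. l \<in> lines S \<and> x \<in> l \<and> y \<in> l)) \<and>
     (\<forall>l\<in>lines S. card l \<ge> 2) \<and>
     card (points S) \<ge> 2 \<and> \<not> (\<exists>l\<in>lines S. points S \<subseteq> l)"

(* Record update keeps the extension fields, so a coloured space passes its colouring on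
   to its subspaces. *)
definition induced_subspace :: "('a, 'b) incidence_scheme \<Rightarrow> 'a set \<Rightarrow> ('a, 'b) incidence_scheme" where
  "induced_subspace S T = S\<lparr>points := T, lines := {l \<inter> T |l. l \<in> lines S \<and> card (l \<inter> T) \<ge> 2}\<rparr>"

datatype colour = Red | Green

(* Only the values of colour on the point set are meaningful. *)
record 'a coloured = "'a incidence" +
  colour :: "'a \<Rightarrow> colour"

definition MR_geometry :: "'a coloured \<Rightarrow> bool" where
  "MR_geometry M \<longleftrightarrow> finite_linear_space M \<and>
     (\<forall>l\<in>lines M. (\<exists>p\<in>l. colour M p = Red) \<and> (\<exists>p\<in>l. colour M p = Green))"

definition isomorphism ::
    "('a \<Rightarrow> 'b) \<Rightarrow> ('a, 'c) incidence_scheme \<Rightarrow> ('b, 'd) incidence_scheme \<Rightarrow> bool" where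
  "isomorphism f S S' \<longleftrightarrow>
     bij_betw f (points S) (points S') \<and> (\<lambda>l. f ` l) ` lines S = lines S'"

definition MR_isomorphic :: "'a coloured \<Rightarrow> 'b coloured \<Rightarrow> bool" where
  "MR_isomorphic M M' \<longleftrightarrow>
     (\<exists>f. isomorphism f M M' \<and> (\<forall>p\<in>points M. colour M' (f p) = colour M p))"

fun other_colour :: "colour \<Rightarrow> colour" where
  "other_colour Red = Green"
| "other_colour Green = Red"

definition swap_colours :: "'a coloured \<Rightarrow> 'a coloured" where
  "swap_colours M = M\<lparr>colour := other_colour \<circ> colour M\<rparr>"

definition MR_equivalent :: "'a coloured \<Rightarrow> 'b coloured \<Rightarrow> bool" where
  "MR_equivalent M M' \<longleftrightarrow> MR_isomorphic M M' \<or> MR_isomorphic (swap_colours M) M'"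

definition green_on :: "'a set \<Rightarrow> 'a \<Rightarrow> colour" where
  "green_on G p = (if p \<in> G then Green else Red)"

definition coloured_by :: "'a incidence \<Rightarrow> 'a set \<Rightarrow> 'a coloured" where
  "coloured_by S G = \<lparr>points = points S, lines = lines S, colour = green_on G\<rparr>"

(* One point type for all the geometries, so that they can be put in one list:
   Hom x y z is a point of PG(2,3) in homogeneous coordinates, Ix i j is the point i_j
   of PG(2,4), and Infty is the extra point of MR15_2. *)
datatype point = Hom nat nat nat | Ix nat nat | Infty

(* Points of PG(2,3), and likewise its lines, are given by the nonzero coordinate vectors
   over the field {0,1,2} of integers mod 3, scaled so that the first nonzero
   coordinate is 1. *)
definition normalised3 :: "(nat \<times> nat \<times> nat) set" where
  "normalised3 = {(x, y, z). x < 3 \<and> y < 3 \<and> z < 3 \<and>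
     (x = 1 \<or> (x = 0 \<and> y = 1) \<or> (x = 0 \<and> y = 0 \<and> z = 1))}"

definition PG23 :: "point incidence" where
  "PG23 =
     \<lparr>points = {Hom x y z |x y z. (x, y, z) \<in> normalised3},
      lines = {{Hom x y z |x y z. (x, y, z) \<in> normalised3 \<and> (a * x + b * y + c * z) mod 3 = 0}
               |a b c. (a, b, c) \<in> normalised3}\<rparr>"

definition quadrangle :: "'a incidence \<Rightarrow> 'a \<Rightarrow> 'a \<Rightarrow> 'a \<Rightarrow> 'a \<Rightarrow> bool" where
  "quadrangle S A B C D \<longleftrightarrow>
     {A, B, C, D} \<subseteq> points S \<and> distinct [A, B, C, D] \<and>
     (\<forall>l\<in>lines S. card (l \<inter> {A, B, C, D}) \<le> 2)"

definition join :: "'a incidence \<Rightarrow> 'a \<Rightarrow> 'a \<Rightarrow> 'a set" where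
  "join S x y = (THE l. l \<in> lines S \<and> x \<in> l \<and> y \<in> l)"

definition meet :: "'a set \<Rightarrow> 'a set \<Rightarrow> 'a" where
  "meet l m = (THE p. p \<in> l \<and> p \<in> m)"

definition MR13 :: "point \<Rightarrow> point \<Rightarrow> point \<Rightarrow> point \<Rightarrow> point coloured" where
  "MR13 A B C D =
     (let E = meet (join PG23 A B) (join PG23 C D);
          F = meet (join PG23 A C) (join PG23 B D);
          H = meet (join PG23 A D) (join PG23 B C)
      in coloured_by PG23 {A, B, C, D, E, F, H})"

definition MR12 :: "point \<Rightarrow> point \<Rightarrow> point \<Rightarrow> point \<Rightarrow> point coloured" where
  "MR12 A B C D =
     (let H = meet (join PG23 A D) (join PG23 B C)
      in induced_subspace (MR13 A B C D) (points PG23 - {H}))"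

definition f4 :: "nat \<Rightarrow> nat" where
  "f4 i = [6, 3, 0, 5, 1, 2, 4] ! i"

definition PG24_line :: "nat \<Rightarrow> nat \<Rightarrow> point set" where
  "PG24_line i j =
     {Ix i j, Ix ((i + 1) mod 7) j, Ix ((i + 3) mod 7) j,
      Ix (f4 i) ((j + 1) mod 3), Ix (f4 i) ((j + 2) mod 3)}"

definition PG24 :: "point incidence" where
  "PG24 =
     \<lparr>points = {Ix i j |i j. i < 7 \<and> j < 3},
      lines = {PG24_line i j |i j. i < 7 \<and> j < 3}\<rparr>"

definition PG24_geometry :: "point set \<Rightarrow> point set \<Rightarrow> point coloured" where
  "PG24_geometry G R = coloured_by (induced_subspace PG24 (G \<union> R)) G"

definition layer0 :: "point set" where
  "layer0 = {Ix i 0 |i. i < 7}"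

definition layer1 :: "point set" where
  "layer1 = {Ix i 1 |i. i < 7}"

definition red14_2 :: "point set" where
  "red14_2 = {Ix 2 1, Ix 4 1, Ix 5 1, Ix 6 1, Ix 0 2, Ix 1 2, Ix 3 2}"

definition MR14_1 :: "point coloured" where
  "MR14_1 = PG24_geometry layer0 layer1"

definition MR14_2 :: "point coloured" where
  "MR14_2 = PG24_geometry layer0 red14_2"

definition MR15_1 :: "point coloured" where
  "MR15_1 = PG24_geometry (layer0 \<union> {Ix 6 2}) layer1"

definition MR15_2 :: "point coloured" where
  "MR15_2 =
     \<lparr>points = insert Infty (points MR14_1),
      lines = (lines MR14_1 - {{Ix i 0, Ix i 1} |i. i < 7})
              \<union> {{Ix i 0, Ix i 1, Infty} |i. i < 7},
      colour = (colour MR14_1)(Infty := Green)\<rparr>"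

definition MR15_3r :: "point coloured" where
  "MR15_3r = PG24_geometry layer0 (red14_2 \<union> {Ix 4 2})"

definition MR15_3g :: "point coloured" where
  "MR15_3g = PG24_geometry (layer0 \<union> {Ix 4 2}) red14_2"

definition MR15_4 :: "point coloured" where
  "MR15_4 = PG24_geometry layer0 (red14_2 \<union> {Ix 3 1})"

(* The listed points are exactly those of PG(2,4) other than
   0_1, 1_1, 3_1, 6_2, 0_2, 3_2. *)
definition MR15_5 :: "point coloured" where
  "MR15_5 = PG24_geometry
     {Ix 0 0, Ix 1 0, Ix 3 0, Ix 4 0, Ix 5 1, Ix 1 2, Ix 5 2}
     {Ix 2 0, Ix 5 0, Ix 6 0, Ix 2 1, Ix 4 1, Ix 6 1, Ix 2 2, Ix 4 2}"

definition MR_list :: "point \<Rightarrow> point \<Rightarrow> point \<Rightarrow> point \<Rightarrow> point coloured list" where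
  "MR_list A B C D =
     [MR12 A B C D, MR13 A B C D, MR14_1, MR14_2, MR15_1, MR15_2, MR15_3r, MR15_3g,
      MR15_4, MR15_5]"

end

(* Let R be the smaller colour class; it has at most 7 points. The sets of at least two points in
   which lines meet R are the lines of a linear space on R, and the lines through a point x off R
   mark pairwise disjoint ones among them. Since the line through two points off R meets R, the sets
   marked by two such points share exactly one line, or else they share none and both leave the same
   point of R uncovered; moreover every line of the space on R is marked by some point. For each of
   the linear spaces on at most 7 points these conditions leave only few families of marked sets,
   and for each family the lines with one point in R are found by adding the points off R one at a
   time. The search runs inside the logic, by rewriting, and its 535 outcomes are identified with
   the geometries of the theorem by explicit relabellings. The geometries on 12 and 13 points, which
   depend on the quadrangle, need no coordinates: being MR geometries they occur in the
   classification, and there their number of points determines them. *)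

theory Submission
  imports Defs
begin

text \<open>Only one direction of the search is proved: every geometry leads to one of the outcomes.
  Whether an outcome is a geometry is never asked. An outcome is compared with a fixed table whose
  rows are the lines of a target, and the comparison is a mere inclusion of rows. This is enough
  because in a table any two points determine their row: two geometries whose lines are all among
  the rows of one table are isomorphic, position by position. As a table does not say which class is
  red, interchanging the colours costs nothing. The linear spaces on \<open>R\<close> are not taken
  on trust either. No line contains \<open>R\<close>, so blocks have fewer than \<open>r\<close>
  points, and the lists, with 1, 2, 4, 9 and 23 spaces for \<open>r = 3, ..., 7\<close>, are checked
  to be closed under adding one more block. Only three of these spaces have outcomes: the complete
  quadrilateral on six points (4 outcomes), the Fano plane (520), and a space on seven points (11)
  that consists of a triangle, the points where its sides meet a fourth line, and one more point of
  that line.\<close>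

type_synonym bits = "bool list"
type_synonym bits2 = "bits \<times> bits"
type_synonym state = "bits list \<times> bits2 list"

section \<open>The search as a functional program\<close>

fun bsub :: "bits \<Rightarrow> bits \<Rightarrow> bool" where
  "bsub (True # xs) (False # ys) = False"
| "bsub (x # xs) (y # ys) = bsub xs ys"
| "bsub _ _ = True"

fun bdisj :: "bits \<Rightarrow> bits \<Rightarrow> bool" where
  "bdisj (True # xs) (True # ys) = False"
| "bdisj (x # xs) (y # ys) = bdisj xs ys"
| "bdisj _ _ = True"

fun bdiff :: "bits \<Rightarrow> bits \<Rightarrow> bits" where
  "bdiff (x # xs) (True # ys) = False # bdiff xs ys"
| "bdiff (x # xs) (False # ys) = x # bdiff xs ys"
| "bdiff _ _ = []"

fun bor :: "bits \<Rightarrow> bits \<Rightarrow> bits" where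
  "bor (x # xs) (True # ys) = True # bor xs ys"
| "bor (x # xs) (False # ys) = x # bor xs ys"
| "bor _ _ = []"

fun bit_at :: "bits \<Rightarrow> nat \<Rightarrow> bool" where
  "bit_at [] n = False"
| "bit_at (x # xs) 0 = x"
| "bit_at (x # xs) (Suc n) = bit_at xs n"

fun weight :: "bits \<Rightarrow> nat" where
  "weight [] = 0"
| "weight (True # xs) = Suc (weight xs)"
| "weight (False # xs) = weight xs"

fun common :: "bits \<Rightarrow> bits \<Rightarrow> nat" where
  "common (True # xs) (True # ys) = Suc (common xs ys)"
| "common (x # xs) (y # ys) = common xs ys"
| "common _ _ = 0"

fun beq :: "bits \<Rightarrow> bits \<Rightarrow> bool" where
  "beq [] [] = True"
| "beq (True # xs) (True # ys) = beq xs ys"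
| "beq (False # xs) (False # ys) = beq xs ys"
| "beq _ _ = False"

text \<open>The functions below are evaluated by the simplifier. They dispatch on Booleans by pattern
  matching instead of using conditionals and abstractions, since the simplifier would traverse all
  data in a pending branch or body again at every step.\<close>

fun keep :: "bool \<Rightarrow> 'a \<Rightarrow> 'a list \<Rightarrow> 'a list" where
  "keep True x xs = x # xs"
| "keep False x xs = xs"

fun select :: "bool \<Rightarrow> 'a \<Rightarrow> 'a \<Rightarrow> 'a" where
  "select True x y = x"
| "select False x y = y"

fun falses :: "'a list \<Rightarrow> bits" where
  "falses [] = []"
| "falses (x # xs) = False # falses xs"

fun trues :: "'a list \<Rightarrow> bits" where
  "trues [] = []"
| "trues (x # xs) = True # trues xs"

fun cons_fst :: "bool \<Rightarrow> bits2 list \<Rightarrow> bits2 list" where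
  "cons_fst b [] = []"
| "cons_fst b ((f, s) # cs) = (b # f, s) # cons_fst b cs"

text \<open>A pair \<open>(f, s)\<close> describes a point off \<open>R\<close>: \<open>f\<close> marks the lines through it that have at least
  two points of \<open>R\<close>, and \<open>s\<close> the points of \<open>R\<close> on none of these.\<close>

fun genp :: "bits list \<Rightarrow> bits \<Rightarrow> bits2 list"
  and genp_with :: "bool \<Rightarrow> bits \<Rightarrow> bits list \<Rightarrow> bits \<Rightarrow> bits2 list" where
  "genp [] s = [([], s)]"
| "genp (b # bs) s = genp_with (bsub b s) b bs s @ cons_fst False (genp bs s)"
| "genp_with True b bs s = cons_fst True (genp bs (bdiff s b))"
| "genp_with False b bs s = []"

fun compat :: "bits \<Rightarrow> bits \<Rightarrow> bits \<Rightarrow> bits \<Rightarrow> bool" where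
  "compat (True # xs) (True # ys) s t = bdisj xs ys"
| "compat (x # xs) (y # ys) s t = compat xs ys s t"
| "compat _ _ s t = (\<not> bdisj s t)"

fun fcompat :: "bits \<Rightarrow> bits \<Rightarrow> bits2 list \<Rightarrow> bits2 list" where
  "fcompat f s [] = []"
| "fcompat f s ((f', s') # cs) = keep (compat f f' s s') (f', s') (fcompat f s cs)"

text \<open>A chosen candidate stays available, since several points may lie on the same marked
  lines; the candidates before it in \<open>as\<close> are given up, so a multiset of pairs is not
  enumerated in several orders.\<close>

fun splits :: "bits2 list \<Rightarrow> bits2 list \<Rightarrow> (bits2 \<times> bits2 list) list" where
  "splits [] cs = []"
| "splits ((f, s) # as) cs = ((f, s), fcompat f s (((f, s) # as) @ cs)) # splits as cs"

fun addcol :: "bits \<Rightarrow> nat list \<Rightarrow> nat list" where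
  "addcol (True # xs) (n # ns) = Suc n # addcol xs ns"
| "addcol (False # xs) (n # ns) = n # addcol xs ns"
| "addcol _ _ = []"

fun counts :: "nat list \<Rightarrow> bits2 list \<Rightarrow> nat list" where
  "counts z [] = z"
| "counts z ((f, s) # cs) = counts (addcol f z) cs"

fun zeros :: "'a list \<Rightarrow> nat list" where
  "zeros [] = []"
| "zeros (x # xs) = 0 # zeros xs"

fun better :: "nat \<Rightarrow> nat \<Rightarrow> nat \<times> nat \<Rightarrow> nat \<times> nat" where
  "better c i (m, j) = select (c \<le> m) (c, i) (m, j)"

fun best :: "nat \<Rightarrow> bits \<Rightarrow> nat list \<Rightarrow> nat \<Rightarrow> nat \<times> nat" where
  "best i (True # bs) (c # cs) m = better c i (best (Suc i) bs cs m)"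
| "best i (False # bs) (c # cs) m = best (Suc i) bs cs m"
| "best i _ _ m = (m, 0)"

fun larger :: "nat \<Rightarrow> nat \<Rightarrow> nat" where
  "larger m n = select (m \<le> n) n m"

fun maxcommon :: "bits \<Rightarrow> bits2 list \<Rightarrow> nat" where
  "maxcommon d [] = 0"
| "maxcommon d ((f, s) # cs) = larger (common d f) (maxcommon d cs)"

fun having :: "nat \<Rightarrow> bits2 list \<Rightarrow> bits2 list" where
  "having j [] = []"
| "having j ((f, s) # cs) = keep (bit_at f j) (f, s) (having j cs)"

fun lacking :: "nat \<Rightarrow> bits2 list \<Rightarrow> bits2 list" where
  "lacking j [] = []"
| "lacking j ((f, s) # cs) = keep (\<not> bit_at f j) (f, s) (lacking j cs)"

fun branches_if :: "bool \<Rightarrow> nat \<Rightarrow> bits2 list \<Rightarrow> (bits2 \<times> bits2 list) list" where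
  "branches_if True j cs = splits (having j cs) (lacking j cs)"
| "branches_if False j cs = splits cs []"

text \<open>The index \<open>j\<close> stems from a heuristic. Testing here that line
  \<open>j\<close> does lack a point makes the branching complete for any index, including the
  default 0 of \<open>best\<close>.\<close>

fun branches_at :: "nat \<times> nat \<Rightarrow> bits \<Rightarrow> bits2 list \<Rightarrow> (bits2 \<times> bits2 list) list" where
  "branches_at (m, j) d cs = branches_if (bit_at d j) j cs"

text \<open>A line with fewest candidates is preferred, which matters for the running time only.\<close>

definition branches :: "bits \<Rightarrow> bits2 list \<Rightarrow> (bits2 \<times> bits2 list) list" where
  "branches d cs = branches_at (best 0 d (counts (zeros d) cs) (length cs)) d cs"

text \<open>Here \<open>ch\<close> describes the points found so far, \<open>d\<close> marks the lines that still need a point off \<open>R\<close>,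
  and \<open>cs\<close> holds the pairs still allowed for the at most \<open>n\<close> further points. A pair is either used,
  and then remains available, or dropped for good.\<close>

function search :: "nat \<Rightarrow> bits2 list \<Rightarrow> bits \<Rightarrow> bits2 list \<Rightarrow> bits2 list list"
  and search_if :: "bool \<Rightarrow> nat \<Rightarrow> bits2 list \<Rightarrow> bits \<Rightarrow> bits2 list \<Rightarrow> bits2 list list"
  and search_all :: "nat \<Rightarrow> bits2 list \<Rightarrow> bits \<Rightarrow> (bits2 \<times> bits2 list) list \<Rightarrow> bits2 list list" where
  "search 0 ch d cs = keep (weight d = 0) ch []"
| "search (Suc n) ch d cs = keep (weight d = 0) ch (search_if (Suc n * maxcommon d cs < weight d) n ch d cs)"
| "search_if True n ch d cs = []"
| "search_if False n ch d cs = search_all n ch d (branches d cs)"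
| "search_all n ch d [] = []"
| "search_all n ch d (((f, s), cs) # bs) = search n ((f, s) # ch) (bdiff d f) cs @ search_all n ch d bs"
  by pat_completeness auto
termination
  by (relation "measures [\<lambda>x. case x of Inl (n, _) \<Rightarrow> n | Inr (Inl (_, n, _)) \<Rightarrow> n | Inr (Inr (n, _)) \<Rightarrow> n,
        \<lambda>x. case x of Inl _ \<Rightarrow> 0 | Inr (Inl _) \<Rightarrow> 2 | Inr (Inr _) \<Rightarrow> 1,
        \<lambda>x. case x of Inr (Inr (_, _, _, bs)) \<Rightarrow> length bs | _ \<Rightarrow> 0]") auto

section \<open>Lines with one point in \<open>R\<close>, one new point at a time\<close>

fun both_if :: "bool \<Rightarrow> bits \<Rightarrow> bits \<Rightarrow> bool" where
  "both_if True b c = bdisj b c"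
| "both_if False b c = False"

fun pick_if :: "bool \<Rightarrow> bits \<Rightarrow> bits \<Rightarrow> bits \<Rightarrow> bits \<Rightarrow> bool" where
  "pick_if True p s b c = both_if (bsub p s) b c"
| "pick_if False p s b c = False"

text \<open>The line from the new point to an earlier point \<open>y\<close> has a single point
  \<open>p\<close> in \<open>R\<close>. As \<open>y\<close> and \<open>p\<close> are joined already,
  that line is an entry of \<open>es\<close> through \<open>y\<close>; its point \<open>p\<close>
  must still be free, and it contains no earlier point joined to the new one by another
  line.\<close>

fun picks :: "nat \<Rightarrow> bits \<Rightarrow> bits \<Rightarrow> bits2 list \<Rightarrow> bits2 list" where
  "picks y s c [] = []"
| "picks y s c ((p, b) # es) = keep (pick_if (bit_at b y) p s b c) (p, b) (picks y s c es)"

text \<open>A new point is joined to the earlier ones by some of the lines \<open>es\<close> with a single point in \<open>R\<close>;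
  \<open>c\<close> marks the earlier points that it is already joined to, \<open>s\<close> the points of \<open>R\<close> that it is not.\<close>

function cover :: "bits2 list \<Rightarrow> nat list \<Rightarrow> bits2 list \<Rightarrow> bits \<Rightarrow> bits \<Rightarrow> (bits2 list \<times> bits) list"
  and cover_if :: "bool \<Rightarrow> bits2 list \<Rightarrow> nat \<Rightarrow> nat list \<Rightarrow> bits2 list \<Rightarrow> bits \<Rightarrow> bits \<Rightarrow> (bits2 list \<times> bits) list"
  and cover_all :: "bits2 list \<Rightarrow> nat list \<Rightarrow> bits2 list \<Rightarrow> bits \<Rightarrow> bits \<Rightarrow> bits2 list \<Rightarrow> (bits2 list \<times> bits) list" where
  "cover es [] acc s c = [(acc, s)]"
| "cover es (y # ys) acc s c = cover_if (bit_at c y) es y ys acc s c"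
| "cover_if True es y ys acc s c = cover es ys acc s c"
| "cover_if False es y ys acc s c = cover_all es ys acc s c (picks y s c es)"
| "cover_all es ys acc s c [] = []"
| "cover_all es ys acc s c ((p, b) # ps) = cover es ys ((p, b) # acc) (bdiff s p) (bor c b) @ cover_all es ys acc s c ps"
  by pat_completeness auto
termination
  by (relation "measures [\<lambda>x. case x of Inl (_, ys, _) \<Rightarrow> length ys | Inr (Inl (_, _, _, ys, _)) \<Rightarrow> length ys
          | Inr (Inr (_, ys, _)) \<Rightarrow> length ys,
        \<lambda>x. case x of Inl _ \<Rightarrow> 0 | Inr (Inl _) \<Rightarrow> 2 | Inr (Inr _) \<Rightarrow> 1,
        \<lambda>x. case x of Inr (Inr (_, _, _, _, _, ps)) \<Rightarrow> length ps | _ \<Rightarrow> 0]") auto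

fun cons_all :: "'a \<Rightarrow> 'a list list \<Rightarrow> 'a list list" where
  "cons_all x [] = []"
| "cons_all x (xs # xss) = (x # xs) # cons_all x xss"

fun units :: "bits \<Rightarrow> bits list" where
  "units [] = []"
| "units (True # s) = (True # falses s) # cons_all False (units s)"
| "units (False # s) = cons_all False (units s)"

fun peq_if :: "bool \<Rightarrow> bits \<Rightarrow> bits \<Rightarrow> bool" where
  "peq_if True b c = beq b c"
| "peq_if False b c = False"

fun peq :: "bits2 \<Rightarrow> bits2 \<Rightarrow> bool" where
  "peq (p, b) (q, c) = peq_if (beq p q) b c"

fun mem :: "bits2 \<Rightarrow> bits2 list \<Rightarrow> bool"
  and mem_if :: "bool \<Rightarrow> bits2 \<Rightarrow> bits2 list \<Rightarrow> bool" where
  "mem e [] = False"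
| "mem e (e' # es) = mem_if (peq e e') e es"
| "mem_if True e es = True"
| "mem_if False e es = mem e es"

fun mark :: "bits2 list \<Rightarrow> bits2 list \<Rightarrow> bits2 list" where
  "mark acc [] = []"
| "mark acc ((p, b) # es) = (p, mem (p, b) acc # b) # mark acc es"

fun union_of :: "bits \<Rightarrow> bits \<Rightarrow> bits list \<Rightarrow> bits" where
  "union_of z (True # f) (g # gs) = bor (union_of z f gs) g"
| "union_of z (False # f) (g # gs) = union_of z f gs"
| "union_of z _ _ = z"

fun cons_each :: "'a list \<Rightarrow> 'a list list \<Rightarrow> 'a list list" where
  "cons_each (x # xs) (ys # yss) = (x # ys) # cons_each xs yss"
| "cons_each _ _ = []"

fun news :: "bits \<Rightarrow> bits list \<Rightarrow> bits2 list" where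
  "news z [] = []"
| "news z (u # us) = (u, True # z) # news z us"

text \<open>A state \<open>(rg, cl)\<close> gives, in \<open>rg\<close>, the points off \<open>R\<close> on each line with at least two points
  in \<open>R\<close>, and in \<open>cl\<close> the lines with one point in \<open>R\<close>. The newest point off \<open>R\<close> comes first.\<close>

fun ext_all :: "bits \<Rightarrow> bits list \<Rightarrow> bits2 list \<Rightarrow> (bits2 list \<times> bits) list \<Rightarrow> state list" where
  "ext_all z rg cl [] = []"
| "ext_all z rg cl ((acc, s) # rest) = (rg, mark acc cl @ news z (units s)) # ext_all z rg cl rest"

fun ext :: "bits \<Rightarrow> nat list \<Rightarrow> bits2 \<Rightarrow> state \<Rightarrow> state list" where
  "ext z ys (f, s) (rg, cl) = ext_all z (cons_each f rg) cl (cover cl ys [] s (union_of z f rg))"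

fun ext_states :: "bits \<Rightarrow> nat list \<Rightarrow> bits2 \<Rightarrow> state list \<Rightarrow> state list" where
  "ext_states z ys c [] = []"
| "ext_states z ys c (st # sts) = ext z ys c st @ ext_states z ys c sts"

fun nils :: "'a list \<Rightarrow> 'b list list" where
  "nils [] = []"
| "nils (x # xs) = [] # nils xs"

fun extend :: "bits list \<Rightarrow> bits2 list \<Rightarrow> state list" where
  "extend L [] = [(nils L, [])]"
| "extend L (c # cs) = ext_states (falses cs) (rev [0..<length cs]) c (extend L cs)"

fun assemble :: "bits list \<Rightarrow> state list \<Rightarrow> bits2 list list" where
  "assemble L [] = []"
| "assemble L ((rg, cl) # sts) = (zip L rg @ cl) # assemble L sts"

text \<open>Fewer than \<open>r\<close> points off \<open>R\<close> would make \<open>R\<close> the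
  larger class; such a geometry is found from its other class.\<close>

fun solve_if :: "bool \<Rightarrow> bits list \<Rightarrow> bits2 list \<Rightarrow> bits2 list list" where
  "solve_if True L ch = []"
| "solve_if False L ch = assemble L (extend L ch)"

fun solve_all :: "nat \<Rightarrow> bits list \<Rightarrow> bits2 list list \<Rightarrow> bits2 list list" where
  "solve_all r L [] = []"
| "solve_all r L (ch # chs) = solve_if (length ch < r) L ch @ solve_all r L chs"

definition solutions :: "nat \<Rightarrow> nat \<Rightarrow> bits list \<Rightarrow> bits2 list list" where
  "solutions r g L = solve_all r L (search g [] (trues L) (genp L (replicate r True)))"

fun pairs :: "nat \<Rightarrow> bits list" where
  "pairs 0 = []"
| "pairs (Suc n) = cons_all True (units (replicate n True)) @ cons_all False (pairs n)"

definition block :: "nat \<Rightarrow> nat list \<Rightarrow> bits" where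
  "block r b = map (\<lambda>i. i \<in> set b) [0..<r]"

text \<open>The pairs inside no block are the two-point lines of the linear space on
  \<open>R\<close>.\<close>

definition red_lines :: "nat \<Rightarrow> bits list \<Rightarrow> bits list" where
  "red_lines r B = B @ filter (\<lambda>p. list_all (\<lambda>b. \<not> bsub p b) B) (pairs r)"

definition completions :: "nat \<Rightarrow> nat list list \<Rightarrow> bits2 list list" where
  "completions r B = solutions r (15 - r) (red_lines r (map (block r) B))"

section \<open>Correctness of the search\<close>

text \<open>The list \<open>xs\<close> numbers the points; whatever a set contains outside
  \<open>xs\<close> is invisible. All bit operations of the program become set operations through
  this function.\<close>

definition bits :: "'a list \<Rightarrow> 'a set \<Rightarrow> bits" where
  "bits xs A = map (\<lambda>x. x \<in> A) xs"

lemma bits_Nil [simp]: "bits [] A = []"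
  and bits_Cons [simp]: "bits (x # xs) A = (x \<in> A) # bits xs A"
  and length_bits [simp]: "length (bits xs A) = length xs"
  by (simp_all add: bits_def)

lemma bits_eq_iff: "bits xs A = bits xs B \<longleftrightarrow> A \<inter> set xs = B \<inter> set xs"
  by (induction xs) auto

lemma bsub_bits: "bsub (bits xs A) (bits xs B) \<longleftrightarrow> A \<inter> set xs \<subseteq> B"
proof (induction xs)
  case (Cons x xs)
  then show ?case by (cases "x \<in> A"; cases "x \<in> B") auto
qed simp

lemma bdisj_bits: "bdisj (bits xs A) (bits xs B) \<longleftrightarrow> A \<inter> B \<inter> set xs = {}"
proof (induction xs)
  case (Cons x xs)
  then show ?case by (cases "x \<in> A"; cases "x \<in> B") auto
qed simp

lemma bdiff_bits: "bdiff (bits xs A) (bits xs B) = bits xs (A - B)"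
proof (induction xs)
  case (Cons x xs)
  then show ?case by (cases "x \<in> B") auto
qed simp

lemma bor_bits: "bor (bits xs A) (bits xs B) = bits xs (A \<union> B)"
proof (induction xs)
  case (Cons x xs)
  then show ?case by (cases "x \<in> B") auto
qed simp

lemma bit_at_bits: "bit_at (bits xs A) n \<longleftrightarrow> n < length xs \<and> xs ! n \<in> A"
proof (induction xs arbitrary: n)
  case (Cons x xs)
  then show ?case by (cases n) auto
qed simp

lemma weight_bits: "distinct xs \<Longrightarrow> weight (bits xs A) = card (A \<inter> set xs)"
proof (induction xs)
  case (Cons x xs)
  then show ?case by (cases "x \<in> A") (auto simp: Int_insert_right)
qed simp

lemma common_bits: "distinct xs \<Longrightarrow> common (bits xs A) (bits xs B) = card (A \<inter> B \<inter> set xs)"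
proof (induction xs)
  case (Cons x xs)
  then show ?case by (cases "x \<in> A"; cases "x \<in> B") (auto simp: Int_insert_right)
qed simp

lemma beq_iff: "beq xs ys \<longleftrightarrow> xs = ys"
  by (induction xs ys rule: beq.induct) auto

lemma peq_iff: "peq x y \<longleftrightarrow> x = y"
  by (cases x; cases y; cases "fst x = fst y") (auto simp: beq_iff)

lemma mem_iff: "mem e es \<longleftrightarrow> e \<in> set es"
proof (induction es)
  case (Cons e' es)
  then show ?case by (cases "e = e'") (auto simp: peq_iff)
qed simp

lemma keep_eq [simp]: "keep b x xs = (if b then x # xs else xs)"
  by (cases b) simp_all

lemma select_eq [simp]: "select b x y = (if b then x else y)"
  by (cases b) simp_all

lemma falses_eq [simp]: "falses xs = map (\<lambda>_. False) xs"
  and trues_eq [simp]: "trues xs = map (\<lambda>_. True) xs"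
  and nils_eq [simp]: "nils xs = map (\<lambda>_. []) xs"
  by (induction xs) simp_all

lemma cons_fst_eq [simp]: "cons_fst b cs = map (\<lambda>(f, s). (b # f, s)) cs"
  by (induction cs) auto

lemma cons_all_eq [simp]: "cons_all x xss = map ((#) x) xss"
  by (induction xss) simp_all

lemma cons_each_eq [simp]: "cons_each xs yss = map2 (#) xs yss"
  by (induction xs yss rule: cons_each.induct) simp_all

lemma news_eq [simp]: "news z us = map (\<lambda>u. (u, True # z)) us"
  by (induction us) simp_all

lemma branches_at_eq:
  "branches_at x d cs = (if bit_at d (snd x) then splits (having (snd x) cs) (lacking (snd x) cs) else splits cs [])"
  by (cases x; cases "bit_at d (snd x)") simp_all

lemma search_all_eq:
  "search_all n ch d bs = concat (map (\<lambda>((f, s), cs). search n ((f, s) # ch) (bdiff d f) cs) bs)"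
  by (induction bs) auto

lemma search_Suc: "search (Suc n) ch d cs = (if weight d = 0 then [ch] else []) @
    (if Suc n * maxcommon d cs < weight d then []
     else concat (map (\<lambda>((f, s), cs). search n ((f, s) # ch) (bdiff d f) cs) (branches d cs)))"
  by (cases "Suc n * maxcommon d cs < weight d") (simp_all add: search_all_eq del: mult_Suc)

declare search.simps(2) [simp del]

lemma cover_all_eq:
  "cover_all es ys acc s c ps = concat (map (\<lambda>(p, b). cover es ys ((p, b) # acc) (bdiff s p) (bor c b)) ps)"
  by (induction ps) auto

lemma cover_Cons: "cover es (y # ys) acc s c = (if bit_at c y then cover es ys acc s c
     else concat (map (\<lambda>(p, b). cover es ys ((p, b) # acc) (bdiff s p) (bor c b)) (picks y s c es)))"
  by (cases "bit_at c y") (simp_all add: cover_all_eq)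

declare cover.simps(2) [simp del]

lemma picks_eq: "picks y s c es = filter (\<lambda>(p, b). bit_at b y \<and> bsub p s \<and> bdisj b c) es"
proof -
  have "pick_if x p s b c \<longleftrightarrow> x \<and> bsub p s \<and> bdisj b c" for x p b
    by (cases x; cases "bsub p s") simp_all
  note [simp] = this
  show ?thesis
  proof (induction es)
    case (Cons e es)
    then show ?case by (cases e) simp
  qed simp
qed

lemma ext_all_eq: "ext_all z rg cl as = map (\<lambda>(acc, s). (rg, mark acc cl @ news z (units s))) as"
  by (induction as) auto

lemma ext_states_eq: "ext_states z ys c sts = concat (map (ext z ys c) sts)"
  by (induction sts) simp_all

lemma assemble_eq: "assemble L sts = map (\<lambda>(rg, cl). zip L rg @ cl) sts"
  by (induction sts) auto

lemma solve_all_eq: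
  "solve_all r L chs = concat (map (\<lambda>ch. if length ch < r then [] else assemble L (extend L ch)) chs)"
proof -
  have "solve_if b L ch = (if b then [] else assemble L (extend L ch))" for b ch
    by (cases b) simp_all
  then show ?thesis by (induction chs) simp_all
qed

lemma mark_eq: "mark acc es = map (\<lambda>(p, b). (p, ((p, b) \<in> set acc) # b)) es"
  by (induction acc es rule: mark.induct) (auto simp: mem_iff)

lemma set_units: "distinct xs \<Longrightarrow> set (units (bits xs A)) = (\<lambda>p. bits xs {p}) ` (A \<inter> set xs)"
proof (induction xs)
  case (Cons x xs)
  have 1: "map (\<lambda>_. False) (bits xs A) = bits xs {x}"
    using Cons.prems by (auto simp: bits_def)
  have 2: "(#) False ` (\<lambda>p. bits xs {p}) ` (A \<inter> set xs) = (\<lambda>p. bits (x # xs) {p}) ` (A \<inter> set xs)"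
    using Cons.prems by (auto simp: image_iff)
  show ?case
  proof (cases "x \<in> A")
    case True
    then have "A \<inter> set (x # xs) = insert x (A \<inter> set xs)" by auto
    then show ?thesis using Cons True 1 2 by simp
  next
    case False
    then have "A \<inter> set (x # xs) = A \<inter> set xs" by auto
    then show ?thesis using Cons False 2 by simp
  qed
qed simp

lemma having_eq: "having j cs = filter (\<lambda>c. bit_at (fst c) j) cs"
  by (induction j cs rule: having.induct) simp_all

lemma lacking_eq: "lacking j cs = filter (\<lambda>c. \<not> bit_at (fst c) j) cs"
  by (induction j cs rule: lacking.induct) simp_all

lemma fcompat_eq: "fcompat f s cs = filter (\<lambda>c. compat f (fst c) s (snd c)) cs"
  by (induction f s cs rule: fcompat.induct) simp_all

lemma maxcommon_ge: "c \<in> set cs \<Longrightarrow> common d (fst c) \<le> maxcommon d cs"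
proof (induction cs)
  case (Cons a cs)
  then show ?case by (cases a) (auto simp: not_le)
qed simp

lemma compat_bits:
  assumes "distinct ls" "card (A \<inter> B \<inter> set ls) \<le> 1" "A \<inter> B \<inter> set ls = {} \<Longrightarrow> \<not> bdisj s t"
  shows "compat (bits ls A) (bits ls B) s t"
  using assms
proof (induction ls)
  case (Cons l ls)
  show ?case
  proof (cases "l \<in> A \<and> l \<in> B")
    case True
    then have "A \<inter> B \<inter> set (l # ls) = insert l (A \<inter> B \<inter> set ls)" by auto
    then have "A \<inter> B \<inter> set ls = {}" using Cons.prems by auto
    then show ?thesis using True by (simp add: bdisj_bits)
  next
    case False
    then have eq: "A \<inter> B \<inter> set (l # ls) = A \<inter> B \<inter> set ls" by auto
    with Cons.prems have "compat (bits ls A) (bits ls B) s t"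
      by (intro Cons.IH) auto
    then show ?thesis using False by (cases "l \<in> A"; cases "l \<in> B") auto
  qed
qed simp

text \<open>Take the first candidate in \<open>as\<close> that is \<open>P z\<close> for some
  \<open>z\<close>. No element of \<open>Z\<close> has an earlier candidate as its value, so
  dropping those loses nothing, and pairwise compatibility lets the other values pass the
  filter.\<close>

lemma splits_sound:
  assumes "P ` Z \<subseteq> set as \<union> set cs" "\<exists>z\<in>Z. P z \<in> set as"
    and "\<And>x y. x \<in> Z \<Longrightarrow> y \<in> Z \<Longrightarrow> x \<noteq> y \<Longrightarrow> compat (fst (P x)) (fst (P y)) (snd (P x)) (snd (P y))"
  shows "\<exists>z\<in>Z. \<exists>cs'. (P z, cs') \<in> set (splits as cs) \<and> P ` (Z - {z}) \<subseteq> set cs'"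
  using assms(1,2)
proof (induction as)
  case (Cons a as)
  obtain f s where a: "a = (f, s)" by (cases a)
  show ?case
  proof (cases "\<exists>z\<in>Z. P z = a")
    case True
    then obtain z where z: "z \<in> Z" "P z = a" by blast
    have "P ` (Z - {z}) \<subseteq> set (fcompat f s ((a # as) @ cs))"
    proof (rule image_subsetI)
      fix y assume y: "y \<in> Z - {z}"
      then have "y \<in> Z" "z \<noteq> y" by blast+
      then have "compat f (fst (P y)) s (snd (P y))" using assms(3)[OF z(1)] z(2) a by fastforce
      moreover have "P y \<in> set ((a # as) @ cs)" using Cons.prems(1) \<open>y \<in> Z\<close> by auto
      ultimately show "P y \<in> set (fcompat f s ((a # as) @ cs))" by (auto simp: fcompat_eq)
    qed
    moreover have "(P z, fcompat f s ((a # as) @ cs)) \<in> set (splits (a # as) cs)"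
      using z a by (simp del: fcompat.simps)
    ultimately show ?thesis using z(1) by blast
  next
    case False
    then have "P ` Z \<subseteq> set as \<union> set cs" "\<exists>z\<in>Z. P z \<in> set as" using Cons.prems by auto
    from Cons.IH[OF this] show ?thesis using a by auto
  qed
qed simp

text \<open>Induction on the number of points that may still be added; \<open>ys\<close> holds the
  points placed so far, newest first. The list \<open>xs\<close> is existential because the search
  decides in which order the points appear.\<close>

lemma search_sound:
  fixes F :: "'x \<Rightarrow> 'l set" and s :: "'x \<Rightarrow> bits" and ls :: "'l list"
  defines "P \<equiv> \<lambda>x. (bits ls (F x), s x)"
  assumes ls: "distinct ls" and X: "finite X"
    and comp: "\<And>x y. x \<in> X \<Longrightarrow> y \<in> X \<Longrightarrow> x \<noteq> y \<Longrightarrow> compat (bits ls (F x)) (bits ls (F y)) (s x) (s y)"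
    and cov: "\<And>l. l \<in> set ls \<Longrightarrow> \<exists>x\<in>X. l \<in> F x"
  assumes "distinct ys" "set ys \<subseteq> X" "card X \<le> n + length ys" "P ` (X - set ys) \<subseteq> set cs"
  shows "\<exists>xs. distinct xs \<and> set xs = X \<and>
    map P xs \<in> set (search n (map P ys) (bits ls (- \<Union> (F ` set ys))) cs)"
  using assms(6-)
proof (induction n arbitrary: ys cs)
  case 0
  then have eq: "set ys = X" using X by (metis add_0 card_seteq distinct_card)
  have "weight (bits ls (- \<Union> (F ` X))) = 0"
    using cov by (auto simp: weight_bits[OF ls])
  then show ?case using 0 eq by auto
next
  case (Suc n)
  let ?d = "bits ls (- \<Union> (F ` set ys))"
  let ?Z = "X - set ys"
  show ?case
  proof (cases "?Z = {}")
    case True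
    then have eq: "set ys = X" using Suc.prems by auto
    have "weight ?d = 0" using cov eq by (auto simp: weight_bits[OF ls])
    then show ?thesis using Suc.prems eq by (auto simp: search_Suc)
  next
    case False
    have "card ?Z = card X - length ys"
      using Suc.prems X by (metis card_Diff_subset distinct_card finite_subset)
    then have cZ: "card ?Z \<le> Suc n" using Suc.prems by simp
    \<comment> \<open>The pruning test never cuts off a real family: each uncovered line contains
      one of at most \<open>Suc n\<close> remaining points, and each of these covers at most
      \<open>maxcommon ?d cs\<close> uncovered lines.\<close>
    have "weight ?d = card (set ls - \<Union> (F ` set ys))"
      using ls by (simp add: weight_bits Diff_eq Int_commute)
    also have "\<dots> \<le> card (\<Union>z\<in>?Z. (- \<Union> (F ` set ys)) \<inter> F z \<inter> set ls)"
      by (rule card_mono) (use X cov in auto)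
    also have "\<dots> \<le> (\<Sum>z\<in>?Z. card ((- \<Union> (F ` set ys)) \<inter> F z \<inter> set ls))"
      by (rule card_UN_le) (use X in auto)
    also have "\<dots> \<le> (\<Sum>z\<in>?Z. maxcommon ?d cs)"
    proof (rule sum_mono)
      fix z assume "z \<in> ?Z"
      then have "P z \<in> set cs" using Suc.prems by auto
      then show "card ((- \<Union> (F ` set ys)) \<inter> F z \<inter> set ls) \<le> maxcommon ?d cs"
        using maxcommon_ge[of "P z" cs ?d] ls by (simp add: P_def common_bits)
    qed
    also have "\<dots> \<le> Suc n * maxcommon ?d cs" using mult_le_mono1[OF cZ] by simp
    finally have noprune: "\<not> Suc n * maxcommon ?d cs < weight ?d" by simp
    have "\<exists>z\<in>?Z. \<exists>cs'. (P z, cs') \<in> set (branches ?d cs) \<and> P ` (?Z - {z}) \<subseteq> set cs'"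
    proof -
      define j where "j = snd (best 0 ?d (counts (zeros ?d) cs) (length cs))"
      have br: "branches ?d cs = (if bit_at ?d j then splits (having j cs) (lacking j cs) else splits cs [])"
        by (simp add: branches_def branches_at_eq j_def)
      have c: "\<And>x y. x \<in> ?Z \<Longrightarrow> y \<in> ?Z \<Longrightarrow> x \<noteq> y \<Longrightarrow>
          compat (fst (P x)) (fst (P y)) (snd (P x)) (snd (P y))"
        using comp by (auto simp: P_def)
      show ?thesis
      proof (cases "bit_at ?d j")
        case True
        \<comment> \<open>Line \<open>j\<close> is on no placed point, so the point that covers it
          is still to come.\<close>
        then obtain z where z: "z \<in> ?Z" "ls ! j \<in> F z" "j < length ls"
          using cov[of "ls ! j"] by (auto simp: bit_at_bits)
        then have "P z \<in> set (having j cs)"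
          using Suc.prems(4) by (auto simp: having_eq P_def bit_at_bits)
        moreover have "P ` ?Z \<subseteq> set (having j cs) \<union> set (lacking j cs)"
          using Suc.prems(4) by (auto simp: having_eq lacking_eq)
        ultimately show ?thesis
          unfolding br if_P[OF True] using z(1) by (intro splits_sound c) blast+
      next
        case False
        show ?thesis
          unfolding br if_not_P[OF False] using Suc.prems(4) \<open>?Z \<noteq> {}\<close>
          by (intro splits_sound c) auto
      qed
    qed
    then obtain z cs' where z: "z \<in> ?Z" "(P z, cs') \<in> set (branches ?d cs)" "P ` (?Z - {z}) \<subseteq> set cs'"
      by blast
    have "\<exists>xs. distinct xs \<and> set xs = X \<and>
      map P xs \<in> set (search n (map P (z # ys)) (bits ls (- \<Union> (F ` set (z # ys)))) cs')"
      by (rule Suc.IH) (use Suc.prems z in auto)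
    moreover have "bits ls (- \<Union> (F ` set (z # ys))) = bdiff ?d (bits ls (F z))"
      by (simp add: bdiff_bits bits_eq_iff) auto
    ultimately obtain xs where "distinct xs" "set xs = X"
      "map P xs \<in> set (search n (P z # map P ys) (bdiff ?d (bits ls (F z))) cs')" by auto
    then show ?thesis using z(2) noprune by (intro exI[of _ xs]) (force simp: P_def search_Suc)
  qed
qed

text \<open>The set \<open>A\<close> is what the lines chosen before leave of \<open>R\<close>; it
  has to vary because every chosen line is removed from it.\<close>

lemma genp_sound:
  assumes "\<And>l. l \<in> set ls \<Longrightarrow> l \<in> F \<Longrightarrow> l \<inter> set rs \<subseteq> A"
    and "\<And>l l'. l \<in> set ls \<inter> F \<Longrightarrow> l' \<in> set ls \<inter> F \<Longrightarrow> l \<noteq> l' \<Longrightarrow> l \<inter> l' \<inter> set rs = {}"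
    and "distinct ls"
  shows "(bits ls F, bits rs (A - \<Union> (set ls \<inter> F))) \<in> set (genp (map (bits rs) ls) (bits rs A))"
  using assms
proof (induction ls arbitrary: A)
  case (Cons l ls)
  show ?case
  proof (cases "l \<in> F")
    case True
    have "(bits ls F, bits rs (A - l - \<Union> (set ls \<inter> F))) \<in> set (genp (map (bits rs) ls) (bits rs (A - l)))"
    proof (rule Cons.IH)
      fix l' assume l': "l' \<in> set ls" "l' \<in> F"
      then have "l \<inter> l' \<inter> set rs = {}" using Cons.prems(2)[of l l'] Cons.prems(3) True by auto
      then show "l' \<inter> set rs \<subseteq> A - l" using Cons.prems(1)[of l'] l' by auto
    qed (use Cons.prems in auto)
    moreover have "bsub (bits rs l) (bits rs A)"
      using Cons.prems(1)[of l] True by (simp add: bsub_bits)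
    moreover have "A - l - \<Union> (set ls \<inter> F) = A - \<Union> (set (l # ls) \<inter> F)" using True by auto
    ultimately show ?thesis using True by (force simp: bdiff_bits)
  next
    case False
    have "(bits ls F, bits rs (A - \<Union> (set ls \<inter> F))) \<in> set (genp (map (bits rs) ls) (bits rs A))"
      by (rule Cons.IH) (use Cons.prems in auto)
    moreover have "set (l # ls) \<inter> F = set ls \<inter> F" using False by auto
    ultimately show ?thesis using False by force
  qed
qed simp

lemma union_of_bits: "union_of (bits gs A) (bits ls F) (map (bits gs) ls) = bits gs (A \<union> \<Union> (set ls \<inter> F))"
proof (induction ls)
  case (Cons l ls)
  then show ?case by (cases "l \<in> F") (simp_all add: bor_bits Un_ac)
qed simp

lemma map2_bits_Cons: "map2 (#) (bits ls {l. x \<in> l}) (map (bits gs) ls) = map (bits (x # gs)) ls"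
  by (induction ls) auto

section \<open>Geometries as a pair of colour classes\<close>

locale bichromatic_space =
  fixes R G :: "'a set" and LS :: "'a set set"
  assumes finite_R: "finite R" and finite_G: "finite G" and disjoint: "R \<inter> G = {}"
    and line_sub: "l \<in> LS \<Longrightarrow> l \<subseteq> R \<union> G"
    and line_ex1: "x \<in> R \<union> G \<Longrightarrow> y \<in> R \<union> G \<Longrightarrow> x \<noteq> y \<Longrightarrow> \<exists>!l. l \<in> LS \<and> x \<in> l \<and> y \<in> l"
    and line_R: "l \<in> LS \<Longrightarrow> l \<inter> R \<noteq> {}" and line_G: "l \<in> LS \<Longrightarrow> l \<inter> G \<noteq> {}"
    and proper: "l \<in> LS \<Longrightarrow> \<not> R \<union> G \<subseteq> l"
begin

lemma line_eq: "l \<in> LS \<Longrightarrow> l' \<in> LS \<Longrightarrow> x \<noteq> y \<Longrightarrow> x \<in> l \<Longrightarrow> y \<in> l \<Longrightarrow> x \<in> l' \<Longrightarrow> y \<in> l' \<Longrightarrow> l = l'"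
  using line_ex1[of x y] line_sub by blast

lemma line_ex:
  assumes "x \<in> R \<union> G" "y \<in> R \<union> G" "x \<noteq> y"
  obtains l where "l \<in> LS" "x \<in> l" "y \<in> l"
  using line_ex1[OF assms] by blast

text \<open>Join a point \<open>x\<close> of \<open>l\<close> off \<open>R\<close> to a point off
  \<open>l\<close>. That line meets \<open>R\<close>, hence meets \<open>l\<close> in a second
  point, and so would equal \<open>l\<close>.\<close>

lemma not_R_subset:
  assumes "l \<in> LS" shows "\<not> R \<subseteq> l"
proof
  assume R: "R \<subseteq> l"
  obtain x where x: "x \<in> l" "x \<in> G" using line_G assms by auto
  obtain y where y: "y \<in> R \<union> G" "y \<notin> l" using proper assms by auto
  obtain m where m: "m \<in> LS" "x \<in> m" "y \<in> m" using line_ex[of x y] x y by auto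
  obtain z where z: "z \<in> m" "z \<in> R" using line_R m by auto
  then have "x \<noteq> z" using x disjoint by auto
  then have "m = l" using line_eq[OF m(1) assms, of x z] m x z R by auto
  then show False using y m by auto
qed

end

section \<open>From a numbered geometry to the data of the program\<close>

locale labelled_space = bichromatic_space +
  fixes rs :: "'a list" and ls :: "'a set list"
  assumes rs: "distinct rs" "set rs = R" and ls: "distinct ls" "set ls = {l \<in> LS. 2 \<le> card (l \<inter> R)}"
begin

text \<open>For \<open>x\<close> off \<open>R\<close>, these are the points of \<open>R\<close>
  joined to \<open>x\<close> by a line with no further point in \<open>R\<close>.\<close>

definition single :: "'a \<Rightarrow> 'a set" where
  "single x = R - \<Union> (set ls \<inter> {l. x \<in> l})"

definition profile :: "'a \<Rightarrow> bits2" where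
  "profile x = (bits ls {l. x \<in> l}, bits rs (single x))"

definition code :: "'a list \<Rightarrow> 'a set \<Rightarrow> bits2" where
  "code gs l = (bits rs l, bits gs l)"

definition short :: "'a list \<Rightarrow> 'a set set" where
  "short gs = {l \<in> LS. l \<notin> set ls \<and> l \<inter> set gs \<noteq> {}}"

lemma short_R:
  assumes "l \<in> LS" "l \<notin> set ls"
  obtains p where "l \<inter> R = {p}"
proof -
  have "card (l \<inter> R) \<noteq> 0" using line_R[OF assms(1)] finite_R by simp
  moreover have "card (l \<inter> R) < 2" using assms ls by auto
  ultimately have "card (l \<inter> R) = 1" by linarith
  then show ?thesis using that by (auto simp: card_1_singleton_iff)
qed

lemma ls_LS: "l \<in> set ls \<Longrightarrow> l \<in> LS"
  using ls by auto

text \<open>A point in \<open>R\<close> and a listed point off \<open>R\<close> can be read off the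
  code, and they determine the line. This allows \<open>mark\<close> to recognise lines by their
  bits.\<close>

lemma code_inj:
  assumes "l \<in> short gs" "l' \<in> short gs" "set gs \<subseteq> G" "code gs l = code gs l'"
  shows "l = l'"
proof -
  obtain p where p: "l \<inter> R = {p}" using short_R assms(1) by (auto simp: short_def)
  obtain g where g: "g \<in> l" "g \<in> set gs" using assms(1) by (auto simp: short_def)
  have "l \<inter> R = l' \<inter> R" "l \<inter> set gs = l' \<inter> set gs"
    using assms(4) rs by (auto simp: code_def bits_eq_iff)
  then have "p \<in> l" "p \<in> l'" "g \<in> l'" using p g by auto
  moreover have "p \<noteq> g" using p g assms(3) disjoint by auto
  ultimately show ?thesis using line_eq[of l l' p g] g assms by (auto simp: short_def)
qed

text \<open>If the line joining \<open>x\<close> and \<open>y\<close> has a single point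
  \<open>p\<close> in \<open>R\<close>, then a longer line through \<open>p\<close> and
  \<open>x\<close>, or \<open>p\<close> and \<open>y\<close>, would be that same line; so both
  points leave \<open>p\<close> uncovered.\<close>

lemma compat_profile:
  assumes "x \<in> G" "y \<in> G" "x \<noteq> y"
  shows "compat (fst (profile x)) (fst (profile y)) (snd (profile x)) (snd (profile y))"
proof -
  obtain l where l: "l \<in> LS" "x \<in> l" "y \<in> l" using line_ex[of x y] assms by auto
  have sub: "{l. x \<in> l} \<inter> {l. y \<in> l} \<inter> set ls \<subseteq> {l}"
  proof
    fix m assume "m \<in> {l. x \<in> l} \<inter> {l. y \<in> l} \<inter> set ls"
    then show "m \<in> {l}" using line_eq[OF ls_LS l(1) assms(3), of m] l by simp
  qed
  show ?thesis unfolding profile_def fst_conv snd_conv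
  proof (rule compat_bits)
    show "distinct ls" by (rule ls)
    show "card ({l. x \<in> l} \<inter> {l. y \<in> l} \<inter> set ls) \<le> 1"
      using card_mono[OF _ sub] by simp
    assume "{l. x \<in> l} \<inter> {l. y \<in> l} \<inter> set ls = {}"
    then have "l \<notin> set ls" using l by auto
    then obtain p where p: "l \<inter> R = {p}" using short_R l by blast
    then have "p \<noteq> x" "p \<noteq> y" using assms disjoint by auto
    have "p \<in> single z" if z: "z \<in> l" "z \<noteq> p" for z
    proof -
      have "m \<notin> set ls" if "z \<in> m" "p \<in> m" for m
        using line_eq[OF ls_LS l(1) z(2), of m] that z p \<open>l \<notin> set ls\<close> by blast
      then show ?thesis using p by (auto simp: single_def)
    qed
    then have "p \<in> single x \<inter> single y" using l \<open>p \<noteq> x\<close> \<open>p \<noteq> y\<close> by simp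
    moreover have "p \<in> set rs" using p rs by auto
    ultimately show "\<not> bdisj (bits rs (single x)) (bits rs (single y))"
      by (auto simp: bdisj_bits)
  qed
qed

lemma profile_genp:
  assumes "x \<in> G"
  shows "profile x \<in> set (genp (map (bits rs) ls) (replicate (length rs) True))"
proof -
  have 1: "replicate (length rs) True = bits rs R"
    using rs by (auto simp: bits_def list_eq_iff_nth_eq)
  show ?thesis unfolding 1 profile_def single_def
  proof (rule genp_sound)
    fix l l' assume l: "l \<in> set ls \<inter> {l. x \<in> l}" "l' \<in> set ls \<inter> {l. x \<in> l}" "l \<noteq> l'"
    show "l \<inter> l' \<inter> set rs = {}"
    proof (rule ccontr)
      assume "l \<inter> l' \<inter> set rs \<noteq> {}"
      then obtain p where p: "p \<in> l" "p \<in> l'" "p \<in> R" using rs by auto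
      then show False using line_eq[of l l' x p] l assms disjoint ls_LS by auto
    qed
  qed (use rs ls in auto)
qed

lemma search_profiles:
  assumes "card G \<le> n"
  shows "\<exists>xs. distinct xs \<and> set xs = G \<and> map profile xs \<in>
    set (search n [] (map (\<lambda>_. True) ls) (genp (map (bits rs) ls) (replicate (length rs) True)))"
proof -
  have 1: "map (\<lambda>_. True) ls = bits ls (- \<Union> ((\<lambda>x. {l. x \<in> l}) ` set []))" by (simp add: bits_def)
  have 2: "map profile xs = map (\<lambda>x. (bits ls {l. x \<in> l}, bits rs (single x))) xs" for xs
    by (simp add: profile_def)
  have 3: "[] = map (\<lambda>x. (bits ls {l. x \<in> l}, bits rs (single x))) []" by simp
  show ?thesis unfolding 1 2 unfolding 3
  proof (rule search_sound)
    show "\<exists>x\<in>G. l \<in> {l. x \<in> l}" if "l \<in> set ls" for l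
      using that ls line_G by auto
  qed (use ls finite_G compat_profile profile_genp assms in \<open>auto simp: profile_def\<close>)
qed

text \<open>\<open>N\<close> consists of the lines with one point in \<open>R\<close> that join
  \<open>x\<close> to earlier points, \<open>E\<close> of those among them already found, and
  \<open>C\<close> is the union of the longer lines through \<open>x\<close>. The last assumption is
  the invariant of the recursion: every earlier point not yet joined to \<open>x\<close> is still
  waiting in \<open>ys\<close>.\<close>

lemma cover_sound:
  assumes x: "x \<in> G" "x \<notin> set gs" and gs: "distinct gs" "set gs \<subseteq> G"
    and cl: "set cl = code gs ` short gs"
  defines "N \<equiv> {l \<in> short gs. x \<in> l}" and "C \<equiv> \<Union> (set ls \<inter> {l. x \<in> l})"
  assumes "E \<subseteq> N" "set acc = code gs ` E" "set ys \<subseteq> {..<length gs}"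
    and "\<And>j. j < length gs \<Longrightarrow> gs ! j \<notin> C \<union> \<Union> E \<Longrightarrow> j \<in> set ys"
  shows "\<exists>acc'. set acc' = code gs ` N \<and> (acc', bits rs (single x - \<Union> N)) \<in>
    set (cover cl ys acc (bits rs (single x - \<Union> E)) (bits gs (C \<union> \<Union> E)))"
  using assms(8-)
proof (induction ys arbitrary: acc E)
  case Nil
  \<comment> \<open>A line in \<open>N\<close> but not in \<open>E\<close> contains an earlier
    point. With \<open>ys\<close> empty that point is already joined to \<open>x\<close>, and by
    uniqueness of the join the line is in \<open>E\<close> or among the longer ones.\<close>
  have "E = N"
  proof (rule ccontr)
    assume "E \<noteq> N"
    then obtain l where l: "l \<in> N" "l \<notin> E" using Nil.prems by auto
    then obtain g where g: "g \<in> l" "g \<in> set gs" by (auto simp: N_def short_def)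
    then obtain j where "j < length gs" "gs ! j = g" by (metis in_set_conv_nth)
    then have "g \<in> C \<union> \<Union> E" using Nil.prems(4) by fastforce
    then obtain l' where l': "l' \<in> LS" "x \<in> l'" "g \<in> l'" "l' \<in> set ls \<or> l' \<in> E"
      using Nil.prems(1) ls_LS by (auto simp: C_def N_def short_def)
    have "l = l'" using line_eq[of l l' x g] l l' g x by (auto simp: N_def short_def)
    then show False using l l' by (auto simp: N_def short_def)
  qed
  then show ?case using Nil.prems by auto
next
  case (Cons y ys)
  let ?c = "bits gs (C \<union> \<Union> E)"
  show ?case
  proof (cases "bit_at ?c y")
    case True
    then have "gs ! y \<in> C \<union> \<Union> E" by (simp add: bit_at_bits)
    then have "\<And>j. j < length gs \<Longrightarrow> gs ! j \<notin> C \<union> \<Union> E \<Longrightarrow> j \<in> set ys"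
      using Cons.prems(4) by fastforce
    then show ?thesis using Cons.IH[of E acc] Cons.prems True by (simp add: cover_Cons)
  next
    case False
    define g where "g = gs ! y"
    have y: "y < length gs" using Cons.prems by auto
    then have g: "g \<in> set gs" "g \<notin> C" "g \<notin> \<Union> E" using False by (auto simp: g_def bit_at_bits)
    then have "g \<noteq> x" "g \<in> G" using x gs by auto
    then obtain l where l: "l \<in> LS" "x \<in> l" "g \<in> l" using line_ex[of x g] x by auto
    have lE: "l \<notin> E" "l \<notin> set ls" using g l by (auto simp: C_def)
    then have lN: "l \<in> N" using l g by (auto simp: N_def short_def)
    obtain p where p: "l \<inter> R = {p}" using short_R l lE by blast
    have pl: "p \<in> l" "p \<in> R" "p \<noteq> x" using p x disjoint by auto
    \<comment> \<open>\<open>l\<close> shares only \<open>x\<close> with the lines through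
      \<open>x\<close> found before. For \<open>z = p\<close> this shows that \<open>p\<close> is
      still free, and for earlier points that \<open>l\<close> contains none that are already
      joined.\<close>
    have meet: "z = x" if "z \<in> l" "z \<in> l'" "l' \<in> set ls \<union> E" "x \<in> l'" for z l'
    proof (rule ccontr)
      assume "z \<noteq> x"
      then have "l = l'" using line_eq[of l l' z x] that l ls_LS Cons.prems(1) by (auto simp: N_def short_def)
      then show False using lE that by auto
    qed
    have xE: "x \<in> l'" if "l' \<in> E" for l' using that Cons.prems(1) by (auto simp: N_def)
    have 1: "bit_at (bits gs l) y" using y l by (simp add: bit_at_bits g_def)
    have "p \<in> single x - \<Union> E"
      using meet[of p] pl xE by (auto simp: single_def)
    then have 2: "bsub (bits rs l) (bits rs (single x - \<Union> E))"
      using p rs by (auto simp: bsub_bits)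
    have 3: "bdisj (bits gs l) ?c"
      using meet xE x by (auto simp: bdisj_bits C_def)
    have "code gs l \<in> set cl" using lN cl by (auto simp: N_def)
    then have pick: "(bits rs l, bits gs l) \<in> set (picks y (bits rs (single x - \<Union> E)) ?c cl)"
      using 1 2 3 by (simp add: picks_eq code_def)
    have eq: "bdiff (bits rs (single x - \<Union> E)) (bits rs l) = bits rs (single x - \<Union> (insert l E))"
      "bor ?c (bits gs l) = bits gs (C \<union> \<Union> (insert l E))"
      by (auto simp: bdiff_bits bor_bits bits_eq_iff)
    have "\<exists>acc'. set acc' = code gs ` N \<and> (acc', bits rs (single x - \<Union> N)) \<in>
      set (cover cl ys (code gs l # acc) (bits rs (single x - \<Union> (insert l E))) (bits gs (C \<union> \<Union> (insert l E))))"
    proof (rule Cons.IH)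
      show "j \<in> set ys" if "j < length gs" "gs ! j \<notin> C \<union> \<Union> (insert l E)" for j
        using Cons.prems(4)[of j] that l by (auto simp: g_def)
    qed (use Cons.prems lN in auto)
    then obtain acc' where acc': "set acc' = code gs ` N" "(acc', bits rs (single x - \<Union> N)) \<in>
      set (cover cl ys ((bits rs l, bits gs l) # acc) (bdiff (bits rs (single x - \<Union> E)) (bits rs l)) (bor ?c (bits gs l)))"
      unfolding eq code_def by blast
    have "(acc', bits rs (single x - \<Union> N)) \<in> set (cover cl (y # ys) acc (bits rs (single x - \<Union> E)) ?c)"
      unfolding cover_Cons if_not_P[OF False] set_concat set_map
      by (rule UN_I[OF imageI[OF pick]]) (use acc'(2) in simp)
    then show ?thesis using acc'(1) by blast
  qed
qed

definition state_of :: "'a list \<Rightarrow> state \<Rightarrow> bool" where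
  "state_of gs st \<longleftrightarrow> fst st = map (bits gs) ls \<and> set (snd st) = code gs ` short gs"

text \<open>The lines with one point in \<open>R\<close> after adding \<open>x\<close> are the old
  ones, marked if \<open>x\<close> is on them, and those on which \<open>x\<close> is the only
  listed point off \<open>R\<close>. The latter correspond to the points of \<open>R\<close> that
  the cover leaves free.\<close>

lemma ext_sound:
  assumes x: "x \<in> G" "x \<notin> set gs" and gs: "distinct gs" "set gs \<subseteq> G" and st: "state_of gs st"
  shows "\<exists>st' \<in> set (ext (bits gs {}) (rev [0..<length gs]) (profile x) st). state_of (x # gs) st'"
proof -
  obtain rg cl where st_eq: "st = (rg, cl)" by (cases st)
  with st have rg: "rg = map (bits gs) ls" and cl: "set cl = code gs ` short gs"
    by (auto simp: state_of_def)
  define N where "N = {l \<in> short gs. x \<in> l}"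
  have un: "union_of (bits gs {}) (bits ls {l. x \<in> l}) rg = bits gs (\<Union> (set ls \<inter> {l. x \<in> l}) \<union> \<Union> {})"
    using union_of_bits[of gs "{}" ls "{l. x \<in> l}"] rg by simp
  have "\<exists>acc'. set acc' = code gs ` N \<and> (acc', bits rs (single x - \<Union> N)) \<in>
    set (cover cl (rev [0..<length gs]) [] (bits rs (single x - \<Union> {})) (bits gs (\<Union> (set ls \<inter> {l. x \<in> l}) \<union> \<Union> {})))"
    unfolding N_def by (rule cover_sound) (use x gs cl in auto)
  then obtain acc where acc: "set acc = code gs ` N" "(acc, bits rs (single x - \<Union> N)) \<in>
      set (cover cl (rev [0..<length gs]) [] (bits rs (single x)) (union_of (bits gs {}) (bits ls {l. x \<in> l}) rg))"
    unfolding un by auto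
  define new where "new = map (\<lambda>u. (u, True # bits gs {})) (units (bits rs (single x - \<Union> N)))"
  define st' where "st' = (map2 (#) (bits ls {l. x \<in> l}) rg, mark acc cl @ new)"
  have "st' \<in> set (ext (bits gs {}) (rev [0..<length gs]) (profile x) st)"
    using acc(2) by (force simp: st_eq profile_def st'_def new_def ext_all_eq)
  moreover have "fst st' = map (bits (x # gs)) ls"
    by (simp add: st'_def rg map2_bits_Cons)
  moreover have "set (snd st') = code (x # gs) ` short (x # gs)"
  proof -
    have old: "set (mark acc cl) = code (x # gs) ` short gs"
    proof -
      have "code gs l \<in> set acc \<longleftrightarrow> x \<in> l" if "l \<in> short gs" for l
        using code_inj[OF that _ gs(2)] that unfolding acc(1) N_def by blast
      then show ?thesis
        unfolding mark_eq set_map cl image_image by (intro image_cong) (auto simp: code_def)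
    qed
    have "set new = code (x # gs) ` {l \<in> LS. l \<notin> set ls \<and> x \<in> l \<and> l \<inter> set gs = {}}" (is "_ = _ ` ?M")
    proof -
      have "set new = (\<lambda>p. (bits rs {p}, True # bits gs {})) ` ((single x - \<Union> N) \<inter> R)"
        by (simp add: new_def set_units rs image_image)
      also have "\<dots> = code (x # gs) ` ?M"
      proof (intro equalityI image_subsetI)
        fix p assume p: "p \<in> (single x - \<Union> N) \<inter> R"
        then have "p \<noteq> x" using x disjoint by auto
        then obtain l where l: "l \<in> LS" "x \<in> l" "p \<in> l" using line_ex[of x p] p x by auto
        have nl: "l \<notin> set ls" using p l by (auto simp: single_def)
        have lg: "l \<inter> set gs = {}" using p l nl by (auto simp: N_def short_def)
        obtain q where "l \<inter> R = {q}" using short_R l nl by blast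
        then have lp: "l \<inter> R = {p}" using p l by auto
        have M: "l \<in> ?M" using l nl lg by simp
        have c: "code (x # gs) l = (bits rs {p}, True # bits gs {})"
          using l lg lp p rs(2) by (simp add: code_def bits_eq_iff)
        show "(bits rs {p}, True # bits gs {}) \<in> code (x # gs) ` ?M"
          unfolding c[symmetric] using M by (rule imageI)
      next
        fix l assume l: "l \<in> ?M"
        then obtain p where p: "l \<inter> R = {p}" using short_R by blast
        then have px: "p \<noteq> x" "p \<in> R" "p \<in> l" using x disjoint by auto
        have "l' = l" if "l' \<in> LS" "x \<in> l'" "p \<in> l'" for l'
          using line_eq[of l' l x p] that l px by auto
        then have "p \<notin> l'" if "x \<in> l'" "l' \<in> set ls \<or> l' \<in> N" for l'
          using that l ls_LS by (auto simp: N_def short_def)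
        then have P: "p \<in> (single x - \<Union> N) \<inter> R"
          using px by (auto simp: single_def N_def)
        have c: "code (x # gs) l = (bits rs {p}, True # bits gs {})"
          using l p px rs(2) by (simp add: code_def bits_eq_iff)
        show "code (x # gs) l \<in> (\<lambda>p. (bits rs {p}, True # bits gs {})) ` ((single x - \<Union> N) \<inter> R)"
          unfolding c using P by (rule imageI)
      qed
      finally show ?thesis .
    qed
    moreover have "short (x # gs) = short gs \<union> ?M" by (auto simp: short_def)
    ultimately show ?thesis using old by (simp add: st'_def image_Un)
  qed
  ultimately show ?thesis by (auto simp: state_of_def)
qed

lemma extend_sound:
  assumes "distinct xs" "set xs \<subseteq> G"
  shows "\<exists>st \<in> set (extend (map (bits rs) ls) (map profile xs)). state_of xs st"
  using assms
proof (induction xs)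
  case Nil
  show ?case by (auto simp: state_of_def short_def)
next
  case (Cons x xs)
  then obtain st where st: "st \<in> set (extend (map (bits rs) ls) (map profile xs))" "state_of xs st"
    by auto
  have "map (\<lambda>_. False) (map profile xs) = bits xs {}" by (simp add: bits_def)
  then show ?case using ext_sound[of x xs st] st Cons.prems by (auto simp: ext_states_eq)
qed

text \<open>The numbering \<open>gs\<close> is the order in which the search happens to place the
  points.\<close>

lemma solutions_sound:
  assumes "card G \<le> n" "length rs \<le> card G"
  shows "\<exists>S \<in> set (solutions (length rs) n (map (bits rs) ls)).
    \<exists>gs. distinct gs \<and> set gs = G \<and> (\<forall>l\<in>LS. (bits rs l, bits gs l) \<in> set S)"
proof -
  obtain xs where xs: "distinct xs" "set xs = G" "map profile xs \<in>
      set (search n [] (map (\<lambda>_. True) ls) (genp (map (bits rs) ls) (replicate (length rs) True)))"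
    using search_profiles[OF assms(1)] by blast
  obtain rg cl where st: "(rg, cl) \<in> set (extend (map (bits rs) ls) (map profile xs))" "state_of xs (rg, cl)"
    using extend_sound xs by (metis order_refl surj_pair)
  let ?S = "zip (map (bits rs) ls) rg @ cl"
  have "\<not> length (map profile xs) < length rs" using assms xs distinct_card by fastforce
  then have "?S \<in> set (solutions (length rs) n (map (bits rs) ls))"
    unfolding solutions_def using xs(3) st(1) by (force simp: comp_def solve_all_eq assemble_eq)
  moreover have "(bits rs l, bits xs l) \<in> set ?S" if "l \<in> LS" for l
  proof (cases "l \<in> set ls")
    case True
    then show ?thesis using st(2) by (force simp: state_of_def zip_map_map zip_same_conv_map)
  next
    case False
    then have "l \<in> short xs" using that line_G xs by (auto simp: short_def)
    then show ?thesis using st(2) by (auto simp: state_of_def code_def)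
  qed
  ultimately show ?thesis using xs by blast
qed

end

section \<open>Tables and certificates\<close>

definition relabel :: "nat list \<Rightarrow> bits \<Rightarrow> bits" where
  "relabel \<pi> b = map (bit_at b) \<pi>"

definition is_perm :: "nat list \<Rightarrow> bool" where
  "is_perm \<pi> \<longleftrightarrow> list_all (\<lambda>i. i \<in> set \<pi>) [0..<length \<pi>]"

fun same_length :: "'a list \<Rightarrow> 'b list \<Rightarrow> bool" where
  "same_length [] [] = True"
| "same_length (x # xs) (y # ys) = same_length xs ys"
| "same_length _ _ = False"

type_synonym certificate = "nat \<times> nat list"

text \<open>The first components refer to the smaller colour class. The last green point of \<open>T13\<close> is \<open>H\<close>.\<close>

definition T13 :: "bits2 list" where
  "T13 = map (\<lambda>(a, b). (block 6 a, block 7 b)) [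
    ([3], [0,1,4]), ([1], [0,2,5]), ([0,2,4], [0]), ([5], [0,3,6]), ([0], [1,2,6]),
    ([1,2,5], [1]), ([4], [1,3,5]), ([3,4,5], [2]), ([0,1,3], [3]), ([2,3], [5,6]),
    ([2], [2,3,4]), ([1,4], [4,6]), ([0,5], [4,5])]"

text \<open>The green points 0 to 3 of \<open>T13\<close> form the quadrangle and 4, 5, 6 are its
  diagonal points; the red ones are the vertices of a complete quadrilateral whose four sides
  contain one point of the quadrangle each. Without point 6, the last one, every row still has a
  green point and at least three points, so all rows remain.\<close>

definition T12 :: "bits2 list" where
  "T12 = map (\<lambda>(a, b). (a, butlast b)) T13"

definition pg24_lines :: "point set list" where
  "pg24_lines = map (\<lambda>(i, j). PG24_line i j) (List.product [0..<7] [0..<3])"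

definition pg24_bits :: "point list \<Rightarrow> point list \<Rightarrow> bits2 list" where
  "pg24_bits rs gs = filter (\<lambda>(a, b). 2 \<le> weight a + weight b) (map (\<lambda>l. (bits rs l, bits gs l)) pg24_lines)"

definition row0 :: "point list" where "row0 = map (\<lambda>i. Ix i 0) [0..<7]"
definition row1 :: "point list" where "row1 = map (\<lambda>i. Ix i 1) [0..<7]"
definition reds14 :: "point list" where "reds14 = [Ix 2 1, Ix 4 1, Ix 5 1, Ix 6 1, Ix 0 2, Ix 1 2, Ix 3 2]"
definition greens15 :: "point list" where "greens15 = [Ix 0 0, Ix 1 0, Ix 3 0, Ix 4 0, Ix 5 1, Ix 1 2, Ix 5 2]"
definition reds15 :: "point list" where "reds15 = [Ix 2 0, Ix 5 0, Ix 6 0, Ix 2 1, Ix 4 1, Ix 6 1, Ix 2 2, Ix 4 2]"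

definition "T14_1 = pg24_bits row1 row0"
definition "T14_2 = pg24_bits reds14 row0"
definition "T14_2' = pg24_bits row0 reds14"
definition "T15_1 = pg24_bits row1 (row0 @ [Ix 6 2])"
text \<open>The last bit is the added point, which lies on exactly the two-point lines of
  \<open>MR14_1\<close>.\<close>

definition "T15_2 = map (\<lambda>(a, b). (a, b @ [weight a + weight b = 2])) T14_1"
definition "T15_3r = pg24_bits row0 (reds14 @ [Ix 4 2])"
definition "T15_3g = pg24_bits reds14 (row0 @ [Ix 4 2])"
definition "T15_4 = pg24_bits row0 (reds14 @ [Ix 3 1])"
definition "T15_5 = pg24_bits greens15 reds15"

text \<open>\<open>T14_2'\<close> is there because in a geometry on \<open>7 + 7\<close> points either class can be taken for \<open>R\<close>.\<close>

definition targets :: "bits2 list list" where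
  "targets = [T12, T13, T14_1, T14_2, T14_2', T15_1, T15_2, T15_3r, T15_3g, T15_4, T15_5]"

text \<open>Each row must occur in the table after renumbering; the converse is not compared. The
  length is tested as well because \<open>bit_at\<close> is false past the end, so that a wrong
  number of points could go unnoticed.\<close>

fun cert_lines :: "nat list \<Rightarrow> nat list \<Rightarrow> bits2 list \<Rightarrow> bits2 list \<Rightarrow> bool"
  and cert_if :: "bool \<Rightarrow> nat list \<Rightarrow> nat list \<Rightarrow> bits2 list \<Rightarrow> bits2 list \<Rightarrow> bool" where
  "cert_lines \<pi> \<rho> T [] = True"
| "cert_lines \<pi> \<rho> T ((a, b) # S) = cert_if (same_length b \<rho> \<and> mem (relabel \<pi> a, relabel \<rho> b) T) \<pi> \<rho> T S"
| "cert_if True \<pi> \<rho> T S = cert_lines \<pi> \<rho> T S"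
| "cert_if False \<pi> \<rho> T S = False"

fun cert_split :: "bits2 list list \<Rightarrow> nat \<Rightarrow> nat \<Rightarrow> nat list \<Rightarrow> nat list \<Rightarrow> bits2 list \<Rightarrow> bool" where
  "cert_split Ts r i \<pi> \<rho> S \<longleftrightarrow> i < length Ts \<and> length \<pi> = r \<and> is_perm \<pi> \<and> is_perm \<rho> \<and> cert_lines \<pi> \<rho> (Ts ! i) S"

fun certified :: "bits2 list list \<Rightarrow> nat \<Rightarrow> certificate list \<Rightarrow> bits2 list list \<Rightarrow> bool"
  and certified_if :: "bool \<Rightarrow> bits2 list list \<Rightarrow> nat \<Rightarrow> certificate list \<Rightarrow> bits2 list list \<Rightarrow> bool" where
  "certified Ts r [] [] = True"
| "certified Ts r ((i, \<pi>) # cs) (S # Ss) = certified_if (cert_split Ts r i (take r \<pi>) (drop r \<pi>) S) Ts r cs Ss"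
| "certified Ts r _ _ = False"
| "certified_if True Ts r cs Ss = certified Ts r cs Ss"
| "certified_if False Ts r cs Ss = False"

text \<open>The certificates are listed in the order in which the search finds its outcomes. Each consists of
  the index of a target and the list of points of the outcome that correspond to the points of the
  target, first those in \<open>R\<close>, then those off \<open>R\<close>.\<close>

definition certificates6 :: "certificate list" where
  "certificates6 = [
    (0, [0,1,3,2,4,5,4,3,2,5,1,0]), (1, [0,1,3,2,4,5,5,4,3,6,2,1,0]),
    (0, [1,0,3,2,5,4,3,4,2,5,1,0]), (0, [2,0,4,1,5,3,2,4,3,5,1,0])]"

definition certificates7 :: "certificate list" where
  "certificates7 = [
    (8, [1,3,0,6,2,4,5,6,5,3,4,1,0,7,2]), (10, [0,3,4,2,5,1,6,1,6,7,2,4,5,3,0]),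
    (10, [1,3,5,2,4,0,6,1,6,7,3,5,4,2,0]), (8, [0,3,1,6,2,5,4,6,4,2,5,1,0,7,3]),
    (3, [0,1,3,6,4,5,2,4,3,0,5,2,1,6]), (8, [0,1,3,6,4,5,2,5,4,1,6,3,2,7,0]),
    (8, [3,0,1,6,5,2,4,4,6,2,5,1,3,7,0]), (3, [0,3,1,6,2,5,4,5,3,0,4,2,1,6]),
    (8, [3,1,0,6,4,2,5,5,6,3,4,2,1,7,0]), (8, [1,0,3,6,5,4,2,4,5,2,6,1,3,7,0]),
    (10, [0,1,2,4,5,3,6,2,5,7,1,4,6,3,0])]"

definition certificates_fano :: "certificate list" where
  "certificates_fano = [
    (4, [1,4,5,6,2,0,3,5,3,1,2,4,6,0]), (4, [0,3,2,4,6,5,1,3,6,2,5,0,4,1]),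
    (4, [0,5,4,6,2,1,3,3,5,1,4,2,6,0]), (4, [1,3,2,5,6,4,0,5,6,4,3,0,2,1]),
    (2, [0,2,5,1,4,3,6,3,5,1,0,4,2,6]), (4, [2,4,0,5,3,6,1,2,6,3,0,4,1,5]),
    (4, [2,3,4,6,0,1,5,3,0,4,1,2,6,5]), (4, [0,1,6,2,4,3,5,3,4,0,6,1,5,2]),
    (4, [0,1,4,2,6,5,3,3,5,1,6,0,4,2]), (4, [2,6,0,3,5,4,1,2,6,3,1,5,0,4]),
    (4, [2,5,6,4,0,1,3,3,1,5,0,2,6,4]), (2, [0,2,3,1,6,5,4,3,4,0,1,5,2,6]),
    (4, [1,5,2,3,4,6,0,4,6,5,3,1,2,0]), (4, [0,5,2,6,4,3,1,3,6,2,4,1,5,0]),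
    (4, [0,3,6,4,2,1,5,3,4,0,5,2,6,1]), (4, [1,6,3,4,2,0,5,4,3,0,2,5,6,1]),
    (4, [2,3,5,6,1,0,4,5,0,2,1,4,6,3]), (4, [0,2,3,1,6,5,4,0,5,2,6,3,4,1]),
    (2, [0,1,5,2,3,4,6,0,5,2,3,4,1,6]), (4, [2,5,1,4,3,6,0,4,6,5,0,2,1,3]),
    (4, [0,5,3,6,1,2,4,0,5,2,4,1,6,3]), (4, [1,5,6,3,0,2,4,0,2,5,3,1,6,4]),
    (4, [1,4,3,6,0,2,5,0,3,4,2,1,6,5]), (4, [0,4,6,3,1,2,5,0,4,3,5,1,6,2]),
    (4, [0,4,1,3,6,5,2,0,6,1,5,3,4,2]), (4, [1,6,0,4,5,3,2,1,6,0,2,5,3,4]),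
    (4, [1,3,0,5,4,6,2,1,6,0,3,4,2,5]), (4, [0,5,1,6,3,4,2,0,6,1,4,2,5,3]),
    (4, [2,4,1,5,6,3,0,5,6,4,0,3,1,2]), (2, [0,1,4,2,6,5,3,0,4,3,2,5,1,6]),
    (4, [0,2,6,1,3,4,5,0,4,3,6,2,5,1]), (4, [2,6,4,3,1,0,5,4,0,3,1,5,6,2]),
    (4, [2,4,6,5,1,0,3,5,1,3,0,4,6,2]), (2, [0,1,6,2,4,3,5,1,5,3,2,4,0,6]),
    (4, [0,2,4,1,5,6,3,1,5,3,6,2,4,0]), (4, [2,6,1,3,4,5,0,4,6,5,1,3,0,2]),
    (4, [0,3,1,4,5,6,2,1,6,0,5,2,4,3]), (4, [1,4,0,6,3,5,2,0,6,1,2,4,3,5]),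
    (4, [1,5,0,3,6,4,2,0,6,1,3,5,2,4]), (4, [0,6,1,5,4,3,2,1,6,0,4,3,5,2]),
    (4, [0,6,4,5,1,2,3,1,5,3,4,0,6,2]), (4, [1,3,4,5,0,2,6,1,2,4,3,0,6,5]),
    (4, [1,6,5,4,0,2,3,1,3,5,2,0,6,4]), (4, [0,3,5,4,1,2,6,1,4,2,5,0,6,3]),
    (4, [2,3,1,6,5,4,0,5,6,4,1,2,0,3]), (4, [0,2,5,1,4,3,6,1,4,2,6,3,5,0]),
    (2, [0,1,3,2,5,6,4,1,4,2,3,5,0,6]), (4, [2,5,3,4,1,0,6,4,1,2,0,5,6,3]),
    (4, [1,3,6,5,2,0,4,5,2,0,3,4,6,1]), (4, [0,6,3,5,2,1,4,2,5,0,4,3,6,1]),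
    (4, [0,4,2,3,5,6,1,2,6,3,5,1,4,0]), (4, [1,4,2,6,5,3,0,5,6,4,2,1,3,0]),
    (4, [0,1,3,2,5,6,4,2,5,0,6,1,4,3]), (4, [2,6,5,3,0,1,4,2,0,5,1,3,6,4]),
    (4, [2,5,0,4,6,3,1,3,6,2,0,5,1,4]), (2, [0,2,4,1,5,6,3,2,4,1,0,5,3,6]),
    (2, [0,2,6,1,3,4,5,2,5,0,1,4,3,6]), (4, [2,4,3,5,0,1,6,2,1,4,0,3,6,5]),
    (4, [2,3,0,6,4,5,1,3,6,2,1,4,0,5]), (4, [0,1,5,2,3,4,6,2,4,1,6,0,5,3]),
    (4, [1,6,2,4,3,5,0,4,6,5,2,0,3,1]), (4, [0,4,5,3,2,1,6,2,4,1,5,3,6,0]),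
    (4, [0,6,2,5,3,4,1,2,6,3,4,0,5,1]), (4, [1,5,4,3,2,0,6,4,2,1,3,5,6,0]),
    (9, [1,4,5,6,2,0,3,6,4,2,3,5,7,1,0]), (9, [1,4,5,6,2,0,3,6,4,2,3,5,7,0,1]),
    (9, [0,5,4,6,2,1,3,4,6,2,5,3,7,1,0]), (9, [0,5,4,6,2,1,3,4,6,2,5,3,7,0,1]),
    (5, [2,5,0,4,6,3,1,6,2,4,5,7,3,1,0]), (5, [2,5,0,4,6,3,1,6,2,4,5,7,3,0,1]),
    (7, [2,0,4,1,3,6,5,5,0,4,7,3,2,6,1]), (7, [2,0,4,1,3,6,5,5,1,4,7,3,2,6,0]),
    (9, [1,2,5,0,4,6,3,2,4,6,7,5,3,1,0]), (9, [1,2,5,0,4,6,3,2,4,6,7,5,3,0,1]),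
    (5, [2,4,6,5,1,0,3,5,7,6,3,2,4,0,1]), (5, [2,4,6,5,1,0,3,5,7,6,3,2,4,1,0]),
    (9, [0,5,2,6,4,3,1,4,7,3,5,2,6,0,1]), (9, [0,5,2,6,4,3,1,4,7,3,5,2,6,1,0]),
    (7, [4,0,2,3,1,6,5,5,1,4,6,2,3,7,0]), (7, [4,0,2,3,1,6,5,5,0,4,6,2,3,7,1]),
    (7, [2,1,5,0,3,6,4,3,0,6,7,5,2,4,1]), (7, [2,1,5,0,3,6,4,3,1,6,7,5,2,4,0]),
    (5, [2,4,1,5,6,3,0,4,2,6,3,7,5,1,0]), (5, [2,4,1,5,6,3,0,4,2,6,3,7,5,0,1]),
    (7, [5,3,2,1,6,0,4,6,0,3,4,7,5,2,1]), (7, [5,3,2,1,6,0,4,6,1,3,4,7,5,2,0]),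
    (7, [4,3,2,0,6,1,5,4,0,5,6,7,3,2,1]), (7, [4,3,2,0,6,1,5,4,1,5,6,7,3,2,0]),
    (7, [4,1,5,6,3,0,2,7,0,2,3,5,6,4,1]), (7, [4,1,5,6,3,0,2,7,1,2,3,5,6,4,0]),
    (7, [5,1,4,3,6,0,2,7,1,2,4,6,5,3,0]), (7, [5,1,4,3,6,0,2,7,0,2,4,6,5,3,1]),
    (5, [2,5,1,4,3,6,0,3,2,5,4,7,6,0,1]), (5, [2,5,1,4,3,6,0,3,2,5,4,7,6,1,0]),
    (7, [2,1,4,0,6,3,5,4,1,5,7,6,2,3,0]), (7, [2,1,4,0,6,3,5,4,0,5,7,6,2,3,1]),
    (5, [2,5,6,4,0,1,3,3,7,4,5,2,6,0,1]), (5, [2,5,6,4,0,1,3,3,7,4,5,2,6,1,0]),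
    (9, [0,2,4,1,5,6,3,2,6,4,7,3,5,1,0]), (9, [0,2,4,1,5,6,3,2,6,4,7,3,5,0,1]),
    (7, [4,0,5,3,6,1,2,7,1,2,6,4,3,5,0]), (7, [4,0,5,3,6,1,2,7,0,2,6,4,3,5,1]),
    (7, [5,0,4,6,3,1,2,7,0,2,5,3,4,6,1]), (7, [5,0,4,6,3,1,2,7,1,2,5,3,4,6,0]),
    (9, [3,5,2,1,4,0,6,5,2,3,4,7,6,0,1]), (9, [3,5,2,1,4,0,6,5,2,3,4,7,6,1,0]),
    (9, [3,4,2,0,5,1,6,3,2,5,6,7,4,0,1]), (9, [3,4,2,0,5,1,6,3,2,5,6,7,4,1,0]),
    (9, [0,2,5,1,4,3,6,2,5,3,7,4,6,0,1]), (9, [0,2,5,1,4,3,6,2,5,3,7,4,6,1,0]),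
    (5, [2,4,3,5,0,1,6,4,7,3,6,2,5,1,0]), (5, [2,4,3,5,0,1,6,4,7,3,6,2,5,0,1]),
    (7, [5,0,2,6,1,3,4,6,0,3,5,2,4,7,1]), (7, [5,0,2,6,1,3,4,6,1,3,5,2,4,7,0]),
    (9, [0,4,2,3,5,6,1,3,7,4,6,2,5,1,0]), (9, [0,4,2,3,5,6,1,3,7,4,6,2,5,0,1]),
    (7, [2,0,5,1,6,3,4,6,1,3,7,4,2,5,0]), (7, [2,0,5,1,6,3,4,6,0,3,7,4,2,5,1]),
    (5, [2,4,0,5,3,6,1,5,2,3,6,7,4,0,1]), (5, [2,4,0,5,3,6,1,5,2,3,6,7,4,1,0]),
    (5, [2,5,3,4,1,0,6,6,7,5,4,2,3,1,0]), (5, [2,5,3,4,1,0,6,6,7,5,4,2,3,0,1]),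
    (9, [1,2,4,0,5,3,6,2,3,5,7,6,4,0,1]), (9, [1,2,4,0,5,3,6,2,3,5,7,6,4,1,0]),
    (9, [0,4,5,3,2,1,6,3,5,2,6,4,7,0,1]), (9, [0,4,5,3,2,1,6,3,5,2,6,4,7,1,0]),
    (9, [1,5,4,3,2,0,6,5,3,2,4,6,7,0,1]), (9, [1,5,4,3,2,0,6,5,3,2,4,6,7,1,0]),
    (7, [6,0,2,5,1,4,3,6,0,4,5,1,3,7,2]), (9, [0,3,2,4,6,5,1,4,7,3,6,1,5,2,0]),
    (7, [6,0,2,5,1,4,3,6,2,4,5,1,3,7,0]), (9, [0,3,2,4,6,5,1,4,7,3,6,1,5,0,2]),
    (5, [2,6,4,3,1,0,5,6,7,5,3,1,4,2,0]), (9, [1,2,3,0,6,4,5,1,4,5,7,6,3,0,2]),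
    (5, [2,6,4,3,1,0,5,6,7,5,3,1,4,0,2]), (9, [1,2,3,0,6,4,5,1,4,5,7,6,3,2,0]),
    (7, [2,0,6,1,5,4,3,6,2,4,7,3,1,5,0]), (5, [2,3,0,6,4,5,1,5,1,4,6,7,3,0,2]),
    (7, [2,0,6,1,5,4,3,6,0,4,7,3,1,5,2]), (5, [2,3,0,6,4,5,1,5,1,4,6,7,3,2,0]),
    (9, [0,3,6,4,2,1,5,4,5,1,6,3,7,0,2]), (9, [1,6,3,4,2,0,5,5,4,1,3,6,7,0,2]),
    (9, [0,3,6,4,2,1,5,4,5,1,6,3,7,2,0]), (9, [1,6,3,4,2,0,5,5,4,1,3,6,7,2,0]),
    (5, [2,6,5,3,0,1,4,4,7,3,5,1,6,0,2]), (9, [0,2,3,1,6,5,4,1,6,3,7,4,5,2,0]),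
    (5, [2,6,5,3,0,1,4,4,7,3,5,1,6,2,0]), (9, [0,2,3,1,6,5,4,1,6,3,7,4,5,0,2]),
    (9, [4,6,2,1,3,0,5,5,1,4,3,7,6,0,2]), (9, [4,3,2,0,6,1,5,4,1,5,6,7,3,0,2]),
    (9, [4,6,2,1,3,0,5,5,1,4,3,7,6,2,0]), (9, [4,3,2,0,6,1,5,4,1,5,6,7,3,2,0]),
    (7, [3,0,6,4,5,1,2,7,2,1,6,3,4,5,0]), (7, [6,0,3,5,4,1,2,7,0,1,5,4,3,6,2]),
    (7, [3,0,6,4,5,1,2,7,0,1,6,3,4,5,2]), (7, [6,0,3,5,4,1,2,7,2,1,5,4,3,6,0]),
    (9, [0,2,6,1,3,4,5,1,5,4,7,3,6,0,2]), (5, [2,3,4,6,0,1,5,3,7,4,6,1,5,2,0]),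
    (9, [0,2,6,1,3,4,5,1,5,4,7,3,6,2,0]), (5, [2,3,4,6,0,1,5,3,7,4,6,1,5,0,2]),
    (7, [2,1,6,0,4,5,3,4,0,6,7,5,1,3,2]), (5, [2,3,1,6,5,4,0,3,1,6,4,7,5,2,0]),
    (7, [2,1,6,0,4,5,3,4,2,6,7,5,1,3,0]), (5, [2,3,1,6,5,4,0,3,1,6,4,7,5,0,2]),
    (7, [3,1,6,5,4,0,2,7,0,1,4,5,6,3,2]), (7, [6,1,3,4,5,0,2,7,2,1,3,6,5,4,0]),
    (7, [3,1,6,5,4,0,2,7,2,1,4,5,6,3,0]), (7, [6,1,3,4,5,0,2,7,0,1,3,6,5,4,2]),
    (7, [6,4,2,1,5,0,3,6,0,4,3,7,5,1,2]), (7, [3,4,2,0,5,1,6,3,0,5,6,7,4,1,2]),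
    (7, [6,4,2,1,5,0,3,6,2,4,3,7,5,1,0]), (7, [3,4,2,0,5,1,6,3,2,5,6,7,4,1,0]),
    (5, [2,6,1,3,4,5,0,4,1,5,3,7,6,0,2]), (7, [2,1,3,0,5,4,6,3,2,5,7,6,1,4,0]),
    (5, [2,6,1,3,4,5,0,4,1,5,3,7,6,2,0]), (7, [2,1,3,0,5,4,6,3,0,5,7,6,1,4,2]),
    (9, [1,3,6,5,2,0,4,6,3,1,4,5,7,2,0]), (9, [0,6,3,5,2,1,4,3,6,1,5,4,7,2,0]),
    (9, [1,3,6,5,2,0,4,6,3,1,4,5,7,0,2]), (9, [0,6,3,5,2,1,4,3,6,1,5,4,7,0,2]),
    (9, [1,2,6,0,3,5,4,1,3,6,7,5,4,2,0]), (5, [2,3,5,6,1,0,4,5,7,6,4,1,3,0,2]),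
    (9, [1,2,6,0,3,5,4,1,3,6,7,5,4,0,2]), (5, [2,3,5,6,1,0,4,5,7,6,4,1,3,2,0]),
    (5, [2,6,0,3,5,4,1,6,1,3,5,7,4,2,0]), (7, [2,0,3,1,4,5,6,5,0,3,7,4,1,6,2]),
    (5, [2,6,0,3,5,4,1,6,1,3,5,7,4,0,2]), (7, [2,0,3,1,4,5,6,5,2,3,7,4,1,6,0]),
    (9, [0,6,2,5,3,4,1,3,7,4,5,1,6,0,2]), (7, [3,0,2,4,1,5,6,5,2,3,6,1,4,7,0]),
    (9, [0,6,2,5,3,4,1,3,7,4,5,1,6,2,0]), (7, [3,0,2,4,1,5,6,5,0,3,6,1,4,7,2]),
    (5, [1,6,5,4,0,2,3,1,7,2,5,4,6,0,3]), (7, [4,0,6,3,5,2,1,7,3,4,6,2,1,5,0]),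
    (9, [3,6,1,2,4,0,5,5,4,1,2,7,6,0,3]), (9, [0,1,6,2,4,3,5,4,5,1,7,2,6,0,3]),
    (5, [1,6,5,4,0,2,3,1,7,2,5,4,6,3,0]), (7, [4,0,6,3,5,2,1,7,0,4,6,2,1,5,3]),
    (9, [3,6,1,2,4,0,5,5,4,1,2,7,6,3,0]), (9, [0,1,6,2,4,3,5,4,5,1,7,2,6,3,0]),
    (9, [0,1,4,2,6,5,3,4,6,2,7,1,5,3,0]), (7, [6,0,4,5,3,2,1,7,0,4,5,1,2,6,3]),
    (9, [3,4,1,0,6,2,5,1,4,5,6,7,2,0,3]), (5, [1,4,3,6,0,2,5,2,7,1,6,4,5,3,0]),
    (9, [0,1,4,2,6,5,3,4,6,2,7,1,5,0,3]), (7, [6,0,4,5,3,2,1,7,3,4,5,1,2,6,0]),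
    (9, [3,4,1,0,6,2,5,1,4,5,6,7,2,3,0]), (5, [1,4,3,6,0,2,5,2,7,1,6,4,5,0,3]),
    (7, [6,0,1,5,2,3,4,6,0,1,5,4,2,7,3]), (7, [1,0,6,2,5,3,4,6,3,1,7,2,4,5,0]),
    (5, [1,6,3,4,2,0,5,6,7,5,2,4,1,3,0]), (9, [0,4,6,3,1,2,5,1,5,4,6,2,7,0,3]),
    (7, [6,0,1,5,2,3,4,6,3,1,5,4,2,7,0]), (7, [1,0,6,2,5,3,4,6,0,1,7,2,4,5,3]),
    (5, [1,6,3,4,2,0,5,6,7,5,2,4,1,0,3]), (9, [0,4,6,3,1,2,5,1,5,4,6,2,7,3,0]),
    (9, [0,4,1,3,6,5,2,1,7,2,6,4,5,3,0]), (5, [1,4,0,6,3,5,2,5,4,1,6,7,2,0,3]),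
    (9, [2,1,4,0,6,3,5,4,1,5,7,6,2,0,3]), (9, [2,6,4,3,1,0,5,5,1,4,2,6,7,0,3]),
    (9, [0,4,1,3,6,5,2,1,7,2,6,4,5,0,3]), (5, [1,4,0,6,3,5,2,5,4,1,6,7,2,3,0]),
    (9, [2,1,4,0,6,3,5,4,1,5,7,6,2,3,0]), (9, [2,6,4,3,1,0,5,5,1,4,2,6,7,3,0]),
    (9, [2,4,6,5,1,0,3,6,2,4,1,5,7,3,0]), (5, [1,6,0,4,5,3,2,6,4,2,5,7,1,3,0]),
    (9, [2,1,6,0,4,5,3,4,2,6,7,5,1,3,0]), (9, [0,6,1,5,4,3,2,2,7,1,5,4,6,0,3]),
    (9, [2,4,6,5,1,0,3,6,2,4,1,5,7,0,3]), (5, [1,6,0,4,5,3,2,6,4,2,5,7,1,0,3]),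
    (9, [2,1,6,0,4,5,3,4,2,6,7,5,1,0,3]), (9, [0,6,1,5,4,3,2,2,7,1,5,4,6,3,0]),
    (9, [0,6,4,5,1,2,3,2,6,4,5,1,7,3,0]), (7, [1,0,4,2,3,5,6,5,0,2,7,1,4,6,3]),
    (5, [1,4,5,6,2,0,3,5,7,6,1,4,2,0,3]), (7, [4,0,1,3,2,5,6,5,3,2,6,4,1,7,0]),
    (9, [0,6,4,5,1,2,3,2,6,4,5,1,7,0,3]), (7, [1,0,4,2,3,5,6,5,3,2,7,1,4,6,0]),
    (5, [1,4,5,6,2,0,3,5,7,6,1,4,2,3,0]), (7, [4,0,1,3,2,5,6,5,0,2,6,4,1,7,3]),
    (7, [1,2,6,0,3,5,4,1,0,6,7,5,4,2,3]), (7, [6,3,1,2,5,0,4,6,0,1,2,7,5,4,3]),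
    (7, [4,2,6,5,3,0,1,7,0,4,1,5,6,2,3]), (5, [1,6,2,4,3,5,0,1,4,5,2,7,6,0,3]),
    (7, [1,2,6,0,3,5,4,1,3,6,7,5,4,2,0]), (7, [6,3,1,2,5,0,4,6,3,1,2,7,5,4,0]),
    (7, [4,2,6,5,3,0,1,7,3,4,1,5,6,2,0]), (5, [1,6,2,4,3,5,0,1,4,5,2,7,6,3,0]),
    (5, [1,4,2,6,5,3,0,2,4,6,1,7,5,3,0]), (7, [4,3,1,0,5,2,6,2,0,5,6,7,1,4,3]),
    (7, [6,2,4,3,5,0,1,7,3,4,2,6,5,1,0]), (7, [1,2,4,0,5,3,6,2,3,5,7,6,4,1,0]),
    (5, [1,4,2,6,5,3,0,2,4,6,1,7,5,0,3]), (7, [4,3,1,0,5,2,6,2,3,5,6,7,1,4,0]),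
    (7, [6,2,4,3,5,0,1,7,0,4,2,6,5,1,3]), (7, [1,2,4,0,5,3,6,2,0,5,7,6,4,1,3]),
    (7, [1,2,5,0,4,6,3,2,0,6,7,5,3,1,4]), (7, [3,2,5,6,4,0,1,7,0,3,2,5,6,1,4]),
    (7, [5,4,1,2,6,0,3,6,0,2,1,7,5,3,4]), (5, [1,5,2,3,4,6,0,2,3,5,1,7,6,0,4]),
    (5, [1,3,2,5,6,4,0,1,3,6,2,7,5,4,0]), (7, [5,2,3,4,6,0,1,7,4,3,1,6,5,2,0]),
    (7, [3,4,1,0,6,2,5,1,0,5,6,7,2,3,4]), (7, [1,2,3,0,6,4,5,1,4,5,7,6,3,2,0]),
    (7, [1,2,5,0,4,6,3,2,4,6,7,5,3,1,0]), (7, [3,2,5,6,4,0,1,7,4,3,2,5,6,1,0]),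
    (7, [5,4,1,2,6,0,3,6,4,2,1,7,5,3,0]), (5, [1,5,2,3,4,6,0,2,3,5,1,7,6,4,0]),
    (5, [1,3,2,5,6,4,0,1,3,6,2,7,5,0,4]), (7, [5,2,3,4,6,0,1,7,0,3,1,6,5,2,4]),
    (7, [3,4,1,0,6,2,5,1,4,5,6,7,2,3,0]), (7, [1,2,3,0,6,4,5,1,0,5,7,6,3,2,4]),
    (9, [2,3,5,6,1,0,4,6,1,3,2,5,7,4,0]), (9, [2,1,5,0,3,6,4,3,1,6,7,5,2,4,0]),
    (5, [1,5,0,3,6,4,2,6,3,1,5,7,2,4,0]), (9, [0,5,1,6,3,4,2,1,7,2,5,3,6,0,4]),
    (9, [0,5,3,6,1,2,4,1,6,3,5,2,7,4,0]), (5, [1,3,6,5,2,0,4,5,7,6,2,3,1,0,4]),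
    (7, [1,0,3,2,4,6,5,5,0,1,7,2,3,6,4]), (7, [3,0,1,4,2,6,5,5,4,1,6,3,2,7,0]),
    (9, [2,3,5,6,1,0,4,6,1,3,2,5,7,0,4]), (9, [2,1,5,0,3,6,4,3,1,6,7,5,2,0,4]),
    (5, [1,5,0,3,6,4,2,6,3,1,5,7,2,0,4]), (9, [0,5,1,6,3,4,2,1,7,2,5,3,6,4,0]),
    (9, [0,5,3,6,1,2,4,1,6,3,5,2,7,0,4]), (5, [1,3,6,5,2,0,4,5,7,6,2,3,1,4,0]),
    (7, [1,0,3,2,4,6,5,5,4,1,7,2,3,6,0]), (7, [3,0,1,4,2,6,5,5,0,1,6,3,2,7,4]),
    (7, [5,0,1,6,2,4,3,6,0,2,5,3,1,7,4]), (5, [1,5,4,3,2,0,6,6,7,5,1,3,2,4,0]),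
    (7, [1,0,5,2,6,4,3,6,4,2,7,1,3,5,0]), (9, [0,3,5,4,1,2,6,2,5,3,6,1,7,0,4]),
    (9, [0,3,1,4,5,6,2,2,7,1,6,3,5,4,0]), (9, [2,1,3,0,5,4,6,3,2,5,7,6,1,0,4]),
    (5, [1,3,0,5,4,6,2,5,3,2,6,7,1,0,4]), (9, [2,5,3,4,1,0,6,5,2,3,1,6,7,0,4]),
    (7, [5,0,1,6,2,4,3,6,4,2,5,3,1,7,0]), (5, [1,5,4,3,2,0,6,6,7,5,1,3,2,0,4]),
    (7, [1,0,5,2,6,4,3,6,0,2,7,1,3,5,4]), (9, [0,3,5,4,1,2,6,2,5,3,6,1,7,4,0]),
    (9, [0,3,1,4,5,6,2,2,7,1,6,3,5,0,4]), (9, [2,1,3,0,5,4,6,3,2,5,7,6,1,4,0]),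
    (5, [1,3,0,5,4,6,2,5,3,2,6,7,1,4,0]), (9, [2,5,3,4,1,0,6,5,2,3,1,6,7,4,0]),
    (5, [1,5,6,3,0,2,4,2,7,1,5,3,6,0,4]), (9, [4,5,1,2,3,0,6,5,3,2,1,7,6,0,4]),
    (7, [3,0,5,4,6,2,1,7,4,3,6,1,2,5,0]), (9, [0,1,5,2,3,4,6,3,5,2,7,1,6,0,4]),
    (9, [0,1,3,2,5,6,4,3,6,1,7,2,5,4,0]), (9, [4,3,1,0,5,2,6,2,3,5,6,7,1,0,4]),
    (7, [5,0,3,6,4,2,1,7,0,3,5,2,1,6,4]), (5, [1,3,4,5,0,2,6,1,7,2,6,3,5,4,0]),
    (5, [1,5,6,3,0,2,4,2,7,1,5,3,6,4,0]), (9, [4,5,1,2,3,0,6,5,3,2,1,7,6,4,0]),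
    (7, [3,0,5,4,6,2,1,7,0,3,6,1,2,5,4]), (9, [0,1,5,2,3,4,6,3,5,2,7,1,6,4,0]),
    (9, [0,1,3,2,5,6,4,3,6,1,7,2,5,0,4]), (9, [4,3,1,0,5,2,6,2,3,5,6,7,1,4,0]),
    (7, [5,0,3,6,4,2,1,7,4,3,5,2,1,6,0]), (5, [1,3,4,5,0,2,6,1,7,2,6,3,5,0,4]),
    (9, [3,6,0,2,5,1,4,3,6,1,2,7,4,0,5]), (9, [1,0,6,2,5,3,4,6,3,1,7,2,4,0,5]),
    (5, [0,6,4,5,1,2,3,1,7,2,3,6,4,0,5]), (7, [5,1,6,3,4,2,0,7,5,6,4,2,1,3,0]),
    (5, [0,6,3,5,2,1,4,4,7,3,2,6,1,5,0]), (9, [1,5,6,3,0,2,4,1,3,6,4,2,7,0,5]),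
    (7, [6,1,0,4,2,3,5,4,0,1,3,6,2,7,5]), (7, [0,1,6,2,4,3,5,4,5,1,7,2,6,3,0]),
    (9, [2,0,6,1,5,4,3,6,2,4,7,3,1,5,0]), (9, [1,6,0,4,5,3,2,2,7,1,3,6,4,0,5]),
    (9, [2,5,6,4,0,1,3,4,2,6,1,3,7,5,0]), (5, [0,6,1,5,4,3,2,4,6,2,3,7,1,5,0]),
    (7, [5,2,6,4,3,1,0,7,0,6,1,3,4,2,5]), (5, [0,6,2,5,3,4,1,1,6,3,2,7,4,0,5]),
    (7, [0,2,6,1,3,4,5,1,0,4,7,3,6,2,5]), (7, [6,3,0,2,4,1,5,4,0,1,2,7,3,6,5]),
    (9, [3,6,0,2,5,1,4,3,6,1,2,7,4,5,0]), (9, [1,0,6,2,5,3,4,6,3,1,7,2,4,5,0]),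
    (5, [0,6,4,5,1,2,3,1,7,2,3,6,4,5,0]), (7, [5,1,6,3,4,2,0,7,0,6,4,2,1,3,5]),
    (5, [0,6,3,5,2,1,4,4,7,3,2,6,1,0,5]), (9, [1,5,6,3,0,2,4,1,3,6,4,2,7,5,0]),
    (7, [6,1,0,4,2,3,5,4,5,1,3,6,2,7,0]), (7, [0,1,6,2,4,3,5,4,0,1,7,2,6,3,5]),
    (9, [2,0,6,1,5,4,3,6,2,4,7,3,1,0,5]), (9, [1,6,0,4,5,3,2,2,7,1,3,6,4,5,0]),
    (9, [2,5,6,4,0,1,3,4,2,6,1,3,7,0,5]), (5, [0,6,1,5,4,3,2,4,6,2,3,7,1,0,5]),
    (7, [5,2,6,4,3,1,0,7,5,6,1,3,4,2,0]), (5, [0,6,2,5,3,4,1,1,6,3,2,7,4,5,0]),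
    (7, [0,2,6,1,3,4,5,1,5,4,7,3,6,2,0]), (7, [6,3,0,2,4,1,5,4,5,1,2,7,3,6,0]),
    (9, [3,5,0,1,6,2,4,1,6,3,4,7,2,0,5]), (5, [0,5,3,6,1,2,4,2,7,1,4,6,3,5,0]),
    (9, [1,0,5,2,6,4,3,6,4,2,7,1,3,5,0]), (7, [6,1,5,4,3,2,0,7,0,6,3,1,2,4,5]),
    (9, [2,0,5,1,6,3,4,6,1,3,7,4,2,0,5]), (9, [2,6,5,3,0,1,4,3,1,6,2,4,7,0,5]),
    (9, [1,5,0,3,6,4,2,1,7,2,4,6,3,5,0]), (5, [0,5,1,6,3,4,2,3,6,1,4,7,2,0,5]),
    (5, [0,5,4,6,2,1,3,3,7,4,1,6,2,0,5]), (7, [5,1,0,3,2,4,6,3,5,2,4,6,1,7,0]),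
    (9, [1,6,5,4,0,2,3,2,4,6,3,1,7,5,0]), (7, [0,1,5,2,3,4,6,3,0,2,7,1,6,4,5]),
    (7, [6,2,5,3,4,1,0,7,5,6,2,4,3,1,0]), (7, [0,2,5,1,4,3,6,2,5,3,7,4,6,1,0]),
    (5, [0,5,2,6,4,3,1,2,6,4,1,7,3,5,0]), (7, [5,3,0,1,4,2,6,2,0,3,4,7,1,6,5]),
    (9, [3,5,0,1,6,2,4,1,6,3,4,7,2,5,0]), (5, [0,5,3,6,1,2,4,2,7,1,4,6,3,0,5]),
    (9, [1,0,5,2,6,4,3,6,4,2,7,1,3,0,5]), (7, [6,1,5,4,3,2,0,7,5,6,3,1,2,4,0]),
    (9, [2,0,5,1,6,3,4,6,1,3,7,4,2,5,0]), (9, [2,6,5,3,0,1,4,3,1,6,2,4,7,5,0]),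
    (9, [1,5,0,3,6,4,2,1,7,2,4,6,3,0,5]), (5, [0,5,1,6,3,4,2,3,6,1,4,7,2,5,0]),
    (5, [0,5,4,6,2,1,3,3,7,4,1,6,2,5,0]), (7, [5,1,0,3,2,4,6,3,0,2,4,6,1,7,5]),
    (9, [1,6,5,4,0,2,3,2,4,6,3,1,7,0,5]), (7, [0,1,5,2,3,4,6,3,5,2,7,1,6,4,0]),
    (7, [6,2,5,3,4,1,0,7,0,6,2,4,3,1,5]), (7, [0,2,5,1,4,3,6,2,0,3,7,4,6,1,5]),
    (5, [0,5,2,6,4,3,1,2,6,4,1,7,3,0,5]), (7, [5,3,0,1,4,2,6,2,5,3,4,7,1,6,0]),
    (7, [4,5,0,2,6,1,3,4,0,2,1,7,3,5,6]), (5, [0,4,2,3,5,6,1,2,5,3,1,7,4,0,6]),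
    (7, [0,2,4,1,5,6,3,2,0,4,7,3,5,1,6]), (7, [3,2,4,6,5,1,0,7,0,5,2,3,4,1,6]),
    (5, [0,4,1,3,6,5,2,4,5,1,3,7,2,6,0]), (9, [1,4,0,6,3,5,2,1,7,2,3,5,4,0,6]),
    (9, [2,3,4,6,0,1,5,4,1,5,2,3,7,6,0]), (9, [2,0,4,1,3,6,5,5,1,4,7,3,2,6,0]),
    (7, [0,1,4,2,6,5,3,4,6,2,7,1,5,3,0]), (9, [1,3,4,5,0,2,6,2,3,5,4,1,7,0,6]),
    (7, [4,1,0,6,2,5,3,4,0,2,3,5,1,7,6]), (5, [0,4,5,3,2,1,6,4,7,3,1,5,2,6,0]),
    (7, [3,1,4,5,6,2,0,7,6,5,4,1,2,3,0]), (9, [1,0,4,2,3,5,6,5,3,2,7,1,4,0,6]),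
    (5, [0,4,6,3,1,2,5,2,7,1,3,5,4,0,6]), (9, [5,4,0,2,3,1,6,3,5,2,1,7,4,0,6]),
    (7, [3,5,0,1,6,2,4,1,0,3,4,7,2,5,6]), (7, [0,2,3,1,6,5,4,1,6,3,7,4,5,2,0]),
    (5, [0,3,2,4,6,5,1,1,5,4,2,7,3,6,0]), (7, [4,2,3,5,6,1,0,7,6,5,1,4,3,2,0]),
    (7, [0,1,3,2,5,6,4,3,0,1,7,2,5,4,6]), (7, [3,1,0,5,2,6,4,3,6,1,4,5,2,7,0]),
    (9, [1,4,3,6,0,2,5,1,4,5,3,2,7,6,0]), (5, [0,3,6,4,2,1,5,3,7,4,2,5,1,0,6]),
    (5, [0,3,1,4,5,6,2,3,5,2,4,7,1,0,6]), (9, [2,4,3,5,0,1,6,3,2,5,1,4,7,0,6]),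
    (9, [1,3,0,5,4,6,2,2,7,1,4,5,3,6,0]), (9, [2,0,3,1,4,5,6,5,2,3,7,4,1,0,6]),
    (7, [4,1,3,6,5,2,0,7,0,5,3,2,1,4,6]), (5, [0,3,5,4,1,2,6,1,7,2,4,5,3,6,0]),
    (9, [1,0,3,2,4,6,5,5,4,1,7,2,3,6,0]), (9, [5,3,0,1,4,2,6,2,5,3,4,7,1,0,6]),
    (7, [4,5,0,2,6,1,3,4,6,2,1,7,3,5,0]), (5, [0,4,2,3,5,6,1,2,5,3,1,7,4,6,0]),
    (7, [0,2,4,1,5,6,3,2,6,4,7,3,5,1,0]), (7, [3,2,4,6,5,1,0,7,6,5,2,3,4,1,0]),
    (5, [0,4,1,3,6,5,2,4,5,1,3,7,2,0,6]), (9, [1,4,0,6,3,5,2,1,7,2,3,5,4,6,0]),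
    (9, [2,3,4,6,0,1,5,4,1,5,2,3,7,0,6]), (9, [2,0,4,1,3,6,5,5,1,4,7,3,2,0,6]),
    (7, [0,1,4,2,6,5,3,4,0,2,7,1,5,3,6]), (9, [1,3,4,5,0,2,6,2,3,5,4,1,7,6,0]),
    (7, [4,1,0,6,2,5,3,4,6,2,3,5,1,7,0]), (5, [0,4,5,3,2,1,6,4,7,3,1,5,2,0,6]),
    (7, [3,1,4,5,6,2,0,7,0,5,4,1,2,3,6]), (9, [1,0,4,2,3,5,6,5,3,2,7,1,4,6,0]),
    (5, [0,4,6,3,1,2,5,2,7,1,3,5,4,6,0]), (9, [5,4,0,2,3,1,6,3,5,2,1,7,4,6,0]),
    (7, [3,5,0,1,6,2,4,1,6,3,4,7,2,5,0]), (7, [0,2,3,1,6,5,4,1,0,3,7,4,5,2,6]),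
    (5, [0,3,2,4,6,5,1,1,5,4,2,7,3,0,6]), (7, [4,2,3,5,6,1,0,7,0,5,1,4,3,2,6]),
    (7, [0,1,3,2,5,6,4,3,6,1,7,2,5,4,0]), (7, [3,1,0,5,2,6,4,3,0,1,4,5,2,7,6]),
    (9, [1,4,3,6,0,2,5,1,4,5,3,2,7,0,6]), (5, [0,3,6,4,2,1,5,3,7,4,2,5,1,6,0]),
    (5, [0,3,1,4,5,6,2,3,5,2,4,7,1,6,0]), (9, [2,4,3,5,0,1,6,3,2,5,1,4,7,6,0]),
    (9, [1,3,0,5,4,6,2,2,7,1,4,5,3,0,6]), (9, [2,0,3,1,4,5,6,5,2,3,7,4,1,6,0]),
    (7, [4,1,3,6,5,2,0,7,6,5,3,2,1,4,0]), (5, [0,3,5,4,1,2,6,1,7,2,4,5,3,0,6]),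
    (9, [1,0,3,2,4,6,5,5,4,1,7,2,3,0,6]), (9, [5,3,0,1,4,2,6,2,5,3,4,7,1,6,0]),
    (9, [3,1,2,5,0,4,6,3,2,5,4,1,6,0,7]), (7, [0,3,2,4,6,5,1,4,7,3,6,1,5,2,0]),
    (9, [3,0,2,4,1,5,6,5,2,3,6,1,4,0,7]), (7, [1,3,2,5,6,4,0,6,7,5,4,1,3,2,0]),
    (5, [0,2,5,1,4,3,6,4,6,2,1,5,3,7,0]), (7, [2,3,0,6,4,5,1,4,0,3,2,5,1,6,7]),
    (9, [5,2,0,4,1,3,6,2,5,3,1,6,4,0,7]), (5, [0,2,6,1,3,4,5,3,6,1,2,5,4,0,7]),
    (5, [0,2,4,1,5,6,3,3,5,2,1,6,4,0,7]), (7, [2,5,0,4,6,3,1,4,0,3,1,6,2,5,7]),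
    (9, [3,2,0,6,1,5,4,1,6,3,2,5,4,0,7]), (5, [0,2,3,1,6,5,4,4,5,1,2,6,3,7,0]),
    (7, [1,4,2,6,5,3,0,6,0,5,3,2,4,1,7]), (7, [0,4,2,3,5,6,1,3,0,4,6,2,5,1,7]),
    (9, [4,0,2,3,1,6,5,5,1,4,6,2,3,7,0]), (9, [4,1,2,6,0,3,5,4,1,5,3,2,6,7,0]),
    (9, [4,2,1,5,0,3,6,2,3,5,1,4,6,0,7]), (5, [0,1,3,2,5,6,4,2,5,3,4,6,1,0,7]),
    (5, [0,1,5,2,3,4,6,1,6,3,4,5,2,7,0]), (7, [2,3,1,6,5,4,0,6,0,5,2,3,1,4,7]),
    (9, [4,0,1,3,2,5,6,5,3,2,6,4,1,0,7]), (9, [3,1,0,5,2,6,4,3,6,1,4,5,2,7,0]),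
    (9, [5,1,0,3,2,4,6,3,5,2,4,6,1,0,7]), (9, [3,0,1,4,2,6,5,5,4,1,6,3,2,7,0]),
    (7, [0,4,1,3,6,5,2,1,7,2,6,4,5,3,0]), (7, [1,5,0,3,6,4,2,1,0,2,4,6,3,5,7]),
    (7, [1,3,0,5,4,6,2,2,7,1,4,5,3,6,0]), (7, [0,3,1,4,5,6,2,2,0,1,6,3,5,4,7]),
    (7, [2,4,1,5,6,3,0,6,7,5,1,4,2,3,0]), (5, [0,1,4,2,6,5,3,1,5,4,3,6,2,7,0]),
    (5, [0,1,6,2,4,3,5,2,6,4,3,5,1,0,7]), (9, [3,2,1,6,0,4,5,1,4,5,2,3,6,7,0]),
    (9, [3,2,1,6,0,4,5,1,4,5,2,3,6,0,7]), (5, [0,1,6,2,4,3,5,2,6,4,3,5,1,7,0]),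
    (5, [0,1,4,2,6,5,3,1,5,4,3,6,2,0,7]), (7, [2,4,1,5,6,3,0,6,0,5,1,4,2,3,7]),
    (7, [0,3,1,4,5,6,2,2,7,1,6,3,5,4,0]), (7, [1,3,0,5,4,6,2,2,0,1,4,5,3,6,7]),
    (7, [1,5,0,3,6,4,2,1,7,2,4,6,3,5,0]), (7, [0,4,1,3,6,5,2,1,0,2,6,4,5,3,7]),
    (9, [3,0,1,4,2,6,5,5,4,1,6,3,2,0,7]), (9, [5,1,0,3,2,4,6,3,5,2,4,6,1,7,0]),
    (9, [3,1,0,5,2,6,4,3,6,1,4,5,2,0,7]), (9, [4,0,1,3,2,5,6,5,3,2,6,4,1,7,0]),
    (7, [2,3,1,6,5,4,0,6,7,5,2,3,1,4,0]), (5, [0,1,5,2,3,4,6,1,6,3,4,5,2,0,7]),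
    (5, [0,1,3,2,5,6,4,2,5,3,4,6,1,7,0]), (9, [4,2,1,5,0,3,6,2,3,5,1,4,6,7,0]),
    (9, [4,1,2,6,0,3,5,4,1,5,3,2,6,0,7]), (9, [4,0,2,3,1,6,5,5,1,4,6,2,3,0,7]),
    (7, [0,4,2,3,5,6,1,3,7,4,6,2,5,1,0]), (7, [1,4,2,6,5,3,0,6,7,5,3,2,4,1,0]),
    (5, [0,2,3,1,6,5,4,4,5,1,2,6,3,0,7]), (9, [3,2,0,6,1,5,4,1,6,3,2,5,4,7,0]),
    (7, [2,5,0,4,6,3,1,4,7,3,1,6,2,5,0]), (5, [0,2,4,1,5,6,3,3,5,2,1,6,4,7,0]),
    (5, [0,2,6,1,3,4,5,3,6,1,2,5,4,7,0]), (9, [5,2,0,4,1,3,6,2,5,3,1,6,4,7,0]),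
    (7, [2,3,0,6,4,5,1,4,7,3,2,5,1,6,0]), (5, [0,2,5,1,4,3,6,4,6,2,1,5,3,0,7]),
    (7, [1,3,2,5,6,4,0,6,0,5,4,1,3,2,7]), (9, [3,0,2,4,1,5,6,5,2,3,6,1,4,7,0]),
    (7, [0,3,2,4,6,5,1,4,0,3,6,1,5,2,7]), (9, [3,1,2,5,0,4,6,3,2,5,4,1,6,7,0]),
    (6, [0,2,5,1,4,3,6,4,6,2,1,5,3,7,0]), (6, [0,2,3,1,6,5,4,4,5,1,2,6,3,7,0]),
    (6, [0,1,5,2,3,4,6,1,6,3,4,5,2,7,0]), (6, [0,1,4,2,6,5,3,1,5,4,3,6,2,7,0]),
    (6, [0,1,6,2,4,3,5,2,6,4,3,5,1,7,0]), (6, [0,1,3,2,5,6,4,2,5,3,4,6,1,7,0]),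
    (6, [0,2,4,1,5,6,3,3,5,2,1,6,4,7,0]), (6, [0,2,6,1,3,4,5,3,6,1,2,5,4,7,0])]"

text \<open>The linear spaces on \<open>r\<close> points up to isomorphism, given by their lines with more than two points.\<close>

definition systems :: "nat \<Rightarrow> (nat list list \<times> certificate list) list" where
  "systems r = (if r = 3 then [([], [])]
   else if r = 4 then [
     ([], []), ([[0,1,2]], [])]
   else if r = 5 then [
     ([], []), ([[0,1,2]], []), ([[0,1,2,3]], []), ([[0,1,2],[0,3,4]], [])]
   else if r = 6 then [
     ([], []), ([[0,1,2]], []), ([[0,1,2,3]], []), ([[0,1,2,3,4]], []), ([[0,1,2],[0,3,4]], []),
     ([[0,1,2],[3,4,5]], []), ([[0,3,4,5],[0,1,2]], []), ([[0,1,2],[0,3,4],[1,3,5]], []),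
     ([[0,1,2],[0,3,4],[1,3,5],[2,4,5]], certificates6)]
   else if r = 7 then [
     ([], []), ([[0,1,2]], []), ([[0,1,2,3]], []), ([[0,1,2,3,4]], []), ([[0,1,2,3,4,5]], []),
     ([[0,1,2],[0,3,4]], []), ([[0,1,2],[3,4,5]], []), ([[0,3,4,5],[0,1,2]], []),
     ([[3,4,5,6],[0,1,2]], []), ([[0,3,4,5,6],[0,1,2]], []), ([[0,1,2,3],[0,4,5,6]], []),
     ([[0,1,2],[0,3,4],[0,5,6]], []), ([[0,1,2],[0,3,4],[1,3,5]], []),
     ([[0,1,2],[0,3,4],[1,5,6]], []), ([[1,3,5,6],[0,1,2],[0,3,4]], []),
     ([[0,1,2],[0,3,4],[0,5,6],[1,3,5]], []), ([[0,1,2],[0,3,4],[1,3,5],[2,4,5]], []),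
     ([[0,1,2],[0,3,4],[1,3,5],[2,4,6]], []),
     ([[2,4,5,6],[0,1,2],[0,3,4],[1,3,5]], certificates7),
     ([[0,1,2],[0,3,4],[0,5,6],[1,3,5],[1,4,6]], []),
     ([[0,1,2],[0,3,4],[0,5,6],[1,3,5],[2,4,6]], []),
     ([[0,1,2],[0,3,4],[0,5,6],[1,3,5],[1,4,6],[2,3,6]], []),
     ([[0,1,2],[0,3,4],[0,5,6],[1,3,5],[1,4,6],[2,3,6],[2,4,5]], certificates_fano)]
   else [])"

text \<open>Enough permutations to turn every listed system with one more block into a listed system.\<close>

definition relabellings :: "nat \<Rightarrow> nat list list" where
  "relabellings r = (
   if r = 4 then [
     [0,1,2,3], [0,1,3,2], [0,2,3,1], [1,2,3,0]]
   else if r = 5 then [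
     [0,1,2,3,4], [1,3,4,0,2], [2,3,4,0,1], [0,1,4,2,3], [1,2,3,4,0], [0,1,3,2,4], [0,2,3,1,4],
     [0,2,4,1,3], [0,3,4,1,2], [1,2,4,0,3]]
   else if r = 6 then [
     [0,1,2,3,4,5], [1,4,5,0,2,3], [2,3,5,0,1,4], [2,4,5,0,1,3], [0,4,5,3,1,2], [3,4,5,1,2,0],
     [0,2,3,4,5,1], [0,3,5,1,2,4], [1,0,2,4,3,5], [1,3,5,2,0,4], [2,3,4,1,0,5], [0,1,2,5,4,3],
     [0,1,3,4,2,5], [1,2,4,5,0,3], [0,1,4,2,3,5], [0,1,5,2,3,4], [0,2,4,1,3,5], [0,2,5,1,3,4],
     [0,3,4,1,2,5], [1,2,3,0,4,5], [1,2,5,0,3,4], [1,3,4,0,2,5], [2,0,1,3,4,5], [2,3,4,5,0,1]]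
   else if r = 7 then [
     [0,1,2,3,4,5,6], [1,4,6,0,2,3,5], [0,5,6,1,2,3,4], [2,0,1,3,6,4,5], [2,4,6,0,1,3,5],
     [2,4,5,0,1,3,6], [1,0,2,5,6,4,3], [2,5,6,0,1,3,4], [0,3,4,2,1,5,6], [1,3,6,0,2,4,5],
     [1,5,6,4,0,3,2], [3,5,6,0,1,2,4], [4,5,6,0,2,3,1], [0,2,1,4,3,6,5], [0,4,3,1,2,5,6],
     [1,3,5,0,2,4,6], [2,3,6,5,4,1,0], [0,3,4,6,5,2,1], [0,3,6,2,1,4,5], [0,4,5,1,2,3,6],
     [0,4,6,1,2,3,5], [1,4,5,2,0,3,6], [2,3,5,0,1,4,6], [3,4,5,0,1,2,6], [3,4,6,1,0,2,5],
     [0,1,2,6,5,3,4], [1,2,3,4,5,0,6], [1,2,4,6,3,0,5], [1,2,5,3,6,0,4], [1,2,6,5,4,0,3],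
     [1,3,4,5,6,0,2], [2,3,4,5,0,1,6], [0,1,2,6,5,4,3], [0,2,3,4,6,1,5], [0,2,5,3,6,1,4],
     [0,3,5,1,2,4,6], [1,0,2,3,4,5,6], [1,5,6,0,2,3,4], [2,0,1,3,4,5,6], [2,3,6,1,0,4,5],
     [3,0,1,2,4,5,6], [3,0,4,1,5,2,6], [0,1,4,2,3,5,6], [0,1,5,2,3,4,6], [0,1,6,2,3,4,5],
     [0,2,1,4,3,5,6], [0,2,4,1,3,5,6], [0,2,6,1,3,4,5], [1,0,2,3,4,6,5], [1,0,2,3,5,6,4],
     [1,3,5,6,0,2,4], [2,0,1,3,5,6,4], [2,0,1,4,5,6,3], [2,3,4,6,0,1,5], [2,4,5,6,0,1,3],
     [3,4,5,6,0,1,2]]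
   else [])"


section \<open>Completeness of the list of small linear spaces\<close>

fun memb :: "bits \<Rightarrow> bits list \<Rightarrow> bool" where
  "memb b [] = False"
| "memb b (c # cs) = (if beq b c then True else memb b cs)"

fun sub_list :: "bits list \<Rightarrow> bits list \<Rightarrow> bool"
  and sub_if :: "bool \<Rightarrow> bits list \<Rightarrow> bits list \<Rightarrow> bool" where
  "sub_list [] C = True"
| "sub_list (b # B) C = sub_if (memb b C) B C"
| "sub_if True B C = sub_list B C"
| "sub_if False B C = False"

fun known :: "bits list \<Rightarrow> bits list list \<Rightarrow> bool"
  and known_if :: "bool \<Rightarrow> bits list \<Rightarrow> bits list \<Rightarrow> bits list list \<Rightarrow> bool"
  and known_if2 :: "bool \<Rightarrow> bits list \<Rightarrow> bits list list \<Rightarrow> bool" where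
  "known C [] = False"
| "known C (B # Bs) = known_if (same_length C B) C B Bs"
| "known_if True C B Bs = known_if2 (sub_list C B \<and> sub_list B C) C Bs"
| "known_if False C B Bs = known C Bs"
| "known_if2 True C Bs = True"
| "known_if2 False C Bs = known C Bs"

fun recognised :: "bits list \<Rightarrow> bits list list \<Rightarrow> nat list list \<Rightarrow> bool"
  and recognised_if :: "bool \<Rightarrow> bits list \<Rightarrow> bits list list \<Rightarrow> nat list list \<Rightarrow> bool" where
  "recognised B Bs [] = False"
| "recognised B Bs (\<pi> # \<pi>s) = recognised_if (known (map (relabel \<pi>) B) Bs) B Bs \<pi>s"
| "recognised_if True B Bs \<pi>s = True"
| "recognised_if False B Bs \<pi>s = recognised B Bs \<pi>s"

fun meets_little :: "bits \<Rightarrow> bits list \<Rightarrow> bool" where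
  "meets_little b [] = True"
| "meets_little b (c # B) = (common b c \<le> 1 \<and> meets_little b B)"

fun extensions :: "bits list \<Rightarrow> bits list \<Rightarrow> bits list list" where
  "extensions [] B = []"
| "extensions (b # bs) B = keep (meets_little b B) (b # B) (extensions bs B)"

fun all_recognised :: "bits list list \<Rightarrow> bits list list \<Rightarrow> nat list list \<Rightarrow> bool"
  and all_recognised_if :: "bool \<Rightarrow> bits list list \<Rightarrow> bits list list \<Rightarrow> nat list list \<Rightarrow> bool" where
  "all_recognised [] Bs \<pi>s = True"
| "all_recognised (C # Cs) Bs \<pi>s = all_recognised_if (recognised C Bs \<pi>s) Cs Bs \<pi>s"
| "all_recognised_if True Cs Bs \<pi>s = all_recognised Cs Bs \<pi>s"
| "all_recognised_if False Cs Bs \<pi>s = False"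

fun all_bits :: "nat \<Rightarrow> bits list" where
  "all_bits 0 = [[]]"
| "all_bits (Suc n) = map ((#) True) (all_bits n) @ map ((#) False) (all_bits n)"

text \<open>If the empty system is listed, this closure gives all systems by induction on the number
  of blocks. Traces with two points are implied by the blocks, and a block with all \<open>r\<close>
  points is excluded by \<open>not_R_subset\<close>.\<close>

definition closed :: "nat \<Rightarrow> bits list list \<Rightarrow> nat list list \<Rightarrow> bool" where
  "closed r Bs \<pi>s \<longleftrightarrow> all_recognised
     (concat (map (extensions (filter (\<lambda>b. 3 \<le> weight b \<and> weight b < r) (all_bits r))) Bs)) Bs \<pi>s"

definition check_systems :: "nat \<Rightarrow> bool" where
  "check_systems r \<longleftrightarrow> list_all is_perm (relabellings r) \<and> list_all (\<lambda>\<pi>. length \<pi> = r) (relabellings r) \<and>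
     closed r (map (\<lambda>(B, _). map (block r) B) (systems r)) (relabellings r)"

fun check_all :: "bits2 list list \<Rightarrow> nat \<Rightarrow> (nat list list \<times> certificate list) list \<Rightarrow> bool" where
  "check_all Ts r [] = True"
| "check_all Ts r ((B, cs) # ss) \<longleftrightarrow>
     distinct (red_lines r (map (block r) B)) \<and> certified Ts r cs (completions r B) \<and> check_all Ts r ss"

section \<open>The classification of labelled geometries\<close>

text \<open>Counting: a list of length \<open>n\<close> that contains the \<open>n\<close> numbers
  below \<open>n\<close> has no room for a repetition or for another value.\<close>

lemma is_permD:
  assumes "is_perm \<pi>" shows "distinct \<pi>" "set \<pi> = {..<length \<pi>}"
proof -
  have sub: "{..<length \<pi>} \<subseteq> set \<pi>" using assms by (auto simp: is_perm_def list_all_iff)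
  then have "length \<pi> \<le> card (set \<pi>)" using card_mono[OF _ sub] by simp
  then show d: "distinct \<pi>" using card_length[of \<pi>] by (simp add: card_distinct)
  show "set \<pi> = {..<length \<pi>}"
    using card_subset_eq[OF _ sub] distinct_card[OF d] by simp
qed

lemma relabel_bits:
  assumes "set \<pi> \<subseteq> {..<length xs}"
  shows "relabel \<pi> (bits xs A) = bits (map ((!) xs) \<pi>) A"
  using assms by (auto simp: relabel_def bits_def bit_at_bits[unfolded bits_def])

lemma relabel_perm:
  assumes "is_perm \<pi>" "length \<pi> = length xs" "distinct xs"
  shows "distinct (map ((!) xs) \<pi>)" "set (map ((!) xs) \<pi>) = set xs"
    and "relabel \<pi> (bits xs A) = bits (map ((!) xs) \<pi>) A"
proof -
  note p = is_permD[OF assms(1)]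
  show "distinct (map ((!) xs) \<pi>)"
    using p assms by (auto simp: distinct_map inj_on_def nth_eq_iff_index_eq)
  show "set (map ((!) xs) \<pi>) = set xs"
    unfolding set_map p(2) assms(2) by (auto simp: set_conv_nth)
  show "relabel \<pi> (bits xs A) = bits (map ((!) xs) \<pi>) A"
    by (rule relabel_bits) (use p assms in auto)
qed

lemma same_length_iff: "same_length xs ys \<longleftrightarrow> length xs = length ys"
  by (induction xs ys rule: same_length.induct) auto

lemma memb_iff: "memb b B \<longleftrightarrow> b \<in> set B"
  by (induction B) (auto simp: beq_iff)

lemma sub_list_iff: "sub_list B C \<longleftrightarrow> set B \<subseteq> set C"
proof (induction B)
  case (Cons b B)
  then show ?case by (cases "memb b C") (auto simp: memb_iff)
qed simp

lemma known_imp: "known C Bs \<Longrightarrow> \<exists>B\<in>set Bs. set C = set B"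
proof (induction Bs)
  case (Cons B Bs)
  show ?case
  proof (cases "set C = set B")
    case False
    then have "(sub_list C B \<and> sub_list B C) = False" by (auto simp: sub_list_iff)
    then have "known C (B # Bs) = known C Bs"
      by (cases "same_length C B") (simp_all only: known.simps known_if.simps known_if2.simps)
    then show ?thesis using Cons by auto
  qed simp
qed simp

lemma recognised_imp: "recognised B Bs \<pi>s \<Longrightarrow> \<exists>\<pi>\<in>set \<pi>s. known (map (relabel \<pi>) B) Bs"
proof (induction \<pi>s)
  case (Cons \<pi> \<pi>s)
  then show ?case by (cases "known (map (relabel \<pi>) B) Bs") auto
qed simp

lemma all_recognised_imp: "all_recognised Cs Bs \<pi>s \<Longrightarrow> C \<in> set Cs \<Longrightarrow> recognised C Bs \<pi>s"
proof (induction Cs)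
  case (Cons D Cs)
  then show ?case by (cases "recognised D Bs \<pi>s") auto
qed simp

lemma meets_little_iff: "meets_little b B \<longleftrightarrow> (\<forall>c\<in>set B. common b c \<le> 1)"
  by (induction B) auto

lemma set_extensions: "b \<in> set bs \<Longrightarrow> meets_little b B \<Longrightarrow> b # B \<in> set (extensions bs B)"
  by (induction bs) auto

lemma set_all_bits: "set (all_bits n) = {b. length b = n}"
proof (induction n)
  case (Suc n)
  then show ?case by (auto simp: length_Suc_conv image_iff)
qed auto

text \<open>The hypotheses pass to subfamilies of \<open>F\<close>, so its blocks can be added one
  at a time. Every addition is recognised by the closure check, at the price of renumbering the
  points.\<close>

lemma blocks_classified:
  assumes check: "check_systems r" and s0: "([], cs) \<in> set (systems r)"
    and R: "finite R" "card R = r"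
    and F: "\<And>b. b \<in> F \<Longrightarrow> b \<subseteq> R" "\<And>b. b \<in> F \<Longrightarrow> 3 \<le> card b \<and> card b < r"
      "\<And>b c. b \<in> F \<Longrightarrow> c \<in> F \<Longrightarrow> b \<noteq> c \<Longrightarrow> card (b \<inter> c) \<le> 1"
  shows "\<exists>rs. distinct rs \<and> set rs = R \<and> (\<exists>(B, cs)\<in>set (systems r). bits rs ` F = set (map (block r) B))"
proof -
  have "F \<subseteq> Pow R" using F(1) by auto
  then have "finite F" using R by (meson finite_Pow_iff finite_subset)
  then show ?thesis using F
  proof (induction F)
    case empty
    obtain rs where "distinct rs" "set rs = R" using finite_distinct_list[OF R(1)] by auto
    then show ?case using s0 by force
  next
    case (insert b F)
    have "\<exists>rs. distinct rs \<and> set rs = R \<and> (\<exists>(B, cs)\<in>set (systems r). bits rs ` F = set (map (block r) B))"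
      by (rule insert.IH) (use insert.prems in auto)
    then obtain rs B cs where rs: "distinct rs" "set rs = R" and B: "(B, cs) \<in> set (systems r)"
      "bits rs ` F = set (map (block r) B)" by blast
    have len: "length rs = r" using rs R distinct_card by fastforce
    let ?B = "map (block r) B" and ?b = "bits rs b"
    define Bs where "Bs = map (\<lambda>(B, _). map (block r) B) (systems r)"
    have "?b \<in> set (filter (\<lambda>b. 3 \<le> weight b \<and> weight b < r) (all_bits r))"
      using insert.prems(1,2)[of b] rs len by (simp add: weight_bits set_all_bits Int_absorb2)
    moreover have "meets_little ?b ?B"
      unfolding meets_little_iff B(2)[symmetric]
    proof safe
      fix c assume c: "c \<in> F"
      then have "b \<noteq> c" using insert.hyps by auto
      then have "card (b \<inter> c) \<le> 1" using insert.prems(3)[of b c] c by auto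
      moreover have "b \<inter> c \<inter> R = b \<inter> c" using insert.prems(1) by auto
      ultimately show "common ?b (bits rs c) \<le> 1" using rs by (simp add: common_bits)
    qed
    ultimately have "?b # ?B \<in> set (extensions (filter (\<lambda>b. 3 \<le> weight b \<and> weight b < r) (all_bits r)) ?B)"
      by (rule set_extensions)
    moreover have "?B \<in> set Bs" using B(1) by (force simp: Bs_def)
    ultimately have "?b # ?B \<in> set (concat (map (extensions (filter (\<lambda>b. 3 \<le> weight b \<and> weight b < r) (all_bits r))) Bs))" by auto
    then have "recognised (?b # ?B) Bs (relabellings r)"
      using check unfolding check_systems_def closed_def Bs_def by (blast intro: all_recognised_imp)
    then obtain \<pi> where \<pi>: "\<pi> \<in> set (relabellings r)" "known (map (relabel \<pi>) (?b # ?B)) Bs"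
      using recognised_imp by blast
    obtain B'' where B'': "B'' \<in> set Bs" "set (map (relabel \<pi>) (?b # ?B)) = set B''"
      using known_imp[OF \<pi>(2)] by blast
    then obtain B' cs' where B': "(B', cs') \<in> set (systems r)" "set (map (relabel \<pi>) (?b # ?B)) = set (map (block r) B')"
      unfolding Bs_def by auto
    have perm: "is_perm \<pi>" "length \<pi> = length rs"
      using check \<pi>(1) len by (auto simp: check_systems_def list_all_iff)
    note new = relabel_perm[OF perm rs(1)]
    have "bits (map ((!) rs) \<pi>) ` insert b F = relabel \<pi> ` (bits rs ` insert b F)"
      by (simp add: new(3) image_image)
    also have "\<dots> = set (map (relabel \<pi>) (?b # ?B))" using B(2) by (simp add: image_image)
    finally have "bits (map ((!) rs) \<pi>) ` insert b F = set (map (block r) B')" using B'(2) by simp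
    then show ?case using new(1,2) rs(2) B'(1) by blast
  qed
qed

lemma set_pairs:
  "distinct xs \<Longrightarrow> set (pairs (length xs)) = bits xs ` {p. p \<subseteq> set xs \<and> card p = 2}"
proof (induction xs)
  case Nil
  show ?case by auto
next
  case (Cons x xs)
  have rep: "replicate (length xs) True = bits xs UNIV"
    by (auto simp: bits_def list_eq_iff_nth_eq)
  have A: "(#) True ` set (units (replicate (length xs) True)) = bits (x # xs) ` {{x, y} |y. y \<in> set xs}"
    (is "_ = _ ` ?P")
  proof -
    have "(#) True ` set (units (replicate (length xs) True)) = (\<lambda>y. bits (x # xs) {x, y}) ` set xs"
      using Cons.prems by (auto simp: rep set_units image_image bits_eq_iff intro!: image_cong)
    then show ?thesis by auto
  qed
  have B: "(#) False ` set (pairs (length xs)) = bits (x # xs) ` {p. p \<subseteq> set xs \<and> card p = 2}" (is "_ = _ ` ?Q")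
    using Cons.prems by (auto simp: Cons.IH image_image intro!: image_cong)
  have "{p. p \<subseteq> set (x # xs) \<and> card p = 2} = ?P \<union> ?Q"
    using Cons.prems by (auto simp: card_2_iff)
  then show ?case using A B by (simp add: image_Un)
qed

lemma cert_linesD:
  "cert_lines \<pi> \<rho> T S \<Longrightarrow> (a, b) \<in> set S \<Longrightarrow> length b = length \<rho> \<and> (relabel \<pi> a, relabel \<rho> b) \<in> set T"
proof (induction S)
  case (Cons l S)
  obtain a' b' where l: "l = (a', b')" by (cases l)
  show ?case using Cons
    by (cases "same_length b' \<rho> \<and> mem (relabel \<pi> a', relabel \<rho> b') T")
      (auto simp: l same_length_iff mem_iff)
qed simp

lemma certifiedD:
  "certified Ts r cs Ss \<Longrightarrow> S \<in> set Ss \<Longrightarrow> \<exists>i \<pi>. cert_split Ts r i (take r \<pi>) (drop r \<pi>) S"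
proof (induction cs arbitrary: Ss)
  case Nil
  then show ?case by (cases Ss) auto
next
  case (Cons c cs)
  obtain i \<pi> where c: "c = (i, \<pi>)" by (cases c)
  obtain S' Ss' where Ss: "Ss = S' # Ss'" using Cons.prems by (cases Ss) auto
  show ?case using Cons unfolding c Ss
    by (cases "cert_split Ts r i (take r \<pi>) (drop r \<pi>) S'") (auto simp del: cert_split.simps)
qed

lemma check_allD:
  "check_all Ts r ss \<Longrightarrow> (B, cs) \<in> set ss \<Longrightarrow>
    distinct (red_lines r (map (block r) B)) \<and> certified Ts r cs (completions r B)"
  by (induction ss) auto

context bichromatic_space
begin

lemma classification:
  assumes check: "check_systems r" "([], cs0) \<in> set (systems r)" "check_all Ts r (systems r)"
    and r: "card R = r" "r \<le> card G" "card G \<le> 15 - r"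
  shows "\<exists>T\<in>set Ts. \<exists>rs gs. distinct rs \<and> set rs = R \<and> distinct gs \<and> set gs = G \<and>
    (\<forall>l\<in>LS. (bits rs l, bits gs l) \<in> set T)"
proof -
  \<comment> \<open>Traces with at least three points suffice to describe the space on
    \<open>R\<close>: the other lines with two points in \<open>R\<close> come from the pairs inside
    no member of \<open>F\<close>.\<close>
  define F where "F = (\<lambda>l. l \<inter> R) ` {l \<in> LS. 3 \<le> card (l \<inter> R)}"
  define Two where "Two = {l \<in> LS. 2 \<le> card (l \<inter> R)}"
  have two_eq: "l = l'" if lm: "l \<in> LS" "l' \<in> LS" "2 \<le> card (l \<inter> l' \<inter> R)" for l l'
  proof -
    obtain x y where "x \<noteq> y" "x \<in> l \<inter> l'" "y \<in> l \<inter> l'"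
      using lm(3) by (auto simp: card_le_Suc_iff numeral_2_eq_2)
    then show ?thesis using line_eq[of l l' x y] lm by auto
  qed
  have "\<exists>rs. distinct rs \<and> set rs = R \<and> (\<exists>(B, cs)\<in>set (systems r). bits rs ` F = set (map (block r) B))"
  proof (rule blocks_classified[OF check(1,2) finite_R r(1)])
    fix b assume "b \<in> F"
    then obtain l where l: "l \<in> LS" "b = l \<inter> R" "3 \<le> card b" by (auto simp: F_def)
    show "b \<subseteq> R" using l by auto
    have "b \<subset> R" using l not_R_subset by auto
    then show "3 \<le> card b \<and> card b < r" using l psubset_card_mono finite_R r by auto
    fix c assume "c \<in> F" "b \<noteq> c"
    then obtain m where m: "m \<in> LS" "c = m \<inter> R" by (auto simp: F_def)
    have "l \<noteq> m" using l m \<open>b \<noteq> c\<close> by auto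
    moreover have "b \<inter> c = l \<inter> m \<inter> R" using l m by auto
    ultimately show "card (b \<inter> c) \<le> 1" using two_eq[of l m] l m by (metis Suc_1 not_less_eq_eq)
  qed
  then obtain rs B cs where rs: "distinct rs" "set rs = R" and B: "(B, cs) \<in> set (systems r)"
    "bits rs ` F = set (map (block r) B)" by blast
  have len: "length rs = r" using rs r distinct_card by fastforce
  have bits_R: "bits rs (l \<inter> R) = bits rs l" for l using rs by (auto simp: bits_eq_iff)
  have F_bits: "bits rs ` F = bits rs ` {l \<in> LS. 3 \<le> card (l \<inter> R)}"
    by (auto simp: F_def image_image bits_R)
  let ?B = "map (block r) B"
  define L where "L = red_lines r ?B"
  have chk: "distinct L" "certified Ts r cs (completions r B)" using check_allD[OF check(3) B(1)] by (auto simp: L_def)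
  have L_Two: "set L = bits rs ` Two"
  proof -
    have "set L = bits rs ` {l \<in> LS. 3 \<le> card (l \<inter> R)} \<union>
      bits rs ` {p. p \<subseteq> R \<and> card p = 2 \<and> (\<forall>b\<in>F. \<not> p \<subseteq> b)}"
    proof -
      have free: "list_all (\<lambda>b. \<not> bsub (bits rs p) b) ?B \<longleftrightarrow> (\<forall>b\<in>F. \<not> p \<subseteq> b)" if "p \<subseteq> R" for p
        unfolding list_all_iff B(2)[symmetric] using that rs(2) by (simp add: bsub_bits Int_absorb2)
      have "set L = bits rs ` F \<union> {q \<in> bits rs ` {p. p \<subseteq> R \<and> card p = 2}. list_all (\<lambda>b. \<not> bsub q b) ?B}"
        unfolding L_def red_lines_def set_append set_filter B(2) using set_pairs[OF rs(1)] rs(2) len by simp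
      also have "{q \<in> bits rs ` {p. p \<subseteq> R \<and> card p = 2}. list_all (\<lambda>b. \<not> bsub q b) ?B} =
          bits rs ` {p \<in> {p. p \<subseteq> R \<and> card p = 2}. list_all (\<lambda>b. \<not> bsub (bits rs p) b) ?B}"
        by blast
      also have "{p \<in> {p. p \<subseteq> R \<and> card p = 2}. list_all (\<lambda>b. \<not> bsub (bits rs p) b) ?B} =
          {p. p \<subseteq> R \<and> card p = 2 \<and> (\<forall>b\<in>F. \<not> p \<subseteq> b)}"
        using free by blast
      finally show ?thesis unfolding F_bits .
    qed
    \<comment> \<open>The line joining a pair inside no block has no third point in
      \<open>R\<close>, since its trace would then be a block. Conversely a block containing a
      two-point trace would belong to the same line.\<close>
    moreover have "bits rs ` {p. p \<subseteq> R \<and> card p = 2 \<and> (\<forall>b\<in>F. \<not> p \<subseteq> b)} =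
      bits rs ` {l \<in> LS. card (l \<inter> R) = 2}"
    proof (intro equalityI image_subsetI)
      fix p assume "p \<in> {p. p \<subseteq> R \<and> card p = 2 \<and> (\<forall>b\<in>F. \<not> p \<subseteq> b)}"
      then have p: "p \<subseteq> R" "card p = 2" "\<And>b. b \<in> F \<Longrightarrow> \<not> p \<subseteq> b" by auto
      then obtain x y where xy: "p = {x, y}" "x \<noteq> y" by (auto simp: card_2_iff)
      then obtain l where l: "l \<in> LS" "x \<in> l" "y \<in> l" using line_ex[of x y] p by auto
      have sub: "p \<subseteq> l \<inter> R" using l xy p by auto
      then have "\<not> 3 \<le> card (l \<inter> R)" using p(3) l by (auto simp: F_def)
      moreover have "2 \<le> card (l \<inter> R)" using card_mono[OF _ sub] p finite_R by auto
      ultimately have c2: "card (l \<inter> R) = 2" by auto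
      then have "l \<inter> R = p" using card_subset_eq[OF _ sub] p finite_R by auto
      then have "bits rs p = bits rs l" using bits_R by metis
      then show "bits rs p \<in> bits rs ` {l \<in> LS. card (l \<inter> R) = 2}" using l c2 by auto
    next
      fix l assume l: "l \<in> {l \<in> LS. card (l \<inter> R) = 2}"
      have "\<not> l \<inter> R \<subseteq> b" if bF: "b \<in> F" for b
      proof
        assume sub: "l \<inter> R \<subseteq> b"
        obtain m where m: "m \<in> LS" "b = m \<inter> R" "3 \<le> card (m \<inter> R)" using bF by (auto simp: F_def)
        then have "l \<inter> m \<inter> R = l \<inter> R" using sub by auto
        then have "l = m" using two_eq[of l m] l m by auto
        then show False using l m by auto
      qed
      then have "l \<inter> R \<in> {p. p \<subseteq> R \<and> card p = 2 \<and> (\<forall>b\<in>F. \<not> p \<subseteq> b)}"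
        using l by simp
      then show "bits rs l \<in> bits rs ` {p. p \<subseteq> R \<and> card p = 2 \<and> (\<forall>b\<in>F. \<not> p \<subseteq> b)}"
        unfolding bits_R[of l, symmetric] by (rule imageI)
    qed
    moreover have "Two = {l \<in> LS. 3 \<le> card (l \<inter> R)} \<union> {l \<in> LS. card (l \<inter> R) = 2}"
      by (auto simp: Two_def)
    ultimately show ?thesis by (simp add: image_Un)
  qed
  have inj: "inj_on (bits rs) Two"
  proof (rule inj_onI)
    fix l m assume lm: "l \<in> Two" "m \<in> Two" "bits rs l = bits rs m"
    then have "l \<inter> R = m \<inter> R" using rs by (simp add: bits_eq_iff)
    then have "l \<inter> m \<inter> R = l \<inter> R" by auto
    then show "l = m" using two_eq[of l m] lm by (auto simp: Two_def)
  qed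
  \<comment> \<open>The lines are numbered in the order of the computed list \<open>L\<close>, so
    that the program's answer for \<open>L\<close> speaks about this geometry.\<close>
  define ls where "ls = map (inv_into Two (bits rs)) L"
  have map_ls: "map (bits rs) ls = L"
    unfolding ls_def map_map by (rule map_idI) (simp add: L_Two f_inv_into_f)
  then have d_ls: "distinct ls" using chk(1) by (metis distinct_map)
  have set_ls: "set ls = Two" using L_Two inj by (simp add: ls_def inv_into_image_cancel)
  interpret labelled_space R G LS rs ls
    by unfold_locales (use rs d_ls set_ls in \<open>auto simp: Two_def\<close>)
  obtain S gs where S: "S \<in> set (completions r B)" and gs: "distinct gs" "set gs = G" "\<And>l. l \<in> LS \<Longrightarrow> (bits rs l, bits gs l) \<in> set S"
    using solutions_sound[of "15 - r", unfolded len map_ls, OF r(3,2)] unfolding completions_def L_def by blast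
  obtain i \<pi> where c: "cert_split Ts r i (take r \<pi>) (drop r \<pi>) S"
    using certifiedD[OF chk(2) S] by blast
  let ?\<pi> = "take r \<pi>" and ?\<rho> = "drop r \<pi>"
  have i: "i < length Ts" and p: "length ?\<pi> = length rs" "is_perm ?\<pi>" "is_perm ?\<rho>"
    and lines: "cert_lines ?\<pi> ?\<rho> (Ts ! i) S" using c len by auto
  show ?thesis
  \<comment> \<open>The certificate is known to renumber as many points off \<open>R\<close> as
    there are only through a row of the outcome, hence only if there is a line. Without lines the
    inclusion is trivial.\<close>
  proof (cases "LS = {}")
    case True
    then show ?thesis using rs gs i nth_mem by blast
  next
    case False
    then obtain l0 where "l0 \<in> LS" by auto
    then have lg: "length ?\<rho> = length gs" using cert_linesD[OF lines gs(3)] by force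
    note new = relabel_perm[OF p(2,1) rs(1)] relabel_perm[OF p(3) lg gs(1)]
    have "(bits (map ((!) rs) ?\<pi>) l, bits (map ((!) gs) ?\<rho>) l) \<in> set (Ts ! i)" if "l \<in> LS" for l
      using cert_linesD[OF lines gs(3)[OF that]] new(3,6) by simp
    then show ?thesis using new rs gs nth_mem[OF i] by metis
  qed
qed

end

lemma two_elements:
  assumes "2 \<le> card A" obtains x y where "x \<in> A" "y \<in> A" "x \<noteq> y"
proof -
  obtain B where "B \<subseteq> A" "card B = 2" using obtain_subset_with_card_n[OF assms] by metis
  then show ?thesis using that by (auto simp: card_2_iff)
qed

context bichromatic_space
begin

text \<open>Lines exist and meet \<open>R\<close>, so \<open>R\<close> is not empty, and one or two
  points of \<open>R\<close> would all lie on one line, against \<open>not_R_subset\<close>.\<close>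

lemma three_le_card_R:
  assumes "2 \<le> card (R \<union> G)" shows "3 \<le> card R"
proof (rule ccontr)
  assume "\<not> 3 \<le> card R"
  moreover obtain x y where xy: "x \<in> R \<union> G" "y \<in> R \<union> G" "x \<noteq> y" using two_elements[OF assms] .
  moreover obtain l where l: "l \<in> LS" using line_ex[OF xy] .
  moreover have "card R \<noteq> 0" using line_R[OF l] finite_R by auto
  ultimately consider "card R = 1" | "card R = 2" by linarith
  then show False
  proof cases
    case 1
    then obtain z where "R = {z}" by (rule card_1_singletonE)
    then show False using line_R[OF l] not_R_subset[OF l] by auto
  next
    case 2
    then obtain z w where R: "R = {z, w}" "z \<noteq> w" by (auto simp: card_2_iff)
    then obtain m where "m \<in> LS" "z \<in> m" "w \<in> m" using line_ex[of z w] by auto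
    then show False using not_R_subset[of m] R by auto
  qed
qed

end

section \<open>Geometries described by tables\<close>

definition side :: "colour \<Rightarrow> 'a coloured \<Rightarrow> 'a set" where
  "side c M = {p \<in> points M. colour M p = c}"

text \<open>Only an inclusion of the lines among the rows is asked for, which is what the
  certificates provide. For a table that passes \<open>table_ok\<close> it pins the geometry down up
  to equivalence.\<close>

definition realises :: "colour \<Rightarrow> bits2 list \<Rightarrow> 'a coloured \<Rightarrow> bool" where
  "realises c T M \<longleftrightarrow> (\<exists>rs gs. distinct rs \<and> set rs = side c M \<and> distinct gs \<and> set gs = points M - side c M \<and>
     (\<forall>l\<in>lines M. (bits rs l, bits gs l) \<in> set T))"

lemma other_colour_eq_iff: "other_colour c = d \<longleftrightarrow> c \<noteq> d"
  by (cases c; cases d) simp_all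

lemma side_other: "side (other_colour c) M = points M - side c M"
  by (auto simp: side_def eq_commute[of _ "other_colour c"] other_colour_eq_iff)

lemma bichromatic_side:
  assumes "MR_geometry M"
  shows "bichromatic_space (side c M) (points M - side c M) (lines M)"
proof -
  have un: "side c M \<union> (points M - side c M) = points M" by (auto simp: side_def)
  have fls: "finite_linear_space M" using assms by (simp add: MR_geometry_def)
  have fin: "finite (points M)" and sub: "\<And>l. l \<in> lines M \<Longrightarrow> l \<subseteq> points M"
    and proper: "\<And>l. l \<in> lines M \<Longrightarrow> \<not> points M \<subseteq> l"
    using fls unfolding finite_linear_space_def by simp_all
  have meets: "l \<inter> side c M \<noteq> {} \<and> l \<inter> (points M - side c M) \<noteq> {}" if l: "l \<in> lines M" for l
  proof -
    have "(\<exists>p\<in>l. colour M p = Red) \<and> (\<exists>p\<in>l. colour M p = Green)"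
      using assms l unfolding MR_geometry_def by simp
    then obtain p q where pq: "p \<in> l" "colour M p = Red" "q \<in> l" "colour M q = Green" by blast
    then have pts: "p \<in> points M" "q \<in> points M" using sub[OF l] by auto
    show ?thesis
    proof (cases c)
      case Red
      then have "p \<in> l \<inter> side c M" "q \<in> l \<inter> (points M - side c M)" using pq pts by (simp_all add: side_def)
      then show ?thesis by blast
    next
      case Green
      then have "q \<in> l \<inter> side c M" "p \<in> l \<inter> (points M - side c M)" using pq pts by (simp_all add: side_def)
      then show ?thesis by blast
    qed
  qed
  have ex1: "\<exists>!l. l \<in> lines M \<and> x \<in> l \<and> y \<in> l" if "x \<in> points M" "y \<in> points M" "x \<noteq> y" for x y
    using fls that unfolding finite_linear_space_def by simp
  show ?thesis
  proof (rule bichromatic_space.intro, unfold un)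
    show "finite (side c M)" using fin by (simp add: side_def)
    show "\<exists>!l. l \<in> lines M \<and> x \<in> l \<and> y \<in> l" if "x \<in> points M" "y \<in> points M" "x \<noteq> y" for x y
      by (rule ex1[OF that])
  qed (use fin in \<open>simp_all add: sub proper meets\<close>)
qed

lemma MR_classified:
  assumes checks: "\<And>r. r \<in> {3..7} \<Longrightarrow> check_systems r \<and> ([], []) \<in> set (systems r) \<and> check_all targets r (systems r)"
    and M: "MR_geometry M" "card (points M) \<le> 15"
  shows "\<exists>c. \<exists>T\<in>set targets. realises c T M"
proof -
  have fin: "finite (points M)" "2 \<le> card (points M)"
    using M by (auto simp: MR_geometry_def finite_linear_space_def)
  have sum: "card (side c M) + card (points M - side c M) = card (points M)" for c
  proof -
    have "side c M \<subseteq> points M" by (auto simp: side_def)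
    then show ?thesis using fin(1) by (simp add: card_Diff_subset finite_subset card_mono)
  qed
  have "\<exists>c. card (side c M) \<le> card (points M - side c M)"
  proof (cases "card (side Red M) \<le> card (points M - side Red M)")
    case False
    then have "card (side Green M) \<le> card (points M - side Green M)"
      using side_other[of Red M] side_other[of Green M] by simp
    then show ?thesis ..
  qed auto
  then obtain c where c: "card (side c M) \<le> card (points M - side c M)" ..
  interpret bichromatic_space "side c M" "points M - side c M" "lines M"
    by (rule bichromatic_side[OF M(1)])
  have "side c M \<union> (points M - side c M) = points M" by (auto simp: side_def)
  then have three: "3 \<le> card (side c M)" using three_le_card_R fin by simp
  then have r: "card (side c M) \<in> {3..7}" using sum[of c] M(2) c by auto
  have "card (points M - side c M) \<le> 15 - card (side c M)" using sum[of c] M(2) by linarith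
  then show ?thesis
    using classification[of "card (side c M)" "[]" targets] checks[OF r] c
    unfolding realises_def by blast
qed

lemma realises_swap:
  assumes "realises c (map prod.swap T) M" shows "realises (other_colour c) T M"
proof -
  obtain rs gs where *: "distinct rs" "set rs = side c M" "distinct gs" "set gs = points M - side c M"
    "\<And>l. l \<in> lines M \<Longrightarrow> (bits rs l, bits gs l) \<in> set (map prod.swap T)"
    using assms unfolding realises_def by blast
  have "(bits gs l, bits rs l) \<in> set T" if "l \<in> lines M" for l using *(5)[OF that] by auto
  moreover have "points M - side (other_colour c) M = side c M" unfolding side_other by (auto simp: side_def)
  ultimately show ?thesis using * unfolding realises_def side_other by metis
qed

definition linear_rows :: "nat \<Rightarrow> bits list \<Rightarrow> bool" where
  "linear_rows n ts \<longleftrightarrow> list_all (\<lambda>i. list_all (\<lambda>j. i = j \<or>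
     length (filter (\<lambda>t. bit_at t i \<and> bit_at t j) ts) = 1) [0..<n]) [0..<n]"

lemma linear_rowsD:
  assumes "linear_rows n ts" "i < n" "j < n" "i \<noteq> j"
  shows "\<exists>!t. t \<in> set ts \<and> bit_at t i \<and> bit_at t j"
proof -
  let ?F = "filter (\<lambda>t. bit_at t i \<and> bit_at t j) ts"
  have "\<forall>i\<in>set [0..<n]. \<forall>j\<in>set [0..<n]. i = j \<or> length (filter (\<lambda>t. bit_at t i \<and> bit_at t j) ts) = 1"
    using assms(1) unfolding linear_rows_def list_all_iff .
  from bspec[OF bspec[OF this, of i], of j] assms have "length ?F = 1" by simp
  then obtain t where "?F = [t]" by (cases ?F) auto
  then have "set ?F = {t}" by simp
  then have "t' \<in> set ts \<and> bit_at t' i \<and> bit_at t' j \<longleftrightarrow> t' = t" for t' by (auto simp: set_eq_iff)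
  then show ?thesis by simp
qed

definition table_ok :: "nat \<Rightarrow> nat \<Rightarrow> bits2 list \<Rightarrow> bool" where
  "table_ok r g T \<longleftrightarrow> linear_rows (r + g) (map (\<lambda>(a, b). a @ b) T) \<and> 2 \<le> r + g \<and> distinct T \<and>
     list_all (\<lambda>(a, b). length a = r \<and> length b = g \<and> weight a \<noteq> 0 \<and> weight b \<noteq> 0 \<and>
       weight a + weight b < r + g) T"

lemma bits_append: "bits (xs @ ys) A = bits xs A @ bits ys A"
  by (simp add: bits_def)

lemma line_two_indices:
  assumes "finite_linear_space S" "l \<in> lines S" "set xs = points S"
  shows "\<exists>i j. i < length xs \<and> j < length xs \<and> i \<noteq> j \<and> xs ! i \<in> l \<and> xs ! j \<in> l"
proof -
  have "2 \<le> card l" "l \<subseteq> set xs" using assms by (auto simp: finite_linear_space_def)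
  then obtain x y where xy: "x \<in> l" "y \<in> l" "x \<noteq> y" using two_elements by metis
  then have "x \<in> set xs" "y \<in> set xs" using \<open>l \<subseteq> set xs\<close> by auto
  then obtain i j where "i < length xs" "x = xs ! i" "j < length xs" "y = xs ! j"
    unfolding in_set_conv_nth by blast
  then show ?thesis using xy by blast
qed

lemma join_indices:
  assumes "finite_linear_space S" "set xs = points S" "distinct xs" "i < length xs" "j < length xs" "i \<noteq> j"
  shows "\<exists>l\<in>lines S. xs ! i \<in> l \<and> xs ! j \<in> l"
proof -
  have "xs ! i \<noteq> xs ! j" "xs ! i \<in> points S" "xs ! j \<in> points S"
    using assms nth_mem[of i xs] nth_mem[of j xs] by (simp_all add: nth_eq_iff_index_eq)
  then have "\<exists>!l. l \<in> lines S \<and> xs ! i \<in> l \<and> xs ! j \<in> l"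
    using assms(1) unfolding finite_linear_space_def by simp
  then show ?thesis by blast
qed

text \<open>The line of \<open>G\<close> and the line of \<open>M\<close> through the points
  numbered \<open>i\<close> and \<open>j\<close> both have the one row with bits \<open>i\<close>
  and \<open>j\<close>, so they correspond under matching of positions. Hence inclusion among the
  rows is enough on either side.\<close>

lemma linear_space_isomorphism:
  assumes G: "finite_linear_space G" and M: "finite_linear_space M"
    and ps: "distinct ps" "set ps = points G" and qs: "distinct qs" "set qs = points M"
    and n: "length ps = n" "length qs = n" and ts: "linear_rows n ts"
    and lG: "\<And>l. l \<in> lines G \<Longrightarrow> bits ps l \<in> set ts" and lM: "\<And>l. l \<in> lines M \<Longrightarrow> bits qs l \<in> set ts"
  shows "\<exists>f. (\<forall>i<n. f (ps ! i) = qs ! i) \<and> isomorphism f G M"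
proof -
  define f where "f p = the (map_of (zip ps qs) p)" for p
  have f: "f (ps ! i) = qs ! i" if "i < n" for i
    using that n ps by (simp add: f_def map_of_zip_nth)
  have iG: "\<exists>i<n. x = ps ! i" if "x \<in> points G" for x
    using that unfolding ps(2)[symmetric] n(1)[symmetric] in_set_conv_nth by blast
  have iM: "\<exists>i<n. x = qs ! i" if "x \<in> points M" for x
    using that unfolding qs(2)[symmetric] n(2)[symmetric] in_set_conv_nth by blast
  have ptG: "ps ! i \<in> points G" and ptM: "qs ! i \<in> points M" if "i < n" for i
    using that n nth_mem ps(2) qs(2) by fastforce+
  have f_inj: "f (ps ! i) = f (ps ! j) \<longleftrightarrow> ps ! i = ps ! j" if "i < n" "j < n" for i j
    using that f ps(1) qs(1) n by (simp add: nth_eq_iff_index_eq)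
  have bij: "bij_betw f (points G) (points M)"
  proof (rule bij_betwI')
    show "f x = f y \<longleftrightarrow> x = y" if "x \<in> points G" "y \<in> points G" for x y
      using iG[OF that(1)] iG[OF that(2)] f_inj by blast
    show "f x \<in> points M" if "x \<in> points G" for x
      using iG[OF that] f ptM by auto
    show "\<exists>x\<in>points G. y = f x" if y: "y \<in> points M" for y
    proof -
      obtain i where "i < n" "y = qs ! i" using iM[OF y] by blast
      then show ?thesis using f[of i] ptG[of i] by (intro bexI[of _ "ps ! i"]) simp_all
    qed
  qed
  have image: "bits qs (f ` l) = bits ps l" if l: "l \<subseteq> points G" for l
  proof -
    have "qs ! i \<in> f ` l \<longleftrightarrow> ps ! i \<in> l" if i: "i < n" for i
    proof
      assume "qs ! i \<in> f ` l"
      then obtain x where x: "x \<in> l" "f (ps ! i) = f x" using f[OF i] by auto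
      moreover have "x \<in> points G" using x l by auto
      ultimately have "ps ! i = x"
        using inj_onD[OF bij_betw_imp_inj_on[OF bij], of "ps ! i" x] ptG[OF i] by simp
      then show "ps ! i \<in> l" using x by simp
    next
      assume "ps ! i \<in> l"
      then show "qs ! i \<in> f ` l" unfolding f[OF i, symmetric] by (rule imageI)
    qed
    then show ?thesis using n by (simp add: bits_def list_eq_iff_nth_eq)
  qed
  have same: "f ` l = m" if "l \<in> lines G" "m \<in> lines M" "i < n" "j < n" "i \<noteq> j"
    "ps ! i \<in> l" "ps ! j \<in> l" "qs ! i \<in> m" "qs ! j \<in> m" for l m i j
  proof -
    have "l \<subseteq> points G" "m \<subseteq> points M" using that G M by (auto simp: finite_linear_space_def)
    have "bit_at (bits ps l) i" "bit_at (bits ps l) j" "bit_at (bits qs m) i" "bit_at (bits qs m) j"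
      using that n by (simp_all add: bit_at_bits)
    then have "bits ps l = bits qs m"
      using linear_rowsD[OF ts that(3-5)] lG[OF that(1)] lM[OF that(2)] by blast
    then have "bits qs (f ` l) = bits qs m" using image[OF \<open>l \<subseteq> points G\<close>] by simp
    moreover have "f ` l \<subseteq> set qs" using \<open>l \<subseteq> points G\<close> bij qs by (auto simp: bij_betw_def)
    ultimately show "f ` l = m" using \<open>m \<subseteq> points M\<close> qs by (auto simp: bits_eq_iff)
  qed
  have "(\<lambda>l. f ` l) ` lines G = lines M"
  proof (intro equalityI subsetI)
    fix m assume "m \<in> (\<lambda>l. f ` l) ` lines G"
    then obtain l where l: "l \<in> lines G" "m = f ` l" by auto
    obtain i j where ij: "i < n" "j < n" "i \<noteq> j" "ps ! i \<in> l" "ps ! j \<in> l"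
      using line_two_indices[OF G l(1) ps(2)] n by auto
    obtain m' where "m' \<in> lines M" "qs ! i \<in> m'" "qs ! j \<in> m'"
      using join_indices[OF M qs(2,1)] ij n by auto
    then show "m \<in> lines M" using same[of l m' i j] ij l by auto
  next
    fix m assume m: "m \<in> lines M"
    obtain i j where ij: "i < n" "j < n" "i \<noteq> j" "qs ! i \<in> m" "qs ! j \<in> m"
      using line_two_indices[OF M m qs(2)] n by auto
    obtain l where "l \<in> lines G" "ps ! i \<in> l" "ps ! j \<in> l"
      using join_indices[OF G ps(2,1)] ij n by auto
    then show "m \<in> (\<lambda>l. f ` l) ` lines G" using same[of l m i j] ij m by auto
  qed
  then show ?thesis using f bij unfolding isomorphism_def by blast
qed

lemma unique_line_if_linear_rows:
  assumes rows: "linear_rows (length ps) ts" "bits ps ` LS = set ts"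
    and sub: "\<And>l. l \<in> LS \<Longrightarrow> l \<subseteq> set ps" and xy: "x \<in> set ps" "y \<in> set ps" "x \<noteq> y"
  shows "\<exists>!l. l \<in> LS \<and> x \<in> l \<and> y \<in> l"
proof -
  obtain i j where ij: "x = ps ! i" "y = ps ! j" "i < length ps" "j < length ps"
    using xy unfolding in_set_conv_nth by blast
  then have "i \<noteq> j" using xy by auto
  have on: "x \<in> l \<longleftrightarrow> bit_at (bits ps l) i" "y \<in> l \<longleftrightarrow> bit_at (bits ps l) j" for l
    using ij by (simp_all add: bit_at_bits)
  from linear_rowsD[OF rows(1) ij(3,4) \<open>i \<noteq> j\<close>]
  obtain t where t: "t \<in> set ts" "bit_at t i" "bit_at t j"
    and uniq: "\<And>t'. t' \<in> set ts \<Longrightarrow> bit_at t' i \<Longrightarrow> bit_at t' j \<Longrightarrow> t' = t" by blast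
  obtain l where l: "l \<in> LS" "t = bits ps l" using t(1) unfolding rows(2)[symmetric] by auto
  have "m = l" if m: "m \<in> LS" "x \<in> m" "y \<in> m" for m
  proof -
    have "bits ps m \<in> set ts" unfolding rows(2)[symmetric] using m(1) by (rule imageI)
    then have "bits ps m = bits ps l" using uniq on m l(2) by simp
    then show "m = l" using sub[OF m(1)] sub[OF l(1)] by (auto simp: bits_eq_iff)
  qed
  then show ?thesis using l t on by blast
qed

lemma MR_lines_nonempty:
  assumes "MR_geometry M" obtains l where "l \<in> lines M"
proof -
  have "2 \<le> card (points M)" using assms by (auto simp: MR_geometry_def finite_linear_space_def)
  then obtain x y where "x \<in> points M" "y \<in> points M" "x \<noteq> y" by (rule two_elements)
  then show ?thesis using assms that unfolding MR_geometry_def finite_linear_space_def by metis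
qed

lemma realises_obtain:
  assumes "MR_geometry M" "realises c T M" "table_ok r g T"
  obtains rs gs where "distinct (rs @ gs)" "set rs = side c M" "set gs = points M - side c M"
    "length rs = r" "length gs = g" "\<And>l. l \<in> lines M \<Longrightarrow> (bits rs l, bits gs l) \<in> set T"
proof -
  obtain rs gs where *: "distinct rs" "set rs = side c M" "distinct gs" "set gs = points M - side c M"
    "\<And>l. l \<in> lines M \<Longrightarrow> (bits rs l, bits gs l) \<in> set T"
    using assms(2) unfolding realises_def by blast
  \<comment> \<open>The row of a single line already shows the sizes of both classes.\<close>
  obtain l where "l \<in> lines M" using MR_lines_nonempty assms(1) .
  then have "(bits rs l, bits gs l) \<in> set T" by (rule *)
  then have "length rs = r" "length gs = g" using assms(3) by (auto simp: table_ok_def list_all_iff)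
  then show ?thesis using that[of rs gs] * by auto
qed

lemma card_realises:
  assumes "MR_geometry M" "realises c T M" "table_ok r g T"
  shows "card (points M) = r + g"
proof -
  obtain rs gs where *: "distinct (rs @ gs)" "set rs = side c M" "set gs = points M - side c M"
    "length rs = r" "length gs = g"
    using realises_obtain[OF assms] by metis
  have "points M = set (rs @ gs)" using * by (auto simp: side_def)
  then show ?thesis using distinct_card[OF *(1)] *(4,5) by simp
qed

text \<open>Matching positions carries the class of colour \<open>c\<close> to the class of colour
  \<open>c'\<close>. If these colours agree the isomorphism preserves colours, otherwise it
  interchanges them.\<close>

lemma MR_equivalent_if_realise:
  assumes G: "MR_geometry G" "realises c T G" and M: "MR_geometry M" "realises c' T M" and T: "table_ok r g T"
  shows "MR_equivalent G M"
proof -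
  obtain rs gs where 1: "distinct (rs @ gs)" "set rs = side c G" "set gs = points G - side c G"
    "length rs = r" "length gs = g" "\<And>l. l \<in> lines G \<Longrightarrow> (bits rs l, bits gs l) \<in> set T"
    using realises_obtain[OF G T] by metis
  obtain rs' gs' where 2: "distinct (rs' @ gs')" "set rs' = side c' M" "set gs' = points M - side c' M"
    "length rs' = r" "length gs' = g" "\<And>l. l \<in> lines M \<Longrightarrow> (bits rs' l, bits gs' l) \<in> set T"
    using realises_obtain[OF M T] by metis
  have pts: "set (rs @ gs) = points G" "set (rs' @ gs') = points M" using 1 2 by (auto simp: side_def)
  have "\<exists>f. (\<forall>i<r + g. f ((rs @ gs) ! i) = (rs' @ gs') ! i) \<and> isomorphism f G M"
  proof (rule linear_space_isomorphism)
    show "linear_rows (r + g) (map (\<lambda>(a, b). a @ b) T)" using T by (simp add: table_ok_def)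
    show "bits (rs @ gs) l \<in> set (map (\<lambda>(a, b). a @ b) T)" if "l \<in> lines G" for l
      using 1(6)[OF that] by (force simp: bits_append)
    show "bits (rs' @ gs') l \<in> set (map (\<lambda>(a, b). a @ b) T)" if "l \<in> lines M" for l
      using 2(6)[OF that] by (force simp: bits_append)
  qed (use 1 2 pts G M in \<open>auto simp: MR_geometry_def\<close>)
  then obtain f where f: "\<And>i. i < r + g \<Longrightarrow> f ((rs @ gs) ! i) = (rs' @ gs') ! i" and iso: "isomorphism f G M" by blast
  have col: "colour M (f p) = c' \<longleftrightarrow> colour G p = c" if p: "p \<in> points G" for p
  proof -
    obtain i where i: "i < r + g" "p = (rs @ gs) ! i"
      using p unfolding pts(1)[symmetric] in_set_conv_nth length_append 1(4,5) by blast
    have fp: "f p = (rs' @ gs') ! i" using f i by simp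
    have "f p \<in> points M" using iso p by (auto simp: isomorphism_def bij_betw_def)
    show ?thesis
    proof (cases "i < r")
      case True
      then have "p \<in> set rs" "f p \<in> set rs'" using i fp 1(4) 2(4) by (simp_all add: nth_append)
      then show ?thesis using 1 2 by (simp add: side_def)
    next
      case False
      then have "p \<in> set gs" "f p \<in> set gs'" using i fp 1(4,5) 2(4,5) by (simp_all add: nth_append)
      then show ?thesis using 1 2 by (auto simp: side_def)
    qed
  qed
  show ?thesis
  proof (cases "c = c'")
    case True
    have "colour M (f p) = colour G p" if "p \<in> points G" for p
      using col[OF that] True by (metis (full_types) colour.exhaust)
    then show ?thesis using iso unfolding MR_equivalent_def MR_isomorphic_def by blast
  next
    case False
    have "colour M (f p) = other_colour (colour G p)" if "p \<in> points G" for p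
      using col[OF that] False by (metis (full_types) colour.exhaust other_colour.simps)
    moreover have "isomorphism f (swap_colours G) M"
      using iso by (simp add: isomorphism_def swap_colours_def)
    ultimately have "MR_isomorphic (swap_colours G) M"
      unfolding MR_isomorphic_def by (intro exI[of _ f]) (simp add: swap_colours_def)
    then show ?thesis by (simp add: MR_equivalent_def)
  qed
qed

lemma card_bits:
  assumes "distinct (rs @ gs)" "l \<subseteq> set rs \<union> set gs"
  shows "card (l \<inter> set rs) = weight (bits rs l)" "card (l \<inter> set gs) = weight (bits gs l)"
    "card l = weight (bits rs l) + weight (bits gs l)"
proof -
  show 1: "card (l \<inter> set rs) = weight (bits rs l)" "card (l \<inter> set gs) = weight (bits gs l)"
    using assms by (simp_all add: weight_bits)
  have "l = (l \<inter> set rs) \<union> (l \<inter> set gs)" using assms by auto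
  moreover have "card \<dots> = card (l \<inter> set rs) + card (l \<inter> set gs)"
    by (rule card_Un_disjoint) (use assms in auto)
  ultimately show "card l = weight (bits rs l) + weight (bits gs l)" using 1 by simp
qed

text \<open>Here the lines are exactly the rows, unlike in \<open>realises\<close>. So the table
  also proves that \<open>M\<close> is an MR geometry, and lines can be counted in it.\<close>

locale tabulated =
  fixes M :: "'a coloured" and c :: colour and rs gs :: "'a list" and T :: "bits2 list"
  assumes distinct: "distinct (rs @ gs)" and points_eq: "points M = set rs \<union> set gs"
    and lines_sub: "l \<in> lines M \<Longrightarrow> l \<subseteq> points M"
    and lines_bits: "(\<lambda>l. (bits rs l, bits gs l)) ` lines M = set T"
    and colour_rs: "p \<in> set rs \<Longrightarrow> colour M p = c" and colour_gs: "p \<in> set gs \<Longrightarrow> colour M p \<noteq> c"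
    and ok: "table_ok (length rs) (length gs) T"
begin

lemma side_eq: "side c M = set rs" "points M - side c M = set gs"
  using points_eq colour_rs colour_gs distinct by (auto simp: side_def)

lemma inj_bits: "inj_on (\<lambda>l. (bits rs l, bits gs l)) (lines M)"
proof (rule inj_onI)
  fix l m assume lm: "l \<in> lines M" "m \<in> lines M" "(bits rs l, bits gs l) = (bits rs m, bits gs m)"
  then have "l \<subseteq> set rs \<union> set gs" "m \<subseteq> set rs \<union> set gs" using lines_sub points_eq by auto
  then show "l = m" using lm(3) by (auto simp: bits_eq_iff)
qed

lemma realises: "realises c T M"
proof -
  have "\<forall>l\<in>lines M. (bits rs l, bits gs l) \<in> set T" using lines_bits by blast
  then show ?thesis
    unfolding realises_def using side_eq distinct by (intro exI[of _ rs] exI[of _ gs]) simp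
qed

lemma MR: "MR_geometry M"
proof -
  have T: "weight (bits rs l) \<noteq> 0" "weight (bits gs l) \<noteq> 0" "weight (bits rs l) + weight (bits gs l) < length rs + length gs"
    if "l \<in> lines M" for l
    using ok lines_bits that by (auto simp: table_ok_def list_all_iff)
  have sub: "l \<subseteq> set rs \<union> set gs" if "l \<in> lines M" for l using lines_sub[OF that] points_eq by simp
  note cb = card_bits[OF distinct sub]
  have card_pts: "card (points M) = length rs + length gs"
    using distinct_card[OF distinct] points_eq by simp
  have ex1: "\<exists>!l. l \<in> lines M \<and> x \<in> l \<and> y \<in> l" if xy: "x \<in> points M" "y \<in> points M" "x \<noteq> y" for x y
  proof (rule unique_line_if_linear_rows[of "rs @ gs"])
    show "linear_rows (length (rs @ gs)) (map (\<lambda>(a, b). a @ b) T)" using ok by (simp add: table_ok_def)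
    show "bits (rs @ gs) ` lines M = set (map (\<lambda>(a, b). a @ b) T)"
      unfolding set_map lines_bits[symmetric] image_image by (simp add: bits_append)
  qed (use xy points_eq sub in simp_all)
  have "(\<exists>p\<in>l. colour M p = c) \<and> (\<exists>p\<in>l. colour M p \<noteq> c)" if l: "l \<in> lines M" for l
  proof -
    have "l \<inter> set rs \<noteq> {}" "l \<inter> set gs \<noteq> {}" using cb[OF l] T[OF l] by (metis card.empty)+
    then show ?thesis using colour_rs colour_gs by blast
  qed
  then have "(\<exists>p\<in>l. colour M p = Red) \<and> (\<exists>p\<in>l. colour M p = Green)" if "l \<in> lines M" for l
    using that by (metis (full_types) colour.exhaust)
  moreover have "finite_linear_space M"
    unfolding finite_linear_space_def
  proof (intro conjI ballI impI notI)
    show "2 \<le> card l" if "l \<in> lines M" for l using cb(3)[OF that] T[OF that] by linarith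
    show "2 \<le> card (points M)" using card_pts ok by (simp add: table_ok_def)
    assume "\<exists>l\<in>lines M. points M \<subseteq> l"
    then obtain l where l: "l \<in> lines M" "points M \<subseteq> l" by blast
    then have "points M = l" using lines_sub by auto
    then show False using cb(3)[OF l(1)] T(3)[OF l(1)] card_pts by simp
  qed (use points_eq lines_sub ex1 in auto)
  ultimately show ?thesis by (simp add: MR_geometry_def)
qed

lemma card_points: "card (points M) = length rs + length gs"
  using card_realises[OF MR realises ok] .

lemma card_lines: "card {l \<in> lines M. P (bits rs l) (bits gs l)} = length (filter (\<lambda>(a, b). P a b) T)"
proof -
  have "card {l \<in> lines M. P (bits rs l) (bits gs l)} =
      card ((\<lambda>l. (bits rs l, bits gs l)) ` {l \<in> lines M. P (bits rs l) (bits gs l)})"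
    by (rule card_image[symmetric], rule inj_on_subset[OF inj_bits]) auto
  also have "(\<lambda>l. (bits rs l, bits gs l)) ` {l \<in> lines M. P (bits rs l) (bits gs l)} =
      {t \<in> (\<lambda>l. (bits rs l, bits gs l)) ` lines M. case t of (a, b) \<Rightarrow> P a b}" by auto
  also have "\<dots> = set (filter (\<lambda>(a, b). P a b) T)" unfolding lines_bits by simp
  finally show ?thesis using ok distinct_card[OF distinct_filter, of T] by (simp add: table_ok_def)
qed

end

text \<open>All three numbers are unaffected by interchanging the colours. The third, which counts
  the lines with equally many points of both colours, is what separates \<open>MR15_3r\<close> from
  \<open>MR15_3g\<close> and \<open>MR15_2\<close> from \<open>MR15_5\<close>.\<close>

definition invariants :: "'a coloured \<Rightarrow> nat \<times> nat \<times> nat" where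
  "invariants M = (card (points M), card {l \<in> lines M. card l = 2},
     card {l \<in> lines M. card (l \<inter> side Red M) = card (l \<inter> side Green M)})"

lemma (in tabulated) invariants: "invariants M = (length rs + length gs,
    length (filter (\<lambda>(a, b). weight a + weight b = 2) T), length (filter (\<lambda>(a, b). weight a = weight b) T))"
proof -
  have sub: "l \<subseteq> set rs \<union> set gs" if "l \<in> lines M" for l using lines_sub[OF that] points_eq by simp
  note cb = card_bits[OF distinct sub]
  have "card (l \<inter> side Red M) = card (l \<inter> side Green M) \<longleftrightarrow> weight (bits rs l) = weight (bits gs l)"
    if "l \<in> lines M" for l
    using cb[OF that] side_eq side_other[of c M] by (cases c) auto
  then have "{l \<in> lines M. card (l \<inter> side Red M) = card (l \<inter> side Green M)} =
    {l \<in> lines M. weight (bits rs l) = weight (bits gs l)}" by auto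
  moreover have "{l \<in> lines M. card l = 2} = {l \<in> lines M. weight (bits rs l) + weight (bits gs l) = 2}"
    using cb by auto
  ultimately show ?thesis
    unfolding invariants_def card_points
    using card_lines[of "\<lambda>a b. weight a + weight b = 2"] card_lines[of "\<lambda>a b. weight a = weight b"] by simp
qed

lemma invariants_isomorphic:
  assumes "MR_geometry M" "MR_isomorphic M M'" shows "invariants M = invariants M'"
proof -
  obtain f where iso: "isomorphism f M M'" and col: "\<forall>p\<in>points M. colour M' (f p) = colour M p"
    using assms(2) unfolding MR_isomorphic_def by (elim exE conjE)
  have bij: "bij_betw f (points M) (points M')" and lines: "(\<lambda>l. f ` l) ` lines M = lines M'"
    using iso by (simp_all add: isomorphism_def)
  have sub: "l \<subseteq> points M" if "l \<in> lines M" for l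
    using assms(1) that by (auto simp: MR_geometry_def finite_linear_space_def)
  have inj: "inj_on f (points M)" using bij by (simp add: bij_betw_def)
  have inj_lines: "inj_on (\<lambda>l. f ` l) (lines M)"
    using inj_on_image_eq_iff[OF inj] sub by (intro inj_onI) blast
  have card_eq: "card (f ` l) = card l" if "l \<subseteq> points M" for l
    using inj that by (meson card_image inj_on_subset)
  have side: "f ` l \<inter> side c M' = f ` (l \<inter> side c M)" if "l \<in> lines M" for l c
    using sub[OF that] col bij by (auto simp: side_def bij_betw_def)
  have count: "card {l \<in> lines M'. P l} = card {l \<in> lines M. P (f ` l)}" for P
  proof -
    have "{l \<in> lines M'. P l} = (\<lambda>l. f ` l) ` {l \<in> lines M. P (f ` l)}"
      unfolding lines[symmetric] by auto
    moreover have "card ((\<lambda>l. f ` l) ` {l \<in> lines M. P (f ` l)}) = card {l \<in> lines M. P (f ` l)}"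
      by (rule card_image, rule inj_on_subset[OF inj_lines]) blast
    ultimately show ?thesis by simp
  qed
  have "card (f ` (l \<inter> side c M)) = card (l \<inter> side c M)" for l c
    by (rule card_eq) (auto simp: side_def)
  then have "{l \<in> lines M. card (f ` l \<inter> side Red M') = card (f ` l \<inter> side Green M')} =
    {l \<in> lines M. card (l \<inter> side Red M) = card (l \<inter> side Green M)}" using side by auto
  moreover have "{l \<in> lines M. card (f ` l) = 2} = {l \<in> lines M. card l = 2}" using card_eq sub by auto
  ultimately show ?thesis
    unfolding invariants_def count using bij_betw_same_card[OF bij] by simp
qed

lemma invariants_equivalent:
  assumes "MR_geometry M" "MR_equivalent M M'" shows "invariants M = invariants M'"
proof -
  have sw: "points (swap_colours M) = points M" "lines (swap_colours M) = lines M"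
    "colour (swap_colours M) = other_colour \<circ> colour M" by (simp_all add: swap_colours_def)
  have red: "other_colour c = Red \<longleftrightarrow> c = Green" and green: "other_colour c = Green \<longleftrightarrow> c = Red" for c
    by (cases c; simp)+
  have "side Red (swap_colours M) = side Green M" "side Green (swap_colours M) = side Red M"
    by (simp_all add: side_def sw red green)
  then have "invariants (swap_colours M) = invariants M"
    unfolding invariants_def sw by (simp add: eq_commute)
  moreover have "MR_geometry (swap_colours M)"
    using assms(1) unfolding MR_geometry_def finite_linear_space_def sw comp_apply red green by simp
  ultimately show ?thesis
    using assms invariants_isomorphic unfolding MR_equivalent_def by metis
qed

section \<open>The geometries in the plane of order 4\<close>

lemma lines_PG24: "lines PG24 = set pg24_lines"
proof -
  have "lines PG24 = (\<lambda>(i, j). PG24_line i j) ` ({0..<7} \<times> {0..<3})"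
    by (auto simp: PG24_def image_iff) blast
  then show ?thesis by (simp add: pg24_lines_def)
qed

lemma tabulated_PG24:
  assumes d: "distinct (rs @ gs)" and P: "Gs \<union> Rs = set rs \<union> set gs"
    and col: "\<And>p. p \<in> set rs \<Longrightarrow> green_on Gs p = c" "\<And>p. p \<in> set gs \<Longrightarrow> green_on Gs p \<noteq> c"
    and ok: "table_ok r g (pg24_bits rs gs)" "length rs = r" "length gs = g"
  shows "tabulated (PG24_geometry Gs Rs) c rs gs (pg24_bits rs gs)"
proof
  have lines: "lines (PG24_geometry Gs Rs) = {l \<inter> (set rs \<union> set gs) |l. l \<in> set pg24_lines \<and> 2 \<le> card (l \<inter> (set rs \<union> set gs))}"
    by (simp add: PG24_geometry_def coloured_by_def induced_subspace_def lines_PG24 P)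
  show pts: "points (PG24_geometry Gs Rs) = set rs \<union> set gs"
    by (simp add: PG24_geometry_def coloured_by_def induced_subspace_def P)
  show "l \<subseteq> points (PG24_geometry Gs Rs)" if "l \<in> lines (PG24_geometry Gs Rs)" for l
    using that unfolding lines pts by blast
  have b: "bits rs (l \<inter> (set rs \<union> set gs)) = bits rs l" "bits gs (l \<inter> (set rs \<union> set gs)) = bits gs l" for l
    unfolding bits_eq_iff by blast+
  have "card (l \<inter> (set rs \<union> set gs)) = weight (bits rs l) + weight (bits gs l)" for l
    using card_bits(3)[OF d, of "l \<inter> (set rs \<union> set gs)"] by (simp add: b)
  then have "lines (PG24_geometry Gs Rs) = (\<lambda>l. l \<inter> (set rs \<union> set gs)) ` {l \<in> set pg24_lines. 2 \<le> weight (bits rs l) + weight (bits gs l)}"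
    unfolding lines by auto
  then show "(\<lambda>l. (bits rs l, bits gs l)) ` lines (PG24_geometry Gs Rs) = set (pg24_bits rs gs)"
    by (auto simp: image_image b pg24_bits_def)
  show "colour (PG24_geometry Gs Rs) p = c" if "p \<in> set rs" for p
    using col(1)[OF that] by (simp add: PG24_geometry_def coloured_by_def)
  show "colour (PG24_geometry Gs Rs) p \<noteq> c" if "p \<in> set gs" for p
    using col(2)[OF that] by (simp add: PG24_geometry_def coloured_by_def)
qed (use d ok in simp_all)

lemma set_rows: "set row0 = layer0" "set row1 = layer1" "set reds14 = red14_2"
  "distinct row0" "distinct row1" "distinct reds14" "length row0 = 7" "length row1 = 7" "length reds14 = 7"
  by (auto simp: row0_def row1_def reds14_def layer0_def layer1_def red14_2_def distinct_map inj_on_def)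

lemma rows_disjoint: "layer0 \<inter> layer1 = {}" "layer0 \<inter> red14_2 = {}" "Ix i 2 \<notin> layer0" "Ix i 2 \<notin> layer1"
  "Ix 4 2 \<notin> red14_2" "Ix 3 1 \<notin> red14_2" "Ix 3 1 \<notin> layer0" "Infty \<notin> layer0" "Infty \<notin> layer1"
  by (auto simp: layer0_def layer1_def red14_2_def)

lemma tables_ok:
  "table_ok 6 6 T12" "table_ok 6 7 T13" "table_ok 7 7 T14_1" "table_ok 7 7 T14_2" "table_ok 7 8 T15_1"
  "table_ok 7 8 T15_2" "table_ok 7 8 T15_3r" "table_ok 7 8 T15_3g" "table_ok 7 8 T15_4" "table_ok 7 8 T15_5"
  by code_simp+

definition counts_of :: "bits2 list \<Rightarrow> nat \<times> nat" where
  "counts_of T = (length (filter (\<lambda>(a, b). weight a + weight b = 2) T), length (filter (\<lambda>(a, b). weight a = weight b) T))"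

lemma table_counts:
  "counts_of T14_1 = (7, 7)" "counts_of T14_2 = (3, 3)" "counts_of T15_1 = (4, 4)" "counts_of T15_2 = (0, 0)"
  "counts_of T15_3r = (1, 1)" "counts_of T15_3g = (1, 3)" "counts_of T15_4 = (3, 3)" "counts_of T15_5 = (0, 2)"
  by code_simp+

lemma tabulated_MR14_1: "tabulated MR14_1 Red row1 row0 T14_1"
  unfolding MR14_1_def T14_1_def
  by (rule tabulated_PG24[OF _ _ _ _ tables_ok(3)[unfolded T14_1_def]])
    (use set_rows rows_disjoint in \<open>auto simp: green_on_def\<close>)

lemma tabulated_MR14_2: "tabulated MR14_2 Red reds14 row0 T14_2"
  unfolding MR14_2_def T14_2_def
  by (rule tabulated_PG24[OF _ _ _ _ tables_ok(4)[unfolded T14_2_def]])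
    (use set_rows rows_disjoint in \<open>auto simp: green_on_def\<close>)

lemma tabulated_MR15_1: "tabulated MR15_1 Red row1 (row0 @ [Ix 6 2]) T15_1"
  unfolding MR15_1_def T15_1_def
  by (rule tabulated_PG24[OF _ _ _ _ tables_ok(5)[unfolded T15_1_def]])
    (use set_rows rows_disjoint in \<open>auto simp: green_on_def\<close>)

lemma tabulated_MR15_3r: "tabulated MR15_3r Green row0 (reds14 @ [Ix 4 2]) T15_3r"
  unfolding MR15_3r_def T15_3r_def
  by (rule tabulated_PG24[OF _ _ _ _ tables_ok(7)[unfolded T15_3r_def]])
    (use set_rows rows_disjoint in \<open>auto simp: green_on_def\<close>)

lemma tabulated_MR15_3g: "tabulated MR15_3g Red reds14 (row0 @ [Ix 4 2]) T15_3g"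
  unfolding MR15_3g_def T15_3g_def
  by (rule tabulated_PG24[OF _ _ _ _ tables_ok(8)[unfolded T15_3g_def]])
    (use set_rows rows_disjoint in \<open>auto simp: green_on_def\<close>)

lemma tabulated_MR15_4: "tabulated MR15_4 Green row0 (reds14 @ [Ix 3 1]) T15_4"
  unfolding MR15_4_def T15_4_def
  by (rule tabulated_PG24[OF _ _ _ _ tables_ok(9)[unfolded T15_4_def]])
    (use set_rows rows_disjoint in \<open>auto simp: green_on_def\<close>)

lemma tabulated_MR15_5: "tabulated MR15_5 Green greens15 reds15 T15_5"
  unfolding MR15_5_def T15_5_def
  by (rule tabulated_PG24[OF _ _ _ _ tables_ok(10)[unfolded T15_5_def]])
    (auto simp: green_on_def greens15_def reds15_def)

text \<open>\<open>MR15_2\<close> names the lines to be extended as \<open>{Ix i 0, Ix i 1}\<close>,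
  whereas \<open>T15_2\<close> finds them by their weight; this shows that both mean the same
  lines.\<close>

lemma two_point_lines_T14_1:
  "set (filter (\<lambda>(a, b). weight a + weight b = 2) T14_1) =
   set (map (\<lambda>i. (bits row1 {Ix i 0, Ix i 1}, bits row0 {Ix i 0, Ix i 1})) [0..<7])"
  by code_simp

lemma image_if_mem:
  assumes "D \<subseteq> L" shows "(\<lambda>l. if l \<in> D then f l else l) ` L = (L - D) \<union> f ` D"
proof -
  have "(\<lambda>l. if l \<in> D then f l else l) ` ((L - D) \<union> D) = (L - D) \<union> f ` D"
    unfolding image_Un by simp
  moreover have "(L - D) \<union> D = L" using assms by blast
  ultimately show ?thesis by (simp only:)
qed

text \<open>The lines are the image of those of \<open>MR14_1\<close> under the map that inserts
  \<open>Infty\<close> into the two-point lines and fixes the others. On rows this map appends one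
  bit.\<close>

lemma tabulated_MR15_2: "tabulated MR15_2 Red row1 (row0 @ [Infty]) T15_2"
proof -
  interpret A: tabulated MR14_1 Red row1 row0 T14_1 by (rule tabulated_MR14_1)
  let ?D = "{{Ix i 0, Ix i 1} |i. i < 7}"
  have sub: "d \<subseteq> set row1 \<union> set row0" if "d \<in> ?D" for d
    using that by (auto simp: set_rows layer0_def layer1_def)
  have D_eq: "?D = (\<lambda>i. {Ix i 0, Ix i 1}) ` set [0..<7]" by auto
  have D_bits: "(\<lambda>l. (bits row1 l, bits row0 l)) ` ?D = {(a, b) \<in> set T14_1. weight a + weight b = 2}"
    using two_point_lines_T14_1 unfolding D_eq image_image by auto
  have inj: "l = m" if "l \<subseteq> set row1 \<union> set row0" "m \<subseteq> set row1 \<union> set row0"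
    "(bits row1 l, bits row0 l) = (bits row1 m, bits row0 m)" for l m
    using that by (auto simp: bits_eq_iff)
  have lsub: "l \<subseteq> set row1 \<union> set row0" if "l \<in> lines MR14_1" for l
    using A.lines_sub[OF that] A.points_eq by simp
  have D_lines: "?D \<subseteq> lines MR14_1"
  proof
    fix d assume d: "d \<in> ?D"
    then have "(bits row1 d, bits row0 d) \<in> (\<lambda>l. (bits row1 l, bits row0 l)) ` lines MR14_1"
      unfolding A.lines_bits using D_bits by blast
    then obtain l where "l \<in> lines MR14_1" "(bits row1 d, bits row0 d) = (bits row1 l, bits row0 l)" by blast
    then show "d \<in> lines MR14_1" using inj[OF sub[OF d] lsub] by metis
  qed
  have D_weight: "l \<in> ?D \<longleftrightarrow> weight (bits row1 l) + weight (bits row0 l) = 2" if l: "l \<in> lines MR14_1" for l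
  proof
    assume "weight (bits row1 l) + weight (bits row0 l) = 2"
    moreover have "(bits row1 l, bits row0 l) \<in> set T14_1" using A.lines_bits l by blast
    ultimately have "(bits row1 l, bits row0 l) \<in> (\<lambda>l. (bits row1 l, bits row0 l)) ` ?D"
      unfolding D_bits by simp
    then obtain d where d: "d \<in> ?D" and eq: "(bits row1 l, bits row0 l) = (bits row1 d, bits row0 d)"
      by (rule imageE) simp
    then show "l \<in> ?D" using inj[OF lsub[OF l] sub[OF d] eq] by simp
  next
    assume "l \<in> ?D"
    then have "(bits row1 l, bits row0 l) \<in> (\<lambda>l. (bits row1 l, bits row0 l)) ` ?D" by (rule imageI)
    then show "weight (bits row1 l) + weight (bits row0 l) = 2" unfolding D_bits by simp
  qed
  have lines: "lines MR15_2 = (\<lambda>l. if l \<in> ?D then insert Infty l else l) ` lines MR14_1"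
  proof -
    have "lines MR15_2 = (lines MR14_1 - ?D) \<union> insert Infty ` ?D"
      by (auto simp: MR15_2_def image_iff insert_commute)
    then show ?thesis unfolding image_if_mem[OF D_lines] .
  qed
  have inf: "Infty \<notin> set row1" "Infty \<notin> set row0" using rows_disjoint set_rows by auto
  show ?thesis
  proof
    show "distinct (row1 @ row0 @ [Infty])" using A.distinct inf by auto
    show pts: "points MR15_2 = set row1 \<union> set (row0 @ [Infty])"
      by (simp add: MR15_2_def A.points_eq)
    show "l \<subseteq> points MR15_2" if l: "l \<in> lines MR15_2" for l
    proof -
      obtain m where m: "m \<in> lines MR14_1" "l = (if m \<in> ?D then insert Infty m else m)"
        using l unfolding lines by (rule imageE) simp
      have "l \<subseteq> insert Infty m" unfolding m(2) by (rule if_split[THEN iffD2]) blast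
      then show ?thesis using lsub[OF m(1)] unfolding pts by auto
    qed
    show "colour MR15_2 p = Red" if "p \<in> set row1" for p
      using A.colour_rs[OF that] that inf by (auto simp: MR15_2_def)
    show "colour MR15_2 p \<noteq> Red" if "p \<in> set (row0 @ [Infty])" for p
      using A.colour_gs[of p] that inf by (auto simp: MR15_2_def)
    show "table_ok (length row1) (length (row0 @ [Infty])) T15_2"
      using tables_ok(6) by (simp add: set_rows)
    have img: "(bits row1 (if l \<in> ?D then insert Infty l else l), bits (row0 @ [Infty]) (if l \<in> ?D then insert Infty l else l)) =
      (bits row1 l, bits row0 l @ [weight (bits row1 l) + weight (bits row0 l) = 2])" if l: "l \<in> lines MR14_1" for l
    proof -
      have "Infty \<notin> l" using lsub[OF l] inf by auto
      then have "Infty \<in> (if l \<in> ?D then insert Infty l else l) \<longleftrightarrow> weight (bits row1 l) + weight (bits row0 l) = 2"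
        using D_weight[OF l] by (simp split: if_split)
      moreover have "bits row1 (if l \<in> ?D then insert Infty l else l) = bits row1 l"
        "bits row0 (if l \<in> ?D then insert Infty l else l) = bits row0 l"
        using inf by (simp_all add: bits_eq_iff)
      ultimately show ?thesis by (simp add: bits_append)
    qed
    have "(\<lambda>l. (bits row1 l, bits (row0 @ [Infty]) l)) ` lines MR15_2 =
      (\<lambda>l. (bits row1 l, bits row0 l @ [weight (bits row1 l) + weight (bits row0 l) = 2])) ` lines MR14_1"
      unfolding lines image_image by (rule image_cong[OF refl img])
    also have "\<dots> = (\<lambda>(a, b). (a, b @ [weight a + weight b = 2])) ` (\<lambda>l. (bits row1 l, bits row0 l)) ` lines MR14_1"
      by (simp add: image_image)
    also have "\<dots> = set T15_2" unfolding A.lines_bits T15_2_def by simp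
    finally show "(\<lambda>l. (bits row1 l, bits (row0 @ [Infty]) l)) ` lines MR15_2 = set T15_2" .
  qed
qed

section \<open>The geometries in the plane of order 3\<close>

locale plane_of_order_3 =
  fixes S :: "'a incidence"
  assumes fls: "finite_linear_space S" and card_line: "l \<in> lines S \<Longrightarrow> card l = 4"
    and meet: "l \<in> lines S \<Longrightarrow> m \<in> lines S \<Longrightarrow> l \<inter> m \<noteq> {}"
begin

lemma join_eq:
  assumes "x \<in> points S" "y \<in> points S" "x \<noteq> y"
  shows "join S x y \<in> lines S" "x \<in> join S x y" "y \<in> join S x y"
proof -
  have "\<exists>!l. l \<in> lines S \<and> x \<in> l \<and> y \<in> l" using fls assms by (simp add: finite_linear_space_def)
  from theI'[OF this] show "join S x y \<in> lines S" "x \<in> join S x y" "y \<in> join S x y"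
    unfolding join_def by simp_all
qed

lemma line_points: "l \<in> lines S \<Longrightarrow> x \<in> l \<Longrightarrow> x \<in> points S"
  using fls by (auto simp: finite_linear_space_def)

lemma point_eq:
  assumes "l \<in> lines S" "m \<in> lines S" "l \<noteq> m" "x \<in> l" "x \<in> m" "y \<in> l" "y \<in> m"
  shows "x = y"
proof (rule ccontr)
  assume "x \<noteq> y"
  then have "\<exists>!l. l \<in> lines S \<and> x \<in> l \<and> y \<in> l"
    using fls line_points assms by (simp add: finite_linear_space_def)
  then show False using assms by blast
qed

lemma meet_eq:
  assumes "l \<in> lines S" "m \<in> lines S" "l \<noteq> m"
  shows "Defs.meet l m \<in> l" "Defs.meet l m \<in> m"
proof -
  obtain x where x: "x \<in> l" "x \<in> m" using meet[OF assms(1,2)] by blast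
  have "\<exists>!p. p \<in> l \<and> p \<in> m"
    by (rule ex1I[of _ x]) (use x point_eq[OF assms] in auto)
  from theI'[OF this] show "Defs.meet l m \<in> l" "Defs.meet l m \<in> m" unfolding Defs.meet_def by simp_all
qed

end

lemma neq_if_mem: "x \<in> l \<Longrightarrow> x \<notin> l' \<Longrightarrow> l \<noteq> l'"
  by blast

locale quadrangle_in_plane = plane_of_order_3 +
  fixes A B C D :: 'a
  assumes quad: "quadrangle S A B C D"
begin

definition "E = Defs.meet (join S A B) (join S C D)"
definition "F = Defs.meet (join S A C) (join S B D)"
definition "H = Defs.meet (join S A D) (join S B C)"

lemma vertices: "A \<in> points S" "B \<in> points S" "C \<in> points S" "D \<in> points S"
  "A \<noteq> B" "A \<noteq> C" "A \<noteq> D" "B \<noteq> C" "B \<noteq> D" "C \<noteq> D"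
  using quad by (auto simp: quadrangle_def)

lemmas joins = join_eq[OF vertices(1,2,5)] join_eq[OF vertices(1,3,6)] join_eq[OF vertices(1,4,7)]
  join_eq[OF vertices(2,3,8)] join_eq[OF vertices(2,4,9)] join_eq[OF vertices(3,4,10)]

lemma not_three:
  assumes "l \<in> lines S"
  shows "\<not> (A \<in> l \<and> B \<in> l \<and> C \<in> l)" "\<not> (A \<in> l \<and> B \<in> l \<and> D \<in> l)"
    "\<not> (A \<in> l \<and> C \<in> l \<and> D \<in> l)" "\<not> (B \<in> l \<and> C \<in> l \<and> D \<in> l)"
proof -
  have "card T \<noteq> 3" if "T \<subseteq> l \<inter> {A, B, C, D}" for T
  proof -
    have "card T \<le> card (l \<inter> {A, B, C, D})" by (rule card_mono) (use that in auto)
    then show ?thesis using quad assms by (fastforce simp: quadrangle_def)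
  qed
  from this[of "{A, B, C}"] this[of "{A, B, D}"] this[of "{A, C, D}"] this[of "{B, C, D}"]
  show "\<not> (A \<in> l \<and> B \<in> l \<and> C \<in> l)" "\<not> (A \<in> l \<and> B \<in> l \<and> D \<in> l)"
    "\<not> (A \<in> l \<and> C \<in> l \<and> D \<in> l)" "\<not> (B \<in> l \<and> C \<in> l \<and> D \<in> l)"
    using vertices by auto
qed

lemma off_joins:
  "C \<notin> join S A B" "D \<notin> join S A B" "B \<notin> join S A C" "D \<notin> join S A C" "B \<notin> join S A D" "C \<notin> join S A D"
  "A \<notin> join S B C" "D \<notin> join S B C" "A \<notin> join S B D" "C \<notin> join S B D" "A \<notin> join S C D" "B \<notin> join S C D"
  using not_three[OF joins(1)] not_three[OF joins(4)] not_three[OF joins(7)]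
    not_three[OF joins(10)] not_three[OF joins(13)] not_three[OF joins(16)] joins by simp_all

lemma joins_neq:
  "join S A B \<noteq> join S C D" "join S A C \<noteq> join S B D" "join S A D \<noteq> join S B C"
  "join S A B \<noteq> join S A C" "join S A B \<noteq> join S A D" "join S A B \<noteq> join S B C" "join S A B \<noteq> join S B D"
  "join S A C \<noteq> join S A D" "join S A C \<noteq> join S B C" "join S A C \<noteq> join S C D"
  "join S A D \<noteq> join S B D" "join S A D \<noteq> join S C D" "join S B C \<noteq> join S B D" "join S B C \<noteq> join S C D"
  "join S B D \<noteq> join S C D"
  by (rule neq_if_mem[OF joins(2) off_joins(11)],
      rule neq_if_mem[OF joins(5) off_joins(9)],
      rule neq_if_mem[OF joins(8) off_joins(7)],
      rule neq_if_mem[OF joins(3) off_joins(3)],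
      rule neq_if_mem[OF joins(3) off_joins(5)],
      rule neq_if_mem[OF joins(2) off_joins(7)],
      rule neq_if_mem[OF joins(2) off_joins(9)],
      rule neq_if_mem[OF joins(6) off_joins(6)],
      rule neq_if_mem[OF joins(5) off_joins(7)],
      rule neq_if_mem[OF joins(5) off_joins(11)],
      rule neq_if_mem[OF joins(8) off_joins(9)],
      rule neq_if_mem[OF joins(8) off_joins(11)],
      rule neq_if_mem[OF joins(12) off_joins(10)],
      rule neq_if_mem[OF joins(11) off_joins(12)],
      rule neq_if_mem[OF joins(14) off_joins(12)])

lemma diagonal_points:
  "E \<in> join S A B" "E \<in> join S C D" "F \<in> join S A C" "F \<in> join S B D" "H \<in> join S A D" "H \<in> join S B C"
  using meet_eq[OF joins(1) joins(16) joins_neq(1)] meet_eq[OF joins(4) joins(13) joins_neq(2)]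
    meet_eq[OF joins(7) joins(10) joins_neq(3)] by (simp_all add: E_def F_def H_def)

text \<open>Otherwise the joins \<open>AB\<close>, \<open>CD\<close>, \<open>AC\<close>, \<open>BD\<close>, \<open>AD\<close> would meet the line in five different points.\<close>

lemma line_meets_green:
  assumes m: "m \<in> lines S" shows "m \<inter> {A, B, C, D, E, F} \<noteq> {}"
proof
  assume none: "m \<inter> {A, B, C, D, E, F} = {}"
  obtain a b c d e where p: "a \<in> m" "a \<in> join S A B" "b \<in> m" "b \<in> join S C D" "c \<in> m" "c \<in> join S A C"
    "d \<in> m" "d \<in> join S B D" "e \<in> m" "e \<in> join S A D"
    using meet[OF m joins(1)] meet[OF m joins(16)] meet[OF m joins(4)] meet[OF m joins(13)] meet[OF m joins(7)]
    by blast
  \<comment> \<open>Any two of the five joins meet in one of \<open>A\<close>, ...,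
    \<open>F\<close>, which is off \<open>m\<close>, so they meet \<open>m\<close> in different
    points. \<open>BC\<close> is left out because it meets \<open>AD\<close> in \<open>H\<close>,
    which may lie on \<open>m\<close>.\<close>
  have neq: "x \<noteq> y" if "x \<in> m" "x \<in> l" "y \<in> l'" "l \<in> lines S" "l' \<in> lines S" "l \<noteq> l'" "v \<in> l" "v \<in> l'" "v \<notin> m" for x y l l' v
    using that point_eq[of l l' x v] by auto
  have off: "A \<notin> m" "B \<notin> m" "C \<notin> m" "D \<notin> m" "E \<notin> m" "F \<notin> m" using none by auto
  have "a \<noteq> b" "c \<noteq> d"
    by (rule neq[OF p(1,2,4) joins(1,16) joins_neq(1) diagonal_points(1,2) off(5)],
        rule neq[OF p(5,6,8) joins(4,13) joins_neq(2) diagonal_points(3,4) off(6)])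
  moreover have "a \<noteq> c" "a \<noteq> d" "a \<noteq> e"
    by (rule neq[OF p(1,2,6) joins(1,4) joins_neq(4) joins(2,5) off(1)],
        rule neq[OF p(1,2,8) joins(1,13) joins_neq(7) joins(3,14) off(2)],
        rule neq[OF p(1,2,10) joins(1,7) joins_neq(5) joins(2,8) off(1)])
  moreover have "b \<noteq> c" "b \<noteq> d" "b \<noteq> e"
    by (rule neq[OF p(3,4,6) joins(16,4) joins_neq(10)[symmetric] joins(17,6) off(3)],
        rule neq[OF p(3,4,8) joins(16,13) joins_neq(15)[symmetric] joins(18,15) off(4)],
        rule neq[OF p(3,4,10) joins(16,7) joins_neq(12)[symmetric] joins(18,9) off(4)])
  moreover have "c \<noteq> e" "d \<noteq> e"
    by (rule neq[OF p(5,6,10) joins(4,7) joins_neq(8) joins(5,8) off(1)],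
        rule neq[OF p(7,8,10) joins(13,7) joins_neq(11)[symmetric] joins(15,9) off(4)])
  ultimately have "card {a, b, c, d, e} = 5" by simp
  moreover have "card {a, b, c, d, e} \<le> card m"
    by (rule card_mono) (use p card_line[OF m] in \<open>auto intro: card_ge_0_finite\<close>)
  ultimately show False using card_line[OF m] by simp
qed

lemma diagonal_not_vertex: "E \<notin> {A, B, C, D}" "F \<notin> {A, B, C, D}" "H \<notin> {A, B, C, D}"
  using diagonal_points off_joins by auto

text \<open>A line through a vertex and a diagonal point is a join of two vertices, and a join of two
  vertices contains only one diagonal point.\<close>

lemma line_meets_red:
  assumes m: "m \<in> lines S" shows "\<not> m \<subseteq> {A, B, C, D, E, F, H}"
proof
  assume sub: "m \<subseteq> {A, B, C, D, E, F, H}"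
  have fin: "finite m" using card_line[OF m] by (auto intro: card_ge_0_finite)
  let ?V = "m \<inter> {A, B, C, D}"
  have V: "card ?V \<le> 2" using quad m by (simp add: quadrangle_def)
  have "?V \<noteq> {}"
  proof
    assume "?V = {}"
    then have "m \<subseteq> {E, F, H}" using sub by auto
    then have "card m \<le> card {E, F, H}" by (intro card_mono) simp_all
    also have "\<dots> \<le> 3" by (simp add: card_insert_if)
    finally show False using card_line[OF m] by simp
  qed
  then obtain v where v: "v \<in> m" "v \<in> {A, B, C, D}" by blast
  \<comment> \<open>All vertices are on the two opposite sides through the diagonal point
    \<open>x\<close>. So \<open>m\<close> shares both \<open>v\<close> and \<open>x\<close> with one
    of these sides.\<close>
  have is_join: "m = l \<or> m = l'" if "x \<in> m" "x \<in> l" "x \<in> l'" "x \<notin> {A, B, C, D}" "l \<in> lines S" "l' \<in> lines S"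
    "{A, B, C, D} \<subseteq> l \<union> l'" for x l l'
    using point_eq[OF m, of l x v] point_eq[OF m, of l' x v] v that by blast
  have EFH: "E \<in> m \<Longrightarrow> m = join S A B \<or> m = join S C D" "F \<in> m \<Longrightarrow> m = join S A C \<or> m = join S B D"
    "H \<in> m \<Longrightarrow> m = join S A D \<or> m = join S B C"
    using is_join[of E "join S A B" "join S C D"] is_join[of F "join S A C" "join S B D"]
      is_join[of H "join S A D" "join S B C"] diagonal_points diagonal_not_vertex joins by simp_all
  have "\<not> (E \<in> m \<and> F \<in> m)"
    by (rule notI, elim conjE, drule EFH(1), drule EFH(2), elim disjE) (use joins_neq(4,7,10,15) in simp_all)
  moreover have "\<not> (E \<in> m \<and> H \<in> m)"
    by (rule notI, elim conjE, drule EFH(1), drule EFH(3), elim disjE) (use joins_neq(5,6,12,14) in simp_all)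
  moreover have "\<not> (F \<in> m \<and> H \<in> m)"
    by (rule notI, elim conjE, drule EFH(2), drule EFH(3), elim disjE) (use joins_neq(8,9,11,13) in simp_all)
  ultimately have "\<exists>x. m \<inter> {E, F, H} \<subseteq> {x}" by blast
  then obtain x where "m \<subseteq> insert x ?V" using sub by blast
  then have "card m \<le> card (insert x ?V)" by (intro card_mono) simp_all
  also have "\<dots> \<le> 3" using V by (simp add: card_insert_if)
  finally show False using card_line[OF m] by simp
qed

text \<open>If \<open>H\<close> were \<open>E\<close>, it would lie on both \<open>AB\<close> and
  \<open>AD\<close> and so be \<open>A\<close>; if it were \<open>F\<close>, the same follows from
  \<open>AC\<close> and \<open>AD\<close>.\<close>

lemma H_neq: "H \<notin> {A, B, C, D, E, F}"
proof -
  have "H \<noteq> E"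
    using point_eq[OF joins(1,7) joins_neq(5), of E A] diagonal_points joins diagonal_not_vertex by auto
  moreover have "H \<noteq> F"
    using point_eq[OF joins(4,7) joins_neq(8), of F A] diagonal_points joins diagonal_not_vertex by auto
  ultimately show ?thesis using diagonal_not_vertex by auto
qed

lemma H_point: "H \<in> points S"
  using line_points[OF joins(7)] diagonal_points by simp

lemma MR_full: "MR_geometry (coloured_by S {A, B, C, D, E, F, H})"
proof -
  have "finite_linear_space (coloured_by S {A, B, C, D, E, F, H})"
    using fls by (simp add: finite_linear_space_def coloured_by_def)
  moreover have "(\<exists>p\<in>l. green_on {A, B, C, D, E, F, H} p = Red) \<and> (\<exists>p\<in>l. green_on {A, B, C, D, E, F, H} p = Green)"
    if "l \<in> lines S" for l
    using line_meets_green[OF that] line_meets_red[OF that] unfolding green_on_def by auto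
  ultimately show ?thesis by (simp add: MR_geometry_def coloured_by_def)
qed

text \<open>Each line keeps at least three of its four points, so none disappears. It keeps a green
  point because \<open>line_meets_green\<close> finds one other than \<open>H\<close>, and a red one
  because \<open>H\<close> is green.\<close>

lemma MR_minus_H: "MR_geometry (induced_subspace (coloured_by S {A, B, C, D, E, F, H}) (points S - {H}))"
proof -
  let ?G = "{A, B, C, D, E, F, H}" and ?T = "points S - {H}"
  let ?M = "induced_subspace (coloured_by S ?G) ?T"
  have fin: "finite (points S)" and sub: "\<And>l. l \<in> lines S \<Longrightarrow> l \<subseteq> points S" and "2 \<le> card (points S)"
    and proper: "\<And>l. l \<in> lines S \<Longrightarrow> \<not> points S \<subseteq> l"
    using fls by (auto simp: finite_linear_space_def)
  have int: "l \<inter> ?T = l - {H}" if "l \<in> lines S" for l using sub[OF that] by auto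
  have card_int: "3 \<le> card (l - {H})" if "l \<in> lines S" for l
    using card_line[OF that] by (simp add: card_Diff_singleton_if)
  have lines: "lines ?M = (\<lambda>l. l - {H}) ` lines S"
  proof -
    have "lines ?M = {l \<inter> ?T |l. l \<in> lines S \<and> 2 \<le> card (l \<inter> ?T)}"
      by (simp add: induced_subspace_def coloured_by_def)
    also have "\<dots> = (\<lambda>l. l \<inter> ?T) ` {l \<in> lines S. 2 \<le> card (l \<inter> ?T)}" by blast
    also have "{l \<in> lines S. 2 \<le> card (l \<inter> ?T)} = lines S" using int card_int by fastforce
    also have "(\<lambda>l. l \<inter> ?T) ` lines S = (\<lambda>l. l - {H}) ` lines S" by (rule image_cong) (auto simp: int)
    finally show ?thesis .
  qed
  have pts: "points ?M = ?T" and col: "colour ?M = green_on ?G"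
    by (simp_all add: induced_subspace_def coloured_by_def)
  have "(\<exists>p\<in>l. green_on ?G p = Red) \<and> (\<exists>p\<in>l. green_on ?G p = Green)" if l: "l \<in> lines ?M" for l
  proof -
    obtain m where m: "m \<in> lines S" "l = m - {H}" using l unfolding lines by blast
    obtain p where p: "p \<in> m" "p \<in> {A, B, C, D, E, F}" using line_meets_green[OF m(1)] by blast
    then have "p \<noteq> H" using H_neq by blast
    moreover have "green_on ?G p = Green" unfolding green_on_def using p(2) by (intro if_P) blast
    moreover obtain q where q: "q \<in> m" "q \<notin> ?G" using line_meets_red[OF m(1)] by blast
    moreover from q have "q \<noteq> H" by blast
    moreover have "green_on ?G q = Red" unfolding green_on_def using q(2) by (rule if_not_P)
    ultimately show ?thesis unfolding m(2) using p(1) by blast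
  qed
  moreover have "finite_linear_space ?M"
    unfolding finite_linear_space_def pts
  proof (intro conjI ballI impI)
    fix x y assume xy: "x \<in> ?T" "y \<in> ?T" "x \<noteq> y"
    then have "\<exists>!l. l \<in> lines S \<and> x \<in> l \<and> y \<in> l" using fls by (simp add: finite_linear_space_def)
    then obtain l where l: "l \<in> lines S" "x \<in> l" "y \<in> l" and u: "\<And>m. m \<in> lines S \<Longrightarrow> x \<in> m \<Longrightarrow> y \<in> m \<Longrightarrow> m = l"
      by blast
    show "\<exists>!l. l \<in> lines ?M \<and> x \<in> l \<and> y \<in> l"
    proof (rule ex1I[of _ "l - {H}"])
      show "l - {H} \<in> lines ?M \<and> x \<in> l - {H} \<and> y \<in> l - {H}" using l xy unfolding lines by simp
      show "m = l - {H}" if "m \<in> lines ?M \<and> x \<in> m \<and> y \<in> m" for m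
        using that u unfolding lines by blast
    qed
  next
    show "finite ?T" using fin by simp
    show "l \<subseteq> ?T" if "l \<in> lines ?M" for l using that sub unfolding lines by blast
    show two: "2 \<le> card l" if "l \<in> lines ?M" for l using that card_int unfolding lines by fastforce
    have "{A, B} \<subseteq> ?T" using vertices H_neq by auto
    then have "card {A, B} \<le> card ?T" using fin by (intro card_mono) simp_all
    then show "2 \<le> card ?T" using vertices by simp
    show "\<not> (\<exists>l\<in>lines ?M. ?T \<subseteq> l)"
    proof
      assume "\<exists>l\<in>lines ?M. ?T \<subseteq> l"
      then obtain l where l: "l \<in> lines S" "?T \<subseteq> l - {H}" unfolding lines by blast
      have "{A, B, C} \<subseteq> ?T" using vertices H_neq by auto
      then have "A \<in> l" "B \<in> l" "C \<in> l" using l(2) by auto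
      then show False using not_three(1)[OF l(1)] by blast
    qed
  qed
  ultimately show ?thesis by (simp add: MR_geometry_def col)
qed

end

section \<open>The plane of order 3 in coordinates\<close>

definition pg23_points :: "(nat \<times> nat \<times> nat) list" where
  "pg23_points = filter (\<lambda>(x, y, z). x = 1 \<or> x = 0 \<and> y = 1 \<or> x = 0 \<and> y = 0 \<and> z = 1)
     (List.product [0..<3] (List.product [0..<3] [0..<3]))"

fun hom :: "nat \<times> nat \<times> nat \<Rightarrow> point" where
  "hom (x, y, z) = Hom x y z"

fun incident :: "nat \<times> nat \<times> nat \<Rightarrow> nat \<times> nat \<times> nat \<Rightarrow> bool" where
  "incident (a, b, c) (x, y, z) \<longleftrightarrow> (a * x + b * y + c * z) mod 3 = 0"

definition pg23_line :: "nat \<times> nat \<times> nat \<Rightarrow> bits" where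
  "pg23_line t = map (incident t) pg23_points"

lemma normalised3_eq: "normalised3 = set pg23_points"
  by (auto simp: normalised3_def pg23_points_def)

text \<open>Lines have the same normalised coordinate vectors as points, so
  \<open>pg23_points\<close> also enumerates the lines. The checks are the axioms of
  \<open>plane_of_order_3\<close>: unique joins, four points on a line, and no two disjoint
  lines.\<close>

lemma pg23_check:
  "length pg23_points = 13" "distinct pg23_points" "linear_rows 13 (map pg23_line pg23_points)"
  "list_all (\<lambda>l. weight (pg23_line l) = 4 \<and> list_all (\<lambda>m. \<not> bdisj (pg23_line l) (pg23_line m)) pg23_points) pg23_points"
  by code_simp+

lemma Collect_triple: "{f x y z |x y z. (x, y, z) \<in> A} = (\<lambda>(x, y, z). f x y z) ` A"
proof (intro equalityI subsetI)
  fix p assume "p \<in> {f x y z |x y z. (x, y, z) \<in> A}"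
  then obtain x y z where "p = f x y z" "(x, y, z) \<in> A" by blast
  then show "p \<in> (\<lambda>(x, y, z). f x y z) ` A" by (intro image_eqI[of _ _ "(x, y, z)"]) simp_all
qed auto

lemma hom_eq: "hom = (\<lambda>(x, y, z). Hom x y z)"
  by auto

lemma inj_hom: "inj hom"
  by (auto simp: inj_def)

lemma points_PG23: "points PG23 = set (map hom pg23_points)"
  unfolding PG23_def by (simp add: Collect_triple normalised3_eq hom_eq)

definition pg23_set :: "nat \<times> nat \<times> nat \<Rightarrow> point set" where
  "pg23_set t = hom ` {u \<in> set pg23_points. incident t u}"

lemma lines_PG23: "lines PG23 = pg23_set ` set pg23_points"
proof -
  have "{Hom x y z |x y z. (x, y, z) \<in> normalised3 \<and> (a * x + b * y + c * z) mod 3 = 0} = pg23_set (a, b, c)" for a b c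
    using Collect_triple[of Hom "{u \<in> set pg23_points. incident (a, b, c) u}"]
    by (simp add: pg23_set_def hom_eq normalised3_eq)
  then show ?thesis
    unfolding PG23_def by (simp add: Collect_triple[of "\<lambda>a b c. pg23_set (a, b, c)"] normalised3_eq)
qed

lemma bits_pg23_set: "bits (map hom pg23_points) (pg23_set t) = pg23_line t"
  using inj_image_mem_iff[OF inj_hom] by (simp add: bits_def pg23_set_def pg23_line_def)

lemma pg23_set_points: "pg23_set t \<subseteq> set (map hom pg23_points)"
  by (auto simp: pg23_set_def)

lemma distinct_hom: "distinct (map hom pg23_points)"
  using pg23_check(2) inj_on_subset[OF inj_hom subset_UNIV] by (simp add: distinct_map)

lemma card_points_PG23: "card (points PG23) = 13"
  unfolding points_PG23 using distinct_card[OF distinct_hom] pg23_check(1) by simp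

interpretation PG23: plane_of_order_3 PG23
proof
  have card_set: "card (pg23_set t) = 4" if "t \<in> set pg23_points" for t
  proof -
    have "card (pg23_set t) = weight (pg23_line t)"
      using weight_bits[OF distinct_hom, of "pg23_set t"] pg23_set_points[of t]
      by (simp add: bits_pg23_set Int_absorb2)
    then show ?thesis using pg23_check(4) that by (simp add: list_all_iff)
  qed
  then show card_line: "card l = 4" if "l \<in> lines PG23" for l using that unfolding lines_PG23 by auto
  show "l \<inter> m \<noteq> {}" if lm: "l \<in> lines PG23" "m \<in> lines PG23" for l m
  proof -
    obtain t u where tu: "t \<in> set pg23_points" "u \<in> set pg23_points" "l = pg23_set t" "m = pg23_set u"
      using lm unfolding lines_PG23 by blast
    then have "\<not> bdisj (pg23_line t) (pg23_line u)" using pg23_check(4) by (simp add: list_all_iff)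
    then show ?thesis unfolding tu bits_pg23_set[symmetric] bdisj_bits by blast
  qed
  have sub: "l \<subseteq> set (map hom pg23_points)" if "l \<in> lines PG23" for l
    using that pg23_set_points unfolding lines_PG23 by blast
  have img: "bits (map hom pg23_points) ` lines PG23 = set (map pg23_line pg23_points)"
    unfolding lines_PG23 image_image bits_pg23_set by simp
  have ex1: "\<exists>!l. l \<in> lines PG23 \<and> x \<in> l \<and> y \<in> l" if "x \<in> points PG23" "y \<in> points PG23" "x \<noteq> y" for x y
    by (rule unique_line_if_linear_rows[OF _ img sub])
      (use that pg23_check(1,3) in \<open>simp_all add: points_PG23\<close>)
  show "finite_linear_space PG23"
    unfolding finite_linear_space_def
  proof (intro conjI ballI impI)
    show "finite (points PG23)" by (simp add: points_PG23)
    show "l \<subseteq> points PG23" if "l \<in> lines PG23" for l using sub[OF that] by (simp only: points_PG23)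
    show "2 \<le> card l" if "l \<in> lines PG23" for l using card_line[OF that] by simp
    show "\<not> (\<exists>l\<in>lines PG23. points PG23 \<subseteq> l)"
    proof
      assume "\<exists>l\<in>lines PG23. points PG23 \<subseteq> l"
      then obtain l where l: "l \<in> lines PG23" "points PG23 \<subseteq> l" by blast
      have "card (points PG23) \<le> card l"
        by (rule card_mono[OF _ l(2)]) (use card_line[OF l(1)] in \<open>auto intro: card_ge_0_finite\<close>)
      then show False using card_line[OF l(1)] card_points_PG23 by simp
    qed
  qed (use ex1 card_points_PG23 in simp_all)
qed

lemma MR13_MR12:
  assumes "quadrangle PG23 A B C D"
  shows "MR_geometry (MR13 A B C D)" "card (points (MR13 A B C D)) = 13"
    and "MR_geometry (MR12 A B C D)" "card (points (MR12 A B C D)) = 12"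
proof -
  interpret Q: quadrangle_in_plane PG23 A B C D by unfold_locales (rule assms)
  have 13: "MR13 A B C D = coloured_by PG23 {A, B, C, D, Q.E, Q.F, Q.H}"
    by (simp add: MR13_def Let_def Q.E_def Q.F_def Q.H_def)
  have 12: "MR12 A B C D = induced_subspace (coloured_by PG23 {A, B, C, D, Q.E, Q.F, Q.H}) (points PG23 - {Q.H})"
    unfolding MR12_def Let_def 13 Q.H_def[symmetric] ..
  show "MR_geometry (MR13 A B C D)" unfolding 13 by (rule Q.MR_full)
  show "card (points (MR13 A B C D)) = 13" unfolding 13 using card_points_PG23 by (simp add: coloured_by_def)
  show "MR_geometry (MR12 A B C D)" unfolding 12 by (rule Q.MR_minus_H)
  show "card (points (MR12 A B C D)) = 12"
    unfolding 12 using card_points_PG23 Q.H_point by (simp add: induced_subspace_def)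
qed

section \<open>The main theorem\<close>

lemma systems_closed: "check_systems 3" "check_systems 4" "check_systems 5" "check_systems 6" "check_systems 7"
  by code_simp+

lemma systems_certified_3_to_6: "check_all targets 3 (systems 3)" "check_all targets 4 (systems 4)"
    "check_all targets 5 (systems 5)" "check_all targets 6 (systems 6)"
  by code_simp+

lemma systems_certified_7: "check_all targets 7 (systems 7)"
  by code_simp

lemma systems_checked:
  assumes "r \<in> {3..7}"
  shows "check_systems r \<and> ([], []) \<in> set (systems r) \<and> check_all targets r (systems r)"
proof -
  from assms consider "r = 3" | "r = 4" | "r = 5" | "r = 6" | "r = 7" by fastforce
  then show ?thesis
    by cases (simp_all add: systems_closed systems_certified_3_to_6 systems_certified_7, simp_all add: systems_def)
qed

lemma table_swapped: "T14_2' = map prod.swap T14_2"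
  by code_simp

lemma table_ok_swapped: "table_ok 7 7 T14_2'"
  by code_simp

text \<open>For 12 and 13 points the size alone singles out the table. This is how
  \<open>MR12\<close> and \<open>MR13\<close> get their tables without coordinates.\<close>

lemma targets_cases:
  assumes "T \<in> set targets"
  shows "\<exists>r g. table_ok r g T \<and> (r + g = 12 \<longrightarrow> T = T12) \<and> (r + g = 13 \<longrightarrow> T = T13)"
proof -
  have small: ?thesis if "table_ok r g T" "r + g = n" "n \<noteq> 12 \<or> T = T12" "n \<noteq> 13 \<or> T = T13" for r g n
    using that by (intro exI[of _ r] exI[of _ g]) auto
  from assms consider "T = T12" | "T = T13" | "T = T14_1" | "T = T14_2" | "T = T14_2'" | "T = T15_1"
    | "T = T15_2" | "T = T15_3r" | "T = T15_3g" | "T = T15_4" | "T = T15_5"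
    unfolding targets_def by auto
  then show ?thesis
  proof cases
    case 1
    show ?thesis by (rule small[of 6 6 12]) (simp_all add: 1 tables_ok table_ok_swapped)
  next
    case 2
    show ?thesis by (rule small[of 6 7 13]) (simp_all add: 2 tables_ok table_ok_swapped)
  next
    case 3
    show ?thesis by (rule small[of 7 7 14]) (simp_all add: 3 tables_ok table_ok_swapped)
  next
    case 4
    show ?thesis by (rule small[of 7 7 14]) (simp_all add: 4 tables_ok table_ok_swapped)
  next
    case 5
    show ?thesis by (rule small[of 7 7 14]) (simp_all add: 5 tables_ok table_ok_swapped)
  next
    case 6
    show ?thesis by (rule small[of 7 8 15]) (simp_all add: 6 tables_ok table_ok_swapped)
  next
    case 7
    show ?thesis by (rule small[of 7 8 15]) (simp_all add: 7 tables_ok table_ok_swapped)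
  next
    case 8
    show ?thesis by (rule small[of 7 8 15]) (simp_all add: 8 tables_ok table_ok_swapped)
  next
    case 9
    show ?thesis by (rule small[of 7 8 15]) (simp_all add: 9 tables_ok table_ok_swapped)
  next
    case 10
    show ?thesis by (rule small[of 7 8 15]) (simp_all add: 10 tables_ok table_ok_swapped)
  next
    case 11
    show ?thesis by (rule small[of 7 8 15]) (simp_all add: 11 tables_ok table_ok_swapped)
  qed
qed

lemma not_equivalent: "MR_geometry M \<Longrightarrow> invariants M \<noteq> invariants M' \<Longrightarrow> \<not> MR_equivalent M M'"
  using invariants_equivalent by blast

theorem theorem2p12:
  fixes A B C D :: point
  assumes "quadrangle PG23 A B C D"
  shows "(\<forall>M \<in> set (MR_list A B C D). MR_geometry M \<and> card (points M) \<le> 15) \<and>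
    sorted_wrt (\<lambda>M M'. \<not> MR_equivalent M M') (MR_list A B C D) \<and>
    (\<forall>G :: 'a coloured. MR_geometry G \<and> card (points G) \<le> 15 \<longrightarrow>
       (\<exists>M \<in> set (MR_list A B C D). MR_equivalent G M))"
proof (intro conjI)
  note tabs = tabulated_MR14_1 tabulated_MR14_2 tabulated_MR15_1 tabulated_MR15_2 tabulated_MR15_3r
    tabulated_MR15_3g tabulated_MR15_4 tabulated_MR15_5
  note plane = MR13_MR12[OF assms]
  have MR: "MR_geometry (MR12 A B C D)" "MR_geometry (MR13 A B C D)" "MR_geometry MR14_1" "MR_geometry MR14_2"
    "MR_geometry MR15_1" "MR_geometry MR15_2" "MR_geometry MR15_3r" "MR_geometry MR15_3g" "MR_geometry MR15_4" "MR_geometry MR15_5"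
    using plane tabs[THEN tabulated.MR] by blast+
  have lengths: "length greens15 = 7" "length reds15 = 8" by (simp_all add: greens15_def reds15_def)
  have inv: "invariants MR14_1 = (14, 7, 7)" "invariants MR14_2 = (14, 3, 3)" "invariants MR15_1 = (15, 4, 4)"
    "invariants MR15_2 = (15, 0, 0)" "invariants MR15_3r = (15, 1, 1)" "invariants MR15_3g = (15, 1, 3)"
    "invariants MR15_4 = (15, 3, 3)" "invariants MR15_5 = (15, 0, 2)"
    using tabs[THEN tabulated.invariants] table_counts set_rows lengths by (simp_all add: counts_of_def)
  \<comment> \<open>The line counts of these two are left open: their numbers of points already
    distinguish them from each other and from the rest.\<close>
  obtain a b c d where inv': "invariants (MR12 A B C D) = (12, a, b)" "invariants (MR13 A B C D) = (13, c, d)"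
    using plane by (simp add: invariants_def)
  have card: "card (points M) = fst (invariants M)" for M :: "point coloured" by (simp add: invariants_def)
  show "\<forall>M \<in> set (MR_list A B C D). MR_geometry M \<and> card (points M) \<le> 15"
    unfolding MR_list_def by (simp add: MR card inv inv')
  show "sorted_wrt (\<lambda>M M'. \<not> MR_equivalent M M') (MR_list A B C D)"
    unfolding MR_list_def by (simp add: not_equivalent MR inv inv')
  show "\<forall>G :: 'a coloured. MR_geometry G \<and> card (points G) \<le> 15 \<longrightarrow>
       (\<exists>M \<in> set (MR_list A B C D). MR_equivalent G M)"
  proof (intro allI impI, elim conjE)
    fix G :: "'a coloured"
    assume G: "MR_geometry G" "card (points G) \<le> 15"
    obtain c T where T: "T \<in> set targets" "realises c T G" using MR_classified[OF systems_checked G] by blast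
    have equiv: "\<exists>M\<in>set (MR_list A B C D). MR_equivalent G M"
      if "realises c T G" "table_ok r g T" "MR_geometry M" "realises c' T M" "M \<in> set (MR_list A B C D)" for c c' T M r g
      using MR_equivalent_if_realise[OF G(1) that(1,3,4,2)] that(5) by blast
    have mem: "M \<in> set (MR_list A B C D)" if "M \<in> {MR12 A B C D, MR13 A B C D, MR14_1, MR14_2, MR15_1, MR15_2, MR15_3r, MR15_3g, MR15_4, MR15_5}" for M
      using that by (simp add: MR_list_def)
    \<comment> \<open>The classification is applied to the target itself. It yields some colour and
      some table, and having twelve points leaves only \<open>T12\<close>.\<close>
    have r12: "\<exists>c. realises c T12 (MR12 A B C D)"
    proof -
      obtain c T where T: "T \<in> set targets" "realises c T (MR12 A B C D)"
        using MR_classified[OF systems_checked plane(3)] plane(4) by auto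
      then show ?thesis using targets_cases[OF T(1)] card_realises[OF plane(3) T(2)] plane(4) by metis
    qed
    have r13: "\<exists>c. realises c T13 (MR13 A B C D)"
    proof -
      obtain c T where T: "T \<in> set targets" "realises c T (MR13 A B C D)"
        using MR_classified[OF systems_checked plane(1)] plane(2) by auto
      then show ?thesis using targets_cases[OF T(1)] card_realises[OF plane(1) T(2)] plane(2) by metis
    qed
    note real = tabs[THEN tabulated.realises]
    from T(1) consider "T = T12" | "T = T13" | "T = T14_1" | "T = T14_2" | "T = T14_2'" | "T = T15_1"
      | "T = T15_2" | "T = T15_3r" | "T = T15_3g" | "T = T15_4" | "T = T15_5"
      unfolding targets_def by auto
    then show "\<exists>M\<in>set (MR_list A B C D). MR_equivalent G M"
    proof cases
      case 1
      then show ?thesis using equiv[OF _ tables_ok(1) MR(1)] r12 T(2) mem by blast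
    next
      case 2
      then show ?thesis using equiv[OF _ tables_ok(2) MR(2)] r13 T(2) mem by blast
    next
      case 3
      then show ?thesis using equiv[OF _ tables_ok(3) MR(3) real(1)] T(2) mem by blast
    next
      case 4
      then show ?thesis using equiv[OF _ tables_ok(4) MR(4) real(2)] T(2) mem by blast
    next
      case 5
      \<comment> \<open>Both classes have seven points here; taking the other one for the first
        components turns \<open>T14_2'\<close> into \<open>T14_2\<close>.\<close>
      then have "realises (other_colour c) T14_2 G" using T(2) table_swapped realises_swap by metis
      then show ?thesis using equiv[OF _ tables_ok(4) MR(4) real(2)] mem by blast
    next
      case 6
      then show ?thesis using equiv[OF _ tables_ok(5) MR(5) real(3)] T(2) mem by blast
    next
      case 7
      then show ?thesis using equiv[OF _ tables_ok(6) MR(6) real(4)] T(2) mem by blast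
    next
      case 8
      then show ?thesis using equiv[OF _ tables_ok(7) MR(7) real(5)] T(2) mem by blast
    next
      case 9
      then show ?thesis using equiv[OF _ tables_ok(8) MR(8) real(6)] T(2) mem by blast
    next
      case 10
      then show ?thesis using equiv[OF _ tables_ok(9) MR(9) real(7)] T(2) mem by blast
    next
      case 11
      then show ?thesis using equiv[OF _ tables_ok(10) MR(10) real(8)] T(2) mem by blast
    qed
  qed
qed

end
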